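(* Let $A$ be a semisimple complex Banach algebra with identity. Every $a\in\mathrm{Soc}\,A$ with $\mathrm{Tr}(a)=0$ can be expressed as a commutator $a=[x,y]$ with $x,y\in\mathrm{Soc}\,A$ if and only if $\mathrm{Soc}\,A$ is a minimal two-sided ideal of $A$. Moreover, in this case, for every $a\in\mathrm{Soc}\,A$ with $\mathrm{Tr}(a)=0$ the elements $x,y\in\mathrm{Soc}\,A$ with $a=[x,y]$ can be chosen such that $\mathrm{rank}(x)\le\mathrm{rank}(a)$ and $\mathrm{rank}(y)\le\mathrm{rank}(a)$. In particular, if $X$ is a complex Banach space and $A=B(X)$ is the algebra of bounded linear operators on $X$, then every $a\in\mathrm{Soc}\,A$ with $\mathrm{Tr}(a)=0$ is of the form $[x,y]$ with $x,y\in\mathrm{Soc}\,A$ of rank at most $\mathrm{rank}(a)$.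
   Context: $[x,y]=xy-yx$. For $x\in A$, $\sigma(x)$ is the spectrum and $\sigma'(x)=\sigma(x)\setminus\{0\}$. The rank of $a\in A$ is $\mathrm{rank}(a)=\sup_{x\in A}\#\sigma'(xa)\in\{0,1,2,\dots\}\cup\{\infty\}$. $\mathrm{Soc}\,A$ is the socle of $A$ (the sum of all minimal left ideals, $\{0\}$ if there are none); for semisimple $A$ it coincides with the set of elements of finite rank. Trace: for $a\in\mathrm{Soc}\,A$ put $E(a)=\{x\in A:\#\sigma'(xa)=\mathrm{rank}(a)\}$ (a dense open subset of $A$). For $\lambda\in\sigma(a)$, let $B(\lambda,r)$ be an open disk containing no other point of $\sigma(a)$; there is an open ball $U\subseteq A$ centered at $\mathbf 1$ such that $\#[\sigma(xa)\cap B(\lambda,r)]$ is constant for $x\in E(a)\cap U$, and this constant is the multiplicity $m(\lambda,a)$. Then $\mathrm{Tr}(a)=\sum_{\lambda\in\sigma(a)}\lambda\, m(\lambda,a)$. For $A=B(X)$, this rank and trace coincide with the usual operator rank and the usual trace of finite-rank operators. A minimal two-sided ideal is a two-sided ideal that contains no two-sided ideals (of $A$) other than $\{0\}$ and itself (so $\{0\}$ counts as minimal under this definition). *)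

theory Defs
  imports "HOL-Analysis.Analysis" "HOL-Library.Extended_Nat"
begin

section \<open>Complex Banach spaces and unital complex Banach algebras\<close>

text \<open>The real vector space structure of the library is kept and extended by a compatible
  multiplication by complex scalars.\<close>

class complex_vector = real_vector +
  fixes scaleC :: "complex \<Rightarrow> 'a \<Rightarrow> 'a" (infixr "*\<^sub>C" 75)
  assumes scaleC_add_right: "c *\<^sub>C (x + y) = c *\<^sub>C x + c *\<^sub>C y"
    and scaleC_add_left: "(c + d) *\<^sub>C x = c *\<^sub>C x + d *\<^sub>C x"
    and scaleC_scaleC: "c *\<^sub>C d *\<^sub>C x = (c * d) *\<^sub>C x"
    and scaleC_one: "1 *\<^sub>C x = x"
    and scaleR_scaleC: "r *\<^sub>R x = complex_of_real r *\<^sub>C x"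

class complex_normed_vector = complex_vector + real_normed_vector +
  assumes norm_scaleC: "norm (c *\<^sub>C x) = cmod c * norm x"

class complex_banach = complex_normed_vector + banach

text \<open>Neither \<open>norm 1 = 1\<close> nor \<open>0 \<noteq> 1\<close> is required: this way the bounded operators on an
  arbitrary complex Banach space, the zero space included, form an instance. This is why the
  class is built on \<^class>\<open>monoid_mult\<close> and not on \<^class>\<open>real_normed_algebra_1\<close>.\<close>

class complex_banach_algebra_1 = complex_banach + real_normed_algebra + monoid_mult +
  assumes mult_scaleC_left: "(c *\<^sub>C x) * y = c *\<^sub>C (x * y)"
    and mult_scaleC_right: "x * (c *\<^sub>C y) = c *\<^sub>C (x * y)"


section \<open>The algebra of bounded linear operators on a complex Banach space\<close>

text \<open>The library type of bounded linear maps only provides \<open>\<real>\<close>-linear ones; the operators wanted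
  here are those that in addition commute with complex scalars.\<close>

typedef (overloaded) 'x bounded_op =
  "{T :: 'x::complex_normed_vector \<Rightarrow>\<^sub>L 'x.
     \<forall>c x. blinfun_apply T (c *\<^sub>C x) = c *\<^sub>C blinfun_apply T x}"
  morphisms blinfun_of_op Op
proof
  have "c *\<^sub>C (0::'x) = 0" for c
    using scaleC_add_right[of c "0::'x" 0] by simp
  then show "(0 :: 'x \<Rightarrow>\<^sub>L 'x) \<in> {T. \<forall>c x. blinfun_apply T (c *\<^sub>C x) = c *\<^sub>C blinfun_apply T x}"
    by simp
qed

setup_lifting type_definition_bounded_op

lemma scaleC_zero_right: "c *\<^sub>C (0::'a::complex_vector) = 0"
  using scaleC_add_right[of c "0::'a" 0] by simp

lemma scaleC_minus_right: "c *\<^sub>C (- x) = - (c *\<^sub>C (x::'a::complex_vector))"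
  using scaleC_add_right[of c x "- x"] by (simp add: scaleC_zero_right eq_neg_iff_add_eq_0 add.commute)

lemma scaleC_diff_right: "c *\<^sub>C (x - y) = c *\<^sub>C x - c *\<^sub>C (y::'a::complex_vector)"
  using scaleC_add_right[of c x "- y"] by (simp add: scaleC_minus_right)

lemma scaleC_scaleR_commute: "c *\<^sub>C (r *\<^sub>R x) = r *\<^sub>R (c *\<^sub>C (x::'a::complex_vector))"
  by (simp add: scaleR_scaleC scaleC_scaleC mult.commute)

lemma bounded_linear_scaleC: "bounded_linear (\<lambda>x::'a::complex_normed_vector. c *\<^sub>C x)"
  by (rule bounded_linear_intro[where K = "cmod c"])
    (simp_all add: scaleC_add_right scaleC_scaleR_commute norm_scaleC mult.commute)

lift_definition scaleC_blinfun ::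
    "complex \<Rightarrow> ('a::complex_normed_vector \<Rightarrow>\<^sub>L 'a) \<Rightarrow> ('a \<Rightarrow>\<^sub>L 'a)"
  is "\<lambda>c f x. c *\<^sub>C f x"
  by (rule bounded_linear_compose[OF bounded_linear_scaleC])

lemma scaleC_blinfun_apply [simp]:
  "blinfun_apply (scaleC_blinfun c T) x = c *\<^sub>C blinfun_apply T x"
  by (simp add: scaleC_blinfun.rep_eq)

instantiation bounded_op :: (complex_normed_vector) complex_normed_vector
begin

lift_definition zero_bounded_op :: "'a bounded_op" is 0
  by (simp add: scaleC_zero_right)

lift_definition plus_bounded_op :: "'a bounded_op \<Rightarrow> 'a bounded_op \<Rightarrow> 'a bounded_op" is "(+)"
  by (simp add: blinfun.add_left scaleC_add_right)

lift_definition minus_bounded_op :: "'a bounded_op \<Rightarrow> 'a bounded_op \<Rightarrow> 'a bounded_op" is "(-)"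
  by (simp add: blinfun.diff_left scaleC_diff_right)

lift_definition uminus_bounded_op :: "'a bounded_op \<Rightarrow> 'a bounded_op" is uminus
  by (simp add: blinfun.minus_left scaleC_minus_right)

lift_definition scaleR_bounded_op :: "real \<Rightarrow> 'a bounded_op \<Rightarrow> 'a bounded_op" is "(*\<^sub>R)"
  by (simp add: blinfun.scaleR_left scaleC_scaleR_commute)

lift_definition scaleC_bounded_op :: "complex \<Rightarrow> 'a bounded_op \<Rightarrow> 'a bounded_op"
  is scaleC_blinfun
  by (simp add: scaleC_scaleC mult.commute)

lift_definition norm_bounded_op :: "'a bounded_op \<Rightarrow> real" is norm .

definition dist_bounded_op :: "'a bounded_op \<Rightarrow> 'a bounded_op \<Rightarrow> real"
  where "dist_bounded_op S T = norm (S - T)"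

definition [code del]: "(uniformity :: ('a bounded_op \<times> 'a bounded_op) filter) =
  (INF e\<in>{0 <..}. principal {(S, T). dist S T < e})"

definition open_bounded_op :: "'a bounded_op set \<Rightarrow> bool"
  where [code del]:
    "open_bounded_op U = (\<forall>S\<in>U. \<forall>\<^sub>F (S', T) in uniformity. S' = S \<longrightarrow> T \<in> U)"

definition sgn_bounded_op :: "'a bounded_op \<Rightarrow> 'a bounded_op"
  where "sgn_bounded_op T = inverse (norm T) *\<^sub>R T"

instance
proof
  fix c d :: complex and r s :: real and S T V :: "'a bounded_op"
  show "S + T + V = S + (T + V)" by transfer simp
  show "S + T = T + S" by transfer simp
  show "0 + S = S" by transfer simp
  show "- S + S = 0" by transfer simp
  show "S - T = S + - T" by transfer simp
  show "r *\<^sub>R (S + T) = r *\<^sub>R S + r *\<^sub>R T" by transfer (simp add: scaleR_add_right)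
  show "(r + s) *\<^sub>R S = r *\<^sub>R S + s *\<^sub>R S" by transfer (simp add: scaleR_add_left)
  show "r *\<^sub>R s *\<^sub>R S = (r * s) *\<^sub>R S" by transfer simp
  show "1 *\<^sub>R S = S" by transfer simp
  show "c *\<^sub>C (S + T) = c *\<^sub>C S + c *\<^sub>C T"
    by transfer (rule blinfun_eqI, simp add: blinfun.add_left scaleC_add_right)
  show "(c + d) *\<^sub>C S = c *\<^sub>C S + d *\<^sub>C S"
    by transfer (rule blinfun_eqI, simp add: blinfun.add_left scaleC_add_left)
  show "c *\<^sub>C d *\<^sub>C S = (c * d) *\<^sub>C S"
    by transfer (rule blinfun_eqI, simp add: scaleC_scaleC)
  show "1 *\<^sub>C S = S"
    by transfer (rule blinfun_eqI, simp add: scaleC_one)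
  show "r *\<^sub>R S = complex_of_real r *\<^sub>C S"
    by transfer (rule blinfun_eqI, simp add: blinfun.scaleR_left scaleR_scaleC)
  show "dist S T = norm (S - T)" by (rule dist_bounded_op_def)
  show "sgn S = inverse (norm S) *\<^sub>R S" by (rule sgn_bounded_op_def)
  show "(uniformity :: ('a bounded_op \<times> 'a bounded_op) filter) =
      (INF e\<in>{0 <..}. principal {(S, T). dist S T < e})"
    by (rule uniformity_bounded_op_def)
  show "open U = (\<forall>S\<in>U. \<forall>\<^sub>F (S', T) in uniformity. S' = S \<longrightarrow> T \<in> U)"
    for U :: "'a bounded_op set"
    by (rule open_bounded_op_def)
  show "(norm S = 0) = (S = 0)" by transfer simp
  show "norm (S + T) \<le> norm S + norm T" by transfer (rule norm_triangle_ineq)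
  show "norm (r *\<^sub>R S) = \<bar>r\<bar> * norm S" by transfer simp
  show "norm (c *\<^sub>C S) = cmod c * norm S"
  proof transfer
    fix c :: complex and T :: "'a \<Rightarrow>\<^sub>L 'a"
    have le: "norm (scaleC_blinfun c T) \<le> cmod c * norm T"
      for c and T :: "'a \<Rightarrow>\<^sub>L 'a"
      by (rule norm_blinfun_bound)
        (auto simp: norm_scaleC mult.assoc intro!: mult_left_mono norm_blinfun)
    show "norm (scaleC_blinfun c T) = cmod c * norm T"
    proof (cases "c = 0")
      case True
      then show ?thesis using le[of c T] by simp
    next
      case False
      define V where "V = scaleC_blinfun c T"
      have "T = scaleC_blinfun (inverse c) V"
        by (rule blinfun_eqI) (simp add: V_def scaleC_scaleC False scaleC_one)
      then have "norm T \<le> cmod (inverse c) * norm V"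
        using le[of "inverse c" V] by simp
      then have "cmod c * norm T \<le> cmod c * (cmod (inverse c) * norm V)"
        by (rule mult_left_mono) simp
      also have "\<dots> = norm V"
        using False by (simp add: norm_inverse)
      finally have "cmod c * norm T \<le> norm V" .
      then show ?thesis using le[of c T] by (simp add: V_def)
    qed
  qed
qed

end

lemma closed_range_blinfun_of_op:
  "closed {T :: 'a::complex_normed_vector \<Rightarrow>\<^sub>L 'a.
     \<forall>c x. blinfun_apply T (c *\<^sub>C x) = c *\<^sub>C blinfun_apply T x}"
proof (intro closed_Collect_all closed_Collect_eq)
  fix c :: complex and x :: 'a
  show "continuous_on UNIV (\<lambda>T :: 'a \<Rightarrow>\<^sub>L 'a. blinfun_apply T (c *\<^sub>C x))"
    by (rule linear_continuous_on[OF blinfun.bounded_linear_left])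
  show "continuous_on UNIV (\<lambda>T :: 'a \<Rightarrow>\<^sub>L 'a. c *\<^sub>C blinfun_apply T x)"
    by (rule linear_continuous_on[OF bounded_linear_compose[OF bounded_linear_scaleC
            blinfun.bounded_linear_left]])
qed

instance bounded_op :: (complex_banach) complex_banach
proof
  fix X :: "nat \<Rightarrow> 'a bounded_op"
  have nrm: "norm (blinfun_of_op S - blinfun_of_op T) = norm (S - T)" for S T :: "'a bounded_op"
    by transfer simp
  assume "Cauchy X"
  then have "Cauchy (\<lambda>n. blinfun_of_op (X n))"
    by (simp add: Cauchy_def dist_norm nrm)
  then obtain L where L: "(\<lambda>n. blinfun_of_op (X n)) \<longlonglongrightarrow> L"
    using Cauchy_convergent_iff convergent_def by blast
  have "L \<in> {T. \<forall>c x. blinfun_apply T (c *\<^sub>C x) = c *\<^sub>C blinfun_apply T x}"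
    by (rule closed_sequentially[OF closed_range_blinfun_of_op _ L]) (rule blinfun_of_op)
  then obtain S where "L = blinfun_of_op S"
    using Op_inverse[of L, symmetric] by blast
  with L have "X \<longlonglongrightarrow> S"
    by (simp add: LIMSEQ_def dist_norm nrm)
  then show "convergent X"
    by (rule convergentI)
qed

instantiation bounded_op :: (complex_banach) complex_banach_algebra_1
begin

lift_definition one_bounded_op :: "'a bounded_op" is id_blinfun
  by simp

lift_definition times_bounded_op :: "'a bounded_op \<Rightarrow> 'a bounded_op \<Rightarrow> 'a bounded_op"
  is "(o\<^sub>L)"
  by simp

instance
proof
  fix c :: complex and r :: real and S T V :: "'a bounded_op"
  show "S * T * V = S * (T * V)" by transfer (simp add: blinfun_eqI)
  show "1 * S = S" by transfer (simp add: blinfun_eqI)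
  show "S * 1 = S" by transfer (simp add: blinfun_eqI)
  show "(S + T) * V = S * V + T * V"
    by transfer (rule blinfun_eqI, simp add: blinfun.add_left)
  show "S * (T + V) = S * T + S * V"
    by transfer (rule blinfun_eqI, simp add: blinfun.add_left blinfun.add_right)
  show "(r *\<^sub>R S) * T = r *\<^sub>R (S * T)"
    by transfer (rule blinfun_eqI, simp add: blinfun.scaleR_left)
  show "S * (r *\<^sub>R T) = r *\<^sub>R (S * T)"
    by transfer (rule blinfun_eqI, simp add: blinfun.scaleR_left blinfun.scaleR_right)
  show "norm (S * T) \<le> norm S * norm T"
    by transfer (rule norm_blinfun_compose)
  show "(c *\<^sub>C S) * T = c *\<^sub>C (S * T)"
    by transfer (rule blinfun_eqI, simp)
  show "S * (c *\<^sub>C T) = c *\<^sub>C (S * T)"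
    by transfer (rule blinfun_eqI, simp)
qed

end


section \<open>Ideals, radical and socle\<close>

definition left_ideal :: "'a::complex_banach_algebra_1 set \<Rightarrow> bool" where
  "left_ideal I \<longleftrightarrow>
     0 \<in> I \<and> (\<forall>x\<in>I. \<forall>y\<in>I. x + y \<in> I) \<and> (\<forall>a. \<forall>x\<in>I. a * x \<in> I)"

definition two_sided_ideal :: "'a::complex_banach_algebra_1 set \<Rightarrow> bool" where
  "two_sided_ideal I \<longleftrightarrow> left_ideal I \<and> (\<forall>a. \<forall>x\<in>I. x * a \<in> I)"

text \<open>As usual a minimal left ideal is nonzero, whereas \<open>{0}\<close> does count as a minimal
  two-sided ideal.\<close>

definition minimal_left_ideal :: "'a::complex_banach_algebra_1 set \<Rightarrow> bool" where
  "minimal_left_ideal I \<longleftrightarrow>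
     left_ideal I \<and> I \<noteq> {0} \<and> (\<forall>J. left_ideal J \<and> J \<subseteq> I \<longrightarrow> J = {0} \<or> J = I)"

definition minimal_two_sided_ideal :: "'a::complex_banach_algebra_1 set \<Rightarrow> bool" where
  "minimal_two_sided_ideal I \<longleftrightarrow>
     two_sided_ideal I \<and> (\<forall>J. two_sided_ideal J \<and> J \<subseteq> I \<longrightarrow> J = {0} \<or> J = I)"

definition maximal_left_ideal :: "'a::complex_banach_algebra_1 set \<Rightarrow> bool" where
  "maximal_left_ideal I \<longleftrightarrow>
     left_ideal I \<and> I \<noteq> UNIV \<and> (\<forall>J. left_ideal J \<and> I \<subseteq> J \<longrightarrow> J = I \<or> J = UNIV)"

definition jacobson_radical :: "'a::complex_banach_algebra_1 set" where
  "jacobson_radical = \<Inter> {I. maximal_left_ideal I}"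

definition semisimple :: "'a::complex_banach_algebra_1 itself \<Rightarrow> bool" where
  "semisimple _ \<longleftrightarrow> (jacobson_radical :: 'a set) = {0}"

text \<open>The sum of all minimal left ideals; the empty sum makes it \<open>{0}\<close> if there are none.\<close>

definition Soc :: "'a::complex_banach_algebra_1 set" where
  "Soc = {(\<Sum>L\<in>F. f L) | F f. finite F \<and> (\<forall>L\<in>F. minimal_left_ideal L \<and> f L \<in> L)}"


section \<open>Spectrum, rank and trace\<close>

definition commutator :: "'a::complex_banach_algebra_1 \<Rightarrow> 'a \<Rightarrow> 'a" where
  "commutator x y = x * y - y * x"

definition spectrum :: "'a::complex_banach_algebra_1 \<Rightarrow> complex set" where
  "spectrum x = {c. \<not> (\<exists>y. (c *\<^sub>C 1 - x) * y = 1 \<and> y * (c *\<^sub>C 1 - x) = 1)}"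

definition nonzero_spectrum :: "'a::complex_banach_algebra_1 \<Rightarrow> complex set" where
  "nonzero_spectrum x = spectrum x - {0}"

text \<open>Unlike \<^const>\<open>card\<close>, this is \<open>\<infinity>\<close> on infinite sets.\<close>

definition ecard :: "'b set \<Rightarrow> enat" where
  "ecard S = (if finite S then enat (card S) else \<infinity>)"

definition spectral_rank :: "'a::complex_banach_algebra_1 \<Rightarrow> enat" where
  "spectral_rank a = (SUP x. ecard (nonzero_spectrum (x * a)))"

definition rank_attained :: "'a::complex_banach_algebra_1 \<Rightarrow> 'a set" where
  "rank_attained a = {x. ecard (nonzero_spectrum (x * a)) = spectral_rank a}"

text \<open>The multiplicity of a point \<open>c\<close> of the spectrum of \<open>a\<close>: the radius \<open>r\<close> of the disk isolating
  \<open>c\<close> in the spectrum ranges over all sufficiently small numbers. This excludes disks with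
  another point of the spectrum of \<open>a\<close> on the boundary circle, for which the number of points
  of the spectrum of \<open>x * a\<close> inside need not be constant near \<open>x = 1\<close>.\<close>

definition multiplicity_at :: "complex \<Rightarrow> 'a::complex_banach_algebra_1 \<Rightarrow> nat" where
  "multiplicity_at c a = (THE m. \<forall>\<^sub>F r in at_right 0.
     spectrum a \<inter> ball c r = {c} \<and>
     (\<exists>\<epsilon>>0. \<forall>x \<in> rank_attained a \<inter> ball 1 \<epsilon>. ecard (spectrum (x * a) \<inter> ball c r) = enat m))"

text \<open>Only meaningful for elements of the socle, whose spectrum is finite.\<close>

definition Tr :: "'a::complex_banach_algebra_1 \<Rightarrow> complex" where
  "Tr a = (\<Sum>c\<in>spectrum a. c * of_nat (multiplicity_at c a))"

end

theory Submission
  imports Defs "HOL-Complex_Analysis.Cauchy_Integral_Formula"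
begin

text \<open>
  Let \<open>e\<close> be a minimal idempotent, so that \<open>e A e = \<complex> e\<close> by Gelfand--Mazur. The ideal \<open>A e A\<close> acts on
  \<open>A e\<close> by finite-rank operators and carries a trace \<open>\<tau>\<close>. If \<open>p\<close> projects \<open>A e\<close> onto the range
  of \<open>a \<in> A e A\<close>, the nonzero spectrum of \<open>x a\<close> consists of the nonzero eigenvalues of \<open>a x\<close> on the
  range of \<open>p\<close>. Hence the spectral rank of \<open>a\<close> is the dimension of that range; triangularising \<open>a x\<close>
  and comparing power sums as \<open>x \<rightarrow> 1\<close> shows that the spectral trace is \<open>\<tau>\<close>.

  If the socle is minimal, it equals \<open>A e A\<close>. When \<open>\<tau> a = 0\<close>, write \<open>p\<close> as a sum of orthogonal minimal
  idempotents \<open>e\<^sub>i\<close> with \<open>e\<^sub>i a e\<^sub>i = 0\<close>. Since \<open>a = p a\<close> is the sum of the \<open>e\<^sub>i a e\<^sub>j\<close> and the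
  \<open>e\<^sub>i a (1 - p)\<close>, it is the commutator of \<open>D = \<Sum> i e\<^sub>i\<close> with
  \<open>\<Sum> (i - j)\<inverse> e\<^sub>i a e\<^sub>j + \<Sum> i\<inverse> e\<^sub>i a (1 - p)\<close>, and both factors have range inside that of \<open>p\<close>.

  If the socle is not minimal, there are minimal idempotents with \<open>e A f = 0\<close>. Then \<open>e - f\<close> has spectral
  trace \<open>0\<close>, but its component \<open>e\<close> in \<open>A e A\<close> has \<open>\<tau> e = 1\<close>, so it is not a commutator.
\<close>

section \<open>Bounded functionals\<close>

text \<open>Semisimplicity enters through semiprimeness: \<open>a A a = 0\<close> forces
  \<open>a = 0\<close>. This makes the pairing of \<open>A e\<close> with \<open>e A\<close>
  nondegenerate, so that linear algebra on \<open>A e\<close> can be done with elements of the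
  algebra and without determinants: eigenvalues come from Gelfand--Mazur in a corner, and dimensions
  are read off as traces of idempotents. The obstacle is the spectral trace. It counts points of the
  spectrum of \<open>x a\<close> for \<open>x\<close> near \<open>1\<close>, so it is not visibly
  additive. Points and eigenvalues can be identified only where all eigenvalues are simple and
  nonzero; hence triangularisation carries a perturbation that separates them. Instead of following
  roots continuously, one extracts convergent subsequences and recovers the limits from their power
  sums. In the commutator the weights of \<open>D\<close> must be distinct, to divide the
  off-diagonal blocks, and nonzero, because \<open>D\<close> has weight \<open>0\<close> on the
  complement of \<open>p\<close>. For the converse, \<open>e - f\<close> lies in neither
  \<open>A e A\<close> nor \<open>A f A\<close>, so its spectral trace is computed directly. Bounded
  functionals serve twice: for Liouville's theorem and for the rank-one operators on
  \<open>X\<close>.\<close>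

definition sublinear :: "('v::real_normed_vector \<Rightarrow> real) \<Rightarrow> bool" where
  "sublinear p \<longleftrightarrow> (\<forall>x y. p (x + y) \<le> p x + p y) \<and> (\<forall>c>0. \<forall>x. p (c *\<^sub>R x) \<le> c * p x)"

lemma sublinear_add: "sublinear p \<Longrightarrow> p (x + y) \<le> p x + p y"
  and sublinear_scale_le: "sublinear p \<Longrightarrow> c > 0 \<Longrightarrow> p (c *\<^sub>R x) \<le> c * p x"
  by (auto simp: sublinear_def)

lemma sublinear_zero: assumes "sublinear p" shows "p 0 = 0"
  using sublinear_add[OF assms, of 0 0] sublinear_scale_le[OF assms, of "1/2" 0] by simp

lemma sublinear_scale:
  assumes "sublinear p" "c \<ge> 0" shows "p (c *\<^sub>R x) = c * p x"
proof (cases "c = 0")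
  case True then show ?thesis using sublinear_zero[OF assms(1)] by simp
next
  case False
  then have c: "c > 0" using assms by simp
  have "p (inverse c *\<^sub>R (c *\<^sub>R x)) \<le> inverse c * p (c *\<^sub>R x)"
    using sublinear_scale_le[OF assms(1), of "inverse c" "c *\<^sub>R x"] c by simp
  then have "c * p x \<le> p (c *\<^sub>R x)" using c by (simp add: field_simps)
  with sublinear_scale_le[OF assms(1) c] show ?thesis by (simp add: antisym)
qed

lemma sublinear_minus_le: "sublinear p \<Longrightarrow> - p (- x) \<le> p x"
  using sublinear_add[of p x "- x"] sublinear_zero[of p] by simp

text \<open>Moving in the direction \<open>z\<close> and subtracting the cost \<open>t * p z\<close>
  can only lower the functional: \<open>t = 0\<close> gives \<open>q \<le> p\<close>,
  \<open>t = 1\<close> gives the last inequality, and \<open>- p (- x)\<close> keeps the infimum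
  finite. For a minimal \<open>p\<close> this forces \<open>q = p\<close>, hence additivity.\<close>

lemma sublinear_reduce:
  fixes p :: "'v::real_normed_vector \<Rightarrow> real"
  assumes p: "sublinear p"
  obtains q where "sublinear q" "q \<le> p" "\<And>x. q x \<le> p (x + z) - p z"
proof
  define q where "q x = (INF t\<in>{0..}. p (x + t *\<^sub>R z) - t * p z)" for x
  have lower: "- p (- x) \<le> p (x + t *\<^sub>R z) - t * p z" if "t \<ge> 0" for x t
    using sublinear_add[OF p, of "x + t *\<^sub>R z" "- x"] sublinear_scale[OF p that, of z] by simp
  have bdd: "bdd_below ((\<lambda>t. p (x + t *\<^sub>R z) - t * p z) ` {0..})" for x
    using lower by (auto simp: bdd_below_def)
  have q_le: "q x \<le> p (x + t *\<^sub>R z) - t * p z" if "t \<ge> 0" for x t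
    unfolding q_def using bdd that by (intro cINF_lower) auto
  have q_ge: "w \<le> q x" if "\<And>t. t \<ge> 0 \<Longrightarrow> w \<le> p (x + t *\<^sub>R z) - t * p z" for w x
    unfolding q_def using that by (intro cINF_greatest) auto
  show "q \<le> p" using q_le[of 0] by (simp add: le_fun_def)
  show "q x \<le> p (x + z) - p z" for x using q_le[of 1 x] by simp
  show "sublinear q" unfolding sublinear_def
  proof safe
    fix x y :: 'v
    \<comment> \<open>The two infima are removed one after the other; the parameters
      \<open>s\<close> for \<open>x\<close> and \<open>t\<close> for \<open>y\<close> combine to
      \<open>s + t\<close> for the sum.\<close>
    have "q (x + y) - (p (y + t *\<^sub>R z) - t * p z) \<le> q x" if t: "t \<ge> 0" for t
    proof (rule q_ge)
      fix s :: real assume s: "s \<ge> 0"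
      have "q (x + y) \<le> p (x + y + (s + t) *\<^sub>R z) - (s + t) * p z" using q_le s t by simp
      moreover have "p (x + y + (s + t) *\<^sub>R z) \<le> p (x + s *\<^sub>R z) + p (y + t *\<^sub>R z)"
        using sublinear_add[OF p, of "x + s *\<^sub>R z" "y + t *\<^sub>R z"] by (simp add: algebra_simps)
      ultimately show "q (x + y) - (p (y + t *\<^sub>R z) - t * p z) \<le> p (x + s *\<^sub>R z) - s * p z"
        by (simp add: algebra_simps)
    qed
    then have "q (x + y) - q x \<le> q y" by (intro q_ge) (simp add: algebra_simps)
    then show "q (x + y) \<le> q x + q y" by simp
  next
    fix c :: real and x :: 'v assume c: "c > 0"
    have "q (c *\<^sub>R x) / c \<le> q x"
    proof (rule q_ge)
      fix t :: real assume t: "t \<ge> 0"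
      have "q (c *\<^sub>R x) \<le> p (c *\<^sub>R (x + t *\<^sub>R z)) - c * t * p z"
        using q_le[of "c * t" "c *\<^sub>R x"] c t by (simp add: algebra_simps)
      also have "\<dots> = c * (p (x + t *\<^sub>R z) - t * p z)"
        using sublinear_scale[OF p, of c "x + t *\<^sub>R z"] c by (simp add: algebra_simps)
      finally show "q (c *\<^sub>R x) / c \<le> p (x + t *\<^sub>R z) - t * p z"
        using c by (simp add: field_simps)
    qed
    then show "q (c *\<^sub>R x) \<le> c * q x" using c by (simp add: field_simps)
  qed
qed

text \<open>Hahn--Banach: a sublinear functional that is minimal for the pointwise order is linear.\<close>

lemma linear_below_sublinear:
  fixes q :: "'v::real_normed_vector \<Rightarrow> real"
  assumes q: "sublinear q"
  obtains u where "linear u" "\<And>x. u x \<le> q x"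
proof -
  define S where "S = {p. sublinear p \<and> p \<le> q}"
  have "\<exists>m\<in>S. \<forall>a\<in>S. a \<le> m \<longrightarrow> a = m"
  proof (rule predicate_Zorn[of S "\<lambda>f g. g \<le> f"])
    show "partial_order_on S (relation_of (\<lambda>f g. g \<le> f) S)"
      by (rule partial_order_on_relation_ofI) auto
  next
    fix C assume C: "C \<in> Chains (relation_of (\<lambda>f g. g \<le> f) S)"
    have CS: "C \<subseteq> S" using C by (auto simp: Chains_def relation_of_def)
    have tot: "f \<le> g \<or> g \<le> f" if "f \<in> C" "g \<in> C" for f g
      using C that by (auto simp: Chains_def relation_of_def)
    show "\<exists>u\<in>S. \<forall>a\<in>C. u \<le> a"
    proof (cases "C = {}")
      case True then show ?thesis using q by (auto simp: S_def)
    next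
      case False
      define u where "u x = (INF p\<in>C. p x)" for x
      have bdd: "bdd_below ((\<lambda>p. p x) ` C)" for x
      proof (rule bdd_belowI2)
        fix p assume "p \<in> C"
        then have "sublinear p" "p (- x) \<le> q (- x)" using CS by (auto simp: S_def le_fun_def)
        then show "- q (- x) \<le> p x" using sublinear_minus_le[of p x] by linarith
      qed
      have u_le: "u x \<le> p x" if "p \<in> C" for p x
        unfolding u_def using bdd that by (intro cINF_lower)
      have u_ge: "w \<le> u x" if "\<And>p. p \<in> C \<Longrightarrow> w \<le> p x" for w x
        unfolding u_def using that False by (intro cINF_greatest) auto
      have sub: "sublinear u" unfolding sublinear_def
      proof safe
        fix x y :: 'v
        have "u (x + y) - g y \<le> u x" if g: "g \<in> C" for g
        proof (rule u_ge)
          fix f assume f: "f \<in> C"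
          \<comment> \<open>The chain is total, so one of \<open>f\<close> and \<open>g\<close> lies
            below both, and its own subadditivity serves for the mixed pair.\<close>
          obtain h where h: "h \<in> C" "h \<le> f" "h \<le> g" using tot[OF f g] f g by auto
          have "u (x + y) \<le> h x + h y"
            using u_le[OF h(1), of "x + y"] sublinear_add[of h x y] h(1) CS
            by (auto simp: S_def dest!: subsetD)
          then show "u (x + y) - g y \<le> f x"
            using le_funD[OF h(2), of x] le_funD[OF h(3), of y] by linarith
        qed
        then have "u (x + y) - u x \<le> u y" by (intro u_ge) (simp add: algebra_simps)
        then show "u (x + y) \<le> u x + u y" by simp
      next
        fix c :: real and x :: 'v assume c: "c > 0"
        have "u (c *\<^sub>R x) / c \<le> u x"
        proof (rule u_ge)
          fix p assume "p \<in> C"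
          then have "u (c *\<^sub>R x) \<le> c * p x"
            using u_le[of p "c *\<^sub>R x"] sublinear_scale_le[of p c x] c CS by (force simp: S_def)
          then show "u (c *\<^sub>R x) / c \<le> p x" using c by (simp add: field_simps)
        qed
        then show "u (c *\<^sub>R x) \<le> c * u x" using c by (simp add: field_simps)
      qed
      obtain p where p: "p \<in> C" using False by blast
      then have "p \<le> q" using CS by (auto simp: S_def)
      then have "u \<in> S" using sub u_le[OF p] by (auto simp: S_def le_fun_def intro: order_trans)
      then show ?thesis using u_le by (auto simp: le_fun_def)
    qed
  qed
  then obtain m where m: "sublinear m" "m \<le> q" and
    min: "\<And>a. sublinear a \<Longrightarrow> a \<le> m \<Longrightarrow> a = m"
    unfolding S_def by (auto intro: order_trans)
  have add: "m (x + z) = m x + m z" for x z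
  proof -
    obtain a where a: "sublinear a" "a \<le> m" "\<And>x. a x \<le> m (x + z) - m z"
      using sublinear_reduce[OF m(1)] by blast
    \<comment> \<open>Minimality turns the reduced functional back into \<open>m\<close>, whose
      extra inequality is the missing superadditivity.\<close>
    have "a = m" using min a by blast
    then show ?thesis using a(3)[of x] sublinear_add[OF m(1), of x z] by auto
  qed
  have neg: "m (- x) = - m x" for x using add[of x "- x"] sublinear_zero[OF m(1)] by simp
  have "m (c *\<^sub>R x) = c * m x" for c x
  proof (cases "c \<ge> 0")
    case False
    then show ?thesis using sublinear_scale[OF m(1), of "- c" x] neg[of "c *\<^sub>R x"] by simp
  qed (simp add: sublinear_scale[OF m(1)])
  then have "linear m" using add by (intro linearI) auto
  then show thesis using that m(2) by (auto simp: le_fun_def)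
qed

text \<open>Reducing the norm in the direction \<open>x0\<close> before linearising gives
  \<open>q (- x0) \<le> - norm x0\<close>, so every linear functional below \<open>q\<close> is
  nonzero at \<open>x0\<close>.\<close>

lemma ex_real_functional:
  fixes x0 :: "'v::real_normed_vector"
  assumes "x0 \<noteq> 0"
  obtains u :: "'v \<Rightarrow> real" where "linear u" "\<And>x. \<bar>u x\<bar> \<le> norm x" "u x0 \<noteq> 0"
proof -
  have norm_sub: "sublinear (norm :: 'v \<Rightarrow> real)"
    by (auto simp: sublinear_def norm_triangle_ineq)
  obtain q where q: "sublinear q" "q \<le> norm" "\<And>x. q x \<le> norm (x + x0) - norm x0"
    using sublinear_reduce[OF norm_sub] by blast
  obtain u where u: "linear u" "\<And>x. u x \<le> q x" using linear_below_sublinear[OF q(1)] by blast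
  have le: "u x \<le> norm x" for x using u(2)[of x] le_funD[OF q(2), of x] by linarith
  have neg: "u (- x) = - u x" for x using u(1) by (rule linear_neg)
  have "\<bar>u x\<bar> \<le> norm x" for x using le[of x] le[of "- x"] neg[of x] by auto
  moreover have "u x0 \<noteq> 0"
  proof -
    have "norm x0 > 0" using assms by simp
    moreover have "q (- x0) \<le> - norm x0" using q(3)[of "- x0"] by simp
    ultimately show ?thesis using u(2)[of "- x0"] neg[of x0] by linarith
  qed
  ultimately show thesis using that u(1) by blast
qed

text \<open>A complex functional is determined by its real part \<open>u\<close> as
  \<open>u x - \<i> * u (\<i> x)\<close>; this formula turns the real functional into a complex
  one.\<close>

lemma ex_complex_functional:
  fixes x0 :: "'v::complex_normed_vector"
  assumes "x0 \<noteq> 0"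
  obtains \<phi> :: "'v \<Rightarrow> complex"
  where "bounded_linear \<phi>" "\<And>c x. \<phi> (c *\<^sub>C x) = c * \<phi> x" "\<phi> x0 \<noteq> 0"
proof -
  obtain u :: "'v \<Rightarrow> real" where u: "linear u" "\<And>x. \<bar>u x\<bar> \<le> norm x" "u x0 \<noteq> 0"
    using ex_real_functional[OF assms] by blast
  define \<phi> where "\<phi> x = Complex (u x) (- u (\<i> *\<^sub>C x))" for x
  have add: "u (x + y) = u x + u y" and scale: "u (r *\<^sub>R x) = r * u x" for x y r
    using u(1) by (simp_all add: linear_add linear_scale)
  have \<phi>_add: "\<phi> (x + y) = \<phi> x + \<phi> y" for x y
    by (simp add: \<phi>_def scaleC_add_right add complex_eq_iff)
  have \<phi>_scaleR: "\<phi> (r *\<^sub>R x) = r *\<^sub>R \<phi> x" for r x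
    by (simp add: \<phi>_def scaleC_scaleR_commute scale complex_eq_iff)
  have i_i: "\<i> *\<^sub>C \<i> *\<^sub>C x = - x" for x :: 'v
    using scaleR_scaleC[of "-1" x] by (simp add: scaleC_scaleC)
  have u_neg: "u (- x) = - u x" for x using u(1) by (rule linear_neg)
  have \<phi>_i: "\<phi> (\<i> *\<^sub>C x) = \<i> * \<phi> x" for x
    by (simp add: \<phi>_def i_i u_neg complex_eq_iff)
  have \<phi>_scaleC: "\<phi> (c *\<^sub>C x) = c * \<phi> x" for c x
  proof -
    have "c *\<^sub>C x = Re c *\<^sub>R x + Im c *\<^sub>R \<i> *\<^sub>C x"
      by (simp add: scaleR_scaleC scaleC_scaleC flip: scaleC_add_left)
        (metis complex_eq mult.commute)
    then have "\<phi> (c *\<^sub>C x) = Re c *\<^sub>R \<phi> x + Im c *\<^sub>R (\<i> * \<phi> x)"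
      by (simp add: \<phi>_add \<phi>_scaleR \<phi>_i)
    then show ?thesis by (simp add: complex_eq_iff)
  qed
  have "bounded_linear \<phi>"
  proof (rule bounded_linear_intro[where K = 2])
    fix x :: 'v
    have "cmod (\<phi> x) \<le> \<bar>u x\<bar> + \<bar>u (\<i> *\<^sub>C x)\<bar>"
      using cmod_le[of "\<phi> x"] by (simp add: \<phi>_def)
    also have "\<dots> \<le> norm x + norm (\<i> *\<^sub>C x)" using u(2) by (intro add_mono)
    finally show "cmod (\<phi> x) \<le> norm x * 2" by (simp add: norm_scaleC)
  qed (simp_all add: \<phi>_add \<phi>_scaleR)
  moreover have "\<phi> x0 \<noteq> 0" using u(3) by (simp add: \<phi>_def complex_eq_iff)
  ultimately show thesis using that \<phi>_scaleC by blast
qed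

section \<open>The spectrum and the Gelfand--Mazur theorem\<close>

lemma scaleC_zero_left [simp]: "0 *\<^sub>C (x::'v::complex_vector) = 0"
  using scaleC_add_left[of 0 0 x] by simp

lemma scaleC_minus_left: "(- c) *\<^sub>C (x::'v::complex_vector) = - (c *\<^sub>C x)"
  using scaleC_add_left[of c "- c" x] by (simp add: eq_neg_iff_add_eq_0 add.commute)

lemma scaleC_diff_left: "(c - d) *\<^sub>C (x::'v::complex_vector) = c *\<^sub>C x - d *\<^sub>C x"
  using scaleC_add_left[of c "- d" x] by (simp add: scaleC_minus_left)

lemma scaleC_eq_0_iff [simp]: "c *\<^sub>C (x::'v::complex_normed_vector) = 0 \<longleftrightarrow> c = 0 \<or> x = 0"
  using norm_scaleC[of c x] by (metis mult_eq_0_iff norm_eq_zero)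

lemma scaleC_cancel_right [simp]:
  "c *\<^sub>C (x::'v::complex_normed_vector) = d *\<^sub>C x \<longleftrightarrow> c = d \<or> x = 0"
  using scaleC_eq_0_iff[of "c - d" x] by (auto simp: scaleC_diff_left)

lemmas scaleC_simps = scaleC_add_right scaleC_add_left scaleC_diff_right scaleC_diff_left
  scaleC_minus_left scaleC_minus_right scaleC_scaleC scaleC_one scaleC_zero_right
  mult_scaleC_left mult_scaleC_right

lemma mult_absorb: "x * y = z \<Longrightarrow> x * (y * w) = z * (w :: 'a::semigroup_mult)"
  by (simp flip: mult.assoc)

definition unit_elt :: "'a::complex_banach_algebra_1 \<Rightarrow> bool" where
  "unit_elt x \<longleftrightarrow> (\<exists>y. x * y = 1 \<and> y * x = 1)"

lemma spectrum_iff: "c \<in> spectrum x \<longleftrightarrow> \<not> unit_elt (c *\<^sub>C 1 - x)"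
  by (simp add: spectrum_def unit_elt_def)

lemma unit_elt_mult:
  assumes "unit_elt x" "unit_elt y" shows "unit_elt (x * y)"
proof -
  obtain x' y' where *: "x * x' = 1" "x' * x = 1" "y * y' = 1" "y' * y = 1"
    using assms unfolding unit_elt_def by blast
  have "x * y * (y' * x') = x * (y * y') * x'" "y' * x' * (x * y) = y' * (x' * x) * y"
    by (simp_all add: mult.assoc)
  then show ?thesis unfolding unit_elt_def using * by auto
qed

lemma unit_elt_mult_iff:
  assumes "unit_elt x" shows "unit_elt (x * y) \<longleftrightarrow> unit_elt y"
proof
  obtain x' where *: "x * x' = 1" "x' * x = 1" using assms unfolding unit_elt_def by blast
  then have "unit_elt x'" unfolding unit_elt_def by blast
  moreover assume "unit_elt (x * y)"
  ultimately have "unit_elt (x' * (x * y))" by (rule unit_elt_mult)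
  then show "unit_elt y" using * by (simp flip: mult.assoc)
qed (rule unit_elt_mult[OF assms])

lemma unit_elt_scaleC_iff:
  assumes "c \<noteq> 0" shows "unit_elt (c *\<^sub>C x) \<longleftrightarrow> unit_elt (x :: 'a::complex_banach_algebra_1)"
proof -
  have "unit_elt (c *\<^sub>C (1::'a))" unfolding unit_elt_def
    using assms by (intro exI[of _ "inverse c *\<^sub>C 1"]) (simp add: scaleC_simps)
  then show ?thesis using unit_elt_mult_iff[of "c *\<^sub>C 1" x] by (simp add: scaleC_simps)
qed

text \<open>The inverse \<open>1 + y * w * x\<close> is what the geometric series for
  \<open>1 - y * x\<close> suggests once the inner powers of \<open>x * y\<close> are summed to
  \<open>w\<close>.\<close>

lemma unit_elt_one_minus_mult:
  assumes "unit_elt (1 - x * y)" shows "unit_elt (1 - y * (x::'a::complex_banach_algebra_1))"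
proof -
  obtain w where w: "(1 - x * y) * w = 1" "w * (1 - x * y) = 1"
    using assms unfolding unit_elt_def by blast
  then have *: "x * y * w = w - 1" "w * (x * y) = w - 1" by (auto simp: algebra_simps)
  have "y * (x * y * w) * x = y * w * x - y * x" "y * (w * (x * y)) * x = y * w * x - y * x"
    unfolding * by (simp_all add: algebra_simps)
  then have "(1 - y * x) * (1 + y * w * x) = 1" "(1 + y * w * x) * (1 - y * x) = 1"
    by (simp_all add: algebra_simps)
  then show ?thesis unfolding unit_elt_def by blast
qed

lemma spectrum_iff_nonzero:
  assumes "c \<noteq> 0"
  shows "c \<in> spectrum x \<longleftrightarrow> \<not> unit_elt (1 - inverse c *\<^sub>C x)"
proof -
  have "c *\<^sub>C 1 - x = c *\<^sub>C (1 - inverse c *\<^sub>C x)" using assms by (simp add: scaleC_simps)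
  then show ?thesis using unit_elt_scaleC_iff[OF assms] by (simp add: spectrum_iff)
qed

lemma nonzero_spectrum_iff:
  "c \<in> nonzero_spectrum x \<longleftrightarrow> c \<noteq> 0 \<and> \<not> unit_elt (c *\<^sub>C 1 - x)"
  by (auto simp: nonzero_spectrum_def spectrum_iff)

text \<open>This lets \<open>x * a\<close>, which appears in the rank and the multiplicities, be
  replaced by \<open>a * x\<close>, whose range stays inside that of \<open>a\<close>.\<close>

lemma nonzero_spectrum_commute: "nonzero_spectrum (x * y) = nonzero_spectrum (y * x)"
proof -
  have "unit_elt (1 - inverse c *\<^sub>C (x * y)) \<longleftrightarrow> unit_elt (1 - inverse c *\<^sub>C (y * x))" for c
    using unit_elt_one_minus_mult[of "inverse c *\<^sub>C x" y]
      unit_elt_one_minus_mult[of y "inverse c *\<^sub>C x"]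
    by (auto simp: scaleC_simps)
  then show ?thesis unfolding nonzero_spectrum_def using spectrum_iff_nonzero by auto
qed

lemma eigenvector_in_spectrum:
  assumes "b * x = c *\<^sub>C x" "x \<noteq> 0" shows "c \<in> spectrum b"
proof -
  have "(c *\<^sub>C 1 - b) * x = 0" using assms by (simp add: algebra_simps scaleC_simps)
  then have "y * (c *\<^sub>C 1 - b) \<noteq> 1" for y
    using assms(2) by (metis mult.assoc mult_1_left mult_zero_right)
  then show ?thesis by (auto simp: spectrum_def)
qed

text \<open>Gelfand--Mazur for the corner \<open>p A p\<close>: composed with a bounded functional, an everywhere
  defined resolvent would be an entire function vanishing at infinity.\<close>

lemma corner_spectrum_nonempty:
  fixes p b :: "'a::complex_banach_algebra_1"
  assumes p: "p * p = p" "p \<noteq> 0" and b: "p * b = b" "b * p = b"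
  obtains c where "\<nexists>g. p * g = g \<and> g * p = g \<and> g * (c *\<^sub>C p - b) = p \<and> (c *\<^sub>C p - b) * g = p"
proof (rule ccontr)
  assume "\<not> thesis"
  with that have "\<forall>c. \<exists>g. p * g = g \<and> g * p = g \<and> g * (c *\<^sub>C p - b) = p \<and> (c *\<^sub>C p - b) * g = p"
    by blast
  then obtain R where R: "\<And>c. p * R c = R c" "\<And>c. R c * p = R c"
    "\<And>c. R c * (c *\<^sub>C p - b) = p" "\<And>c. (c *\<^sub>C p - b) * R c = p"
    by metis
  \<comment> \<open>The first resolvent identity; together with continuity it yields the derivative
    \<open>- R d * R d\<close>.\<close>
  have resolvent: "R c - R d = (d - c) *\<^sub>C (R c * R d)" for c d
  proof -
    have "R c - R d = R c * p - p * R d" by (simp add: R)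
    also have "\<dots> = R c * ((d *\<^sub>C p - b) * R d) - (R c * (c *\<^sub>C p - b)) * R d" by (simp add: R)
    also have "\<dots> = (d - c) *\<^sub>C (R c * (p * R d))" by (simp add: algebra_simps scaleC_simps)
    finally show ?thesis by (simp add: R)
  qed
  have cont: "(R \<longlongrightarrow> R d) (at d)" for d
  proof -
    define K where "K = norm (R d)"
    have "p \<noteq> 0 \<Longrightarrow> R d \<noteq> 0" using R(3)[of d] by auto
    then have K: "K > 0" using p by (simp add: K_def)
    \<comment> \<open>In the disk of radius \<open>1 / (2 * K)\<close> the resolvent identity bounds
      \<open>norm (R c - R d)\<close> by half of \<open>norm (R c)\<close>, so
      \<open>norm (R c) \<le> 2 * K\<close>; fed back, this gives a Lipschitz estimate.\<close>
    have bound: "norm (R c - R d) \<le> 2 * K * K * cmod (c - d)" if "cmod (c - d) < 1 / (2 * K)" for c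
    proof -
      have *: "norm (R c - R d) \<le> cmod (c - d) * (norm (R c) * K)"
        unfolding resolvent norm_scaleC K_def norm_minus_commute[of d c]
        by (intro mult_left_mono norm_mult_ineq) auto
      have "cmod (c - d) * K \<le> 1 / 2" using that K by (simp add: field_simps)
      then have "cmod (c - d) * K * norm (R c) \<le> 1 / 2 * norm (R c)" by (intro mult_right_mono) auto
      moreover have "norm (R c) \<le> norm (R c - R d) + K"
        using norm_triangle_ineq[of "R c - R d" "R d"] by (simp add: K_def)
      ultimately have "norm (R c) \<le> 2 * K" using * by (simp add: algebra_simps)
      then have "cmod (c - d) * (norm (R c) * K) \<le> cmod (c - d) * (2 * K * K)"
        using K by (intro mult_left_mono mult_right_mono) auto
      with * show ?thesis by (simp add: algebra_simps)
    qed
    have "((\<lambda>c. R c - R d) \<longlongrightarrow> 0) (at d)"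
    proof (rule Lim_null_comparison)
      show "\<forall>\<^sub>F c in at d. norm (R c - R d) \<le> 2 * K * K * cmod (c - d)"
        unfolding eventually_at using K bound
        by (intro exI[of _ "1 / (2 * K)"]) (auto simp: dist_norm)
      show "((\<lambda>c. 2 * K * K * cmod (c - d)) \<longlongrightarrow> 0) (at d)"
        by (auto intro!: tendsto_eq_intros)
    qed
    then show ?thesis by (simp add: LIM_zero_iff)
  qed
  have decay: "(R \<longlongrightarrow> 0) at_infinity"
  proof (rule Lim_null_comparison)
    \<comment> \<open>In \<open>c R c = p + R c * b\<close> the last term is at most half of the
      left side in norm once \<open>cmod c\<close> exceeds \<open>2 * norm b\<close>.\<close>
    have "norm (R c) \<le> 2 * norm p * inverse (cmod c)" if c: "2 * norm b + 1 \<le> cmod c" for c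
    proof -
      have "c *\<^sub>C R c = p + R c * b" using R(3)[of c] R(2)[of c]
        by (simp add: algebra_simps scaleC_simps)
      then have "cmod c * norm (R c) \<le> norm p + norm (R c) * norm b"
        using norm_triangle_ineq[of p "R c * b"] norm_mult_ineq[of "R c" b]
        by (simp flip: norm_scaleC)
      moreover have "norm (R c) * norm b \<le> norm (R c) * (cmod c / 2)"
        using c by (intro mult_left_mono) auto
      ultimately have "cmod c * norm (R c) \<le> 2 * norm p" by (simp add: algebra_simps)
      moreover have "cmod c > 0" using c norm_ge_zero[of b] by linarith
      ultimately show ?thesis by (simp add: field_simps)
    qed
    then show "\<forall>\<^sub>F c in at_infinity. norm (R c) \<le> 2 * norm p * inverse (cmod c)"
      unfolding eventually_at_infinity by blast
    have "((\<lambda>c::complex. inverse (cmod c)) \<longlongrightarrow> 0) at_infinity"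
      by (rule tendsto_inverse_0_at_top[OF filterlim_norm_at_top])
    from tendsto_mult_right_zero[OF this]
    show "((\<lambda>c::complex. 2 * norm p * inverse (cmod c)) \<longlongrightarrow> 0) at_infinity" .
  qed
  have "R 0 \<noteq> 0" using R(3)[of 0] p by auto
  then obtain \<phi> :: "'a \<Rightarrow> complex" where \<phi>: "bounded_linear \<phi>"
    "\<And>c x. \<phi> (c *\<^sub>C x) = c * \<phi> x" "\<phi> (R 0) \<noteq> 0"
    using ex_complex_functional by blast
  interpret \<phi>: bounded_linear \<phi> by (rule \<phi>(1))
  have "((\<lambda>c. \<phi> (R c)) has_field_derivative - \<phi> (R d * R d)) (at d)" for d
    unfolding has_field_derivative_iff
  proof (rule Lim_transform_eventually)
    show "((\<lambda>c. - \<phi> (R c * R d)) \<longlongrightarrow> - \<phi> (R d * R d)) (at d)"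
      by (intro tendsto_minus \<phi>.tendsto tendsto_mult cont tendsto_const)
    have "\<phi> (R c) - \<phi> (R d) = - ((c - d) * \<phi> (R c * R d))" for c
      unfolding \<phi>.diff[symmetric] resolvent \<phi>(2) by (simp add: algebra_simps)
    then show "\<forall>\<^sub>F c in at d. - \<phi> (R c * R d) = (\<phi> (R c) - \<phi> (R d)) / (c - d)"
      unfolding eventually_at by (intro exI[of _ 1]) auto
  qed
  then have "(\<lambda>c. \<phi> (R c)) holomorphic_on UNIV"
    by (auto simp: holomorphic_on_def field_differentiable_def intro: has_field_derivative_at_within)
  moreover have "((\<lambda>c. \<phi> (R c)) \<longlongrightarrow> 0) at_infinity"
    using \<phi>.tendsto[OF decay] by (simp add: \<phi>.zero)
  ultimately have "\<phi> (R 0) = 0" by (rule Liouville_weak_0)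
  with \<phi>(3) show False by simp
qed

section \<open>Minimal left ideals and the socle\<close>

lemma left_idealD:
  assumes "left_ideal I"
  shows "0 \<in> I" "x \<in> I \<Longrightarrow> y \<in> I \<Longrightarrow> x + y \<in> I" "x \<in> I \<Longrightarrow> a * x \<in> I"
  using assms by (auto simp: left_ideal_def)

lemma left_ideal_scaleC: "left_ideal I \<Longrightarrow> x \<in> I \<Longrightarrow> c *\<^sub>C x \<in> I"
  using left_idealD(3)[of I x "c *\<^sub>C 1"] by (simp add: scaleC_simps)

lemma left_ideal_diff: "left_ideal I \<Longrightarrow> x \<in> I \<Longrightarrow> y \<in> I \<Longrightarrow> x - y \<in> I"
  using left_ideal_scaleC[of I y "-1"] left_idealD(2)[of I x "- y"] by (simp add: scaleC_simps)

lemma left_ideal_Int: "left_ideal I \<Longrightarrow> left_ideal J \<Longrightarrow> left_ideal (I \<inter> J)"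
  by (auto simp: left_ideal_def)

lemma left_ideal_image_mult:
  assumes "left_ideal L" shows "left_ideal ((\<lambda>z. z * y) ` L)"
proof -
  have "u * y + v * y \<in> (\<lambda>z. z * y) ` L" if "u \<in> L" "v \<in> L" for u v
    using left_idealD(2)[OF assms that] by (auto simp flip: distrib_right)
  moreover have "a * (u * y) \<in> (\<lambda>z. z * y) ` L" if "u \<in> L" for a u
    using left_idealD(3)[OF assms that] by (auto simp flip: mult.assoc)
  ultimately show ?thesis using left_idealD(1)[OF assms] by (force simp: left_ideal_def)
qed

lemma left_ideal_principal: "left_ideal (range (\<lambda>z. z * y))"
  by (rule left_ideal_image_mult) (simp add: left_ideal_def)

lemma minimal_left_idealD:
  assumes "minimal_left_ideal L"
  shows "left_ideal L" "\<exists>x\<in>L. x \<noteq> 0"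
    "left_ideal J \<Longrightarrow> J \<subseteq> L \<Longrightarrow> x \<in> J \<Longrightarrow> x \<noteq> 0 \<Longrightarrow> J = L"
  using assms left_idealD(1)[of L] by (auto simp: minimal_left_ideal_def)

text \<open>The preimage of \<open>J\<close> under right multiplication by \<open>y\<close> is a
  left ideal inside \<open>L\<close>, hence \<open>{0}\<close> or \<open>L\<close>. This is why the
  socle is closed under multiplication from the right.\<close>

lemma minimal_left_ideal_mult:
  assumes L: "minimal_left_ideal L"
  shows "(\<lambda>z. z * y) ` L = {0} \<or> minimal_left_ideal ((\<lambda>z. z * y) ` L)"
proof -
  have "J = {0} \<or> J = (\<lambda>z. z * y) ` L" if J: "left_ideal J" "J \<subseteq> (\<lambda>z. z * y) ` L" for J
  proof -
    define K where "K = {z\<in>L. z * y \<in> J}"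
    have "left_ideal K" using minimal_left_idealD(1)[OF L] J(1)
      by (auto simp: K_def left_ideal_def distrib_right mult.assoc)
    moreover have "K \<subseteq> L" by (auto simp: K_def)
    ultimately have "K = {0} \<or> K = L" using L by (auto simp: minimal_left_ideal_def)
    moreover have "J = (\<lambda>z. z * y) ` K" using J(2) by (auto simp: K_def)
    ultimately show ?thesis by auto
  qed
  then show ?thesis
    using left_ideal_image_mult[OF minimal_left_idealD(1)[OF L]] by (auto simp: minimal_left_ideal_def)
qed

section \<open>The socle as a two-sided ideal\<close>

lemma Soc_zero: "0 \<in> Soc"
  unfolding Soc_def by (auto intro!: exI[of _ "{}"])

text \<open>Sums in the socle are indexed by distinct ideals. If \<open>L\<close> already occurs,
  \<open>x\<close> has to be merged into its summand, which is what \<open>g\<close> does.\<close>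

lemma Soc_add_minimal:
  assumes "s \<in> Soc" "minimal_left_ideal L" "x \<in> L" shows "s + x \<in> Soc"
proof -
  obtain F f where F: "s = (\<Sum>L\<in>F. f L)" "finite F" "\<forall>L\<in>F. minimal_left_ideal L \<and> f L \<in> L"
    using assms(1) unfolding Soc_def by blast
  define g where "g K = (if K = L then (if L \<in> F then f L else 0) + x else f K)" for K
  have "(\<Sum>K\<in>insert L F. g K) = s + x"
  proof (cases "L \<in> F")
    case True
    then have "(\<Sum>K\<in>insert L F. g K) = g L + (\<Sum>K\<in>F - {L}. g K)"
      using sum.remove[OF F(2), of L g] by (simp add: insert_absorb)
    also have "(\<Sum>K\<in>F - {L}. g K) = (\<Sum>K\<in>F - {L}. f K)"
      by (intro sum.cong) (auto simp: g_def)
    also have "g L + \<dots> = s + x"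
      unfolding F(1) sum.remove[OF F(2) True, of f] using True by (simp add: g_def)
    finally show ?thesis .
  next
    case False
    have "(\<Sum>K\<in>insert L F. g K) = g L + (\<Sum>K\<in>F. g K)" using F(2) False by simp
    also have "(\<Sum>K\<in>F. g K) = (\<Sum>K\<in>F. f K)" using False by (intro sum.cong) (auto simp: g_def)
    finally show ?thesis unfolding F(1) using False by (simp add: g_def add.commute)
  qed
  moreover have "\<forall>K\<in>insert L F. minimal_left_ideal K \<and> g K \<in> K"
  proof
    fix K assume "K \<in> insert L F"
    then have K: "minimal_left_ideal K" "K \<noteq> L \<Longrightarrow> f K \<in> K" using F(3) assms(2) by auto
    have "left_ideal L" using assms(2) by (rule minimal_left_idealD(1))
    moreover have "(if L \<in> F then f L else 0) \<in> L" using F(3) left_idealD(1)[OF \<open>left_ideal L\<close>] by simp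
    ultimately have "(if L \<in> F then f L else 0) + x \<in> L" using left_idealD(2) assms(3) by blast
    then show "minimal_left_ideal K \<and> g K \<in> K" using K by (simp add: g_def)
  qed
  moreover have "finite (insert L F)" using F(2) by simp
  ultimately show ?thesis unfolding Soc_def mem_Collect_eq by metis
qed

lemma Soc_induct [consumes 1, case_names zero add]:
  assumes "s \<in> Soc" and "P 0"
    and "\<And>s L x. s \<in> Soc \<Longrightarrow> P s \<Longrightarrow> minimal_left_ideal L \<Longrightarrow> x \<in> L \<Longrightarrow> P (s + x)"
  shows "P s"
proof -
  obtain F f where F: "s = (\<Sum>L\<in>F. f L)" "finite F" "\<forall>L\<in>F. minimal_left_ideal L \<and> f L \<in> L"
    using assms(1) unfolding Soc_def by blast
  have "(\<Sum>L\<in>F. f L) \<in> Soc \<and> P (\<Sum>L\<in>F. f L)" using F(2,3)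
  proof (induction F)
    case empty then show ?case using assms(2) Soc_zero by simp
  next
    case (insert L F)
    then show ?case
      using assms(3)[of "\<Sum>L\<in>F. f L" L "f L"] Soc_add_minimal[of "\<Sum>L\<in>F. f L" L "f L"]
      by (simp add: add.commute)
  qed
  then show ?thesis using F(1) by simp
qed

lemma minimal_left_ideal_subset_Soc: "minimal_left_ideal L \<Longrightarrow> L \<subseteq> Soc"
  using Soc_add_minimal[OF Soc_zero] by auto

lemma two_sided_ideal_Soc: "two_sided_ideal (Soc :: 'a::complex_banach_algebra_1 set)"
proof -
  have "s + t \<in> Soc" if "s \<in> Soc" "t \<in> Soc" for s t :: 'a
    using that(2)
  proof (induction rule: Soc_induct)
    case zero then show ?case using that by simp
  next
    case (add t L x)
    then show ?case using Soc_add_minimal[of "s + t" L x] by (simp add: add.assoc)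
  qed
  moreover have "a * s \<in> Soc" if "s \<in> Soc" for a s :: 'a
    using that
  proof (induction rule: Soc_induct)
    case (add s L x)
    then have "a * x \<in> L" using minimal_left_idealD(1) left_idealD(3) by blast
    with add show ?case using Soc_add_minimal[of "a * s" L "a * x"] by (simp add: distrib_left)
  qed (simp add: Soc_zero)
  moreover have "s * a \<in> Soc" if "s \<in> Soc" for a s :: 'a
    using that
  proof (induction rule: Soc_induct)
    case (add s L x)
    from minimal_left_ideal_mult[OF add.hyps(2), of a] show ?case
    proof
      assume "(\<lambda>z. z * a) ` L = {0}"
      then have "x * a = 0" using add.hyps(3) by blast
      then show ?thesis using add.IH by (simp add: distrib_right)
    next
      assume "minimal_left_ideal ((\<lambda>z. z * a) ` L)"
      then show ?thesis using Soc_add_minimal[OF add.IH] add.hyps(3) by (simp add: distrib_right)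
    qed
  qed (simp add: Soc_zero)
  ultimately show ?thesis by (auto simp: two_sided_ideal_def left_ideal_def Soc_zero)
qed

section \<open>Semiprimeness and minimal idempotents\<close>

locale semiprime =
  fixes A :: "'a::complex_banach_algebra_1 itself"
  assumes semiprime: "(\<And>x. a * x * a = 0) \<Longrightarrow> a = (0::'a)"

text \<open>If \<open>a\<close> lay outside a maximal left ideal \<open>M\<close>, then
  \<open>1 = m + x * a\<close> with \<open>m\<close> in \<open>M\<close>. Since \<open>x * a\<close>
  squares to \<open>0\<close>, multiplying \<open>m = 1 - x * a\<close> by \<open>1 + x * a\<close>
  gives \<open>1\<close>, which would then be in \<open>M\<close>.\<close>

lemma semisimple_imp_semiprime:
  assumes "semisimple TYPE('a::complex_banach_algebra_1)"
  shows "semiprime TYPE('a)"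
proof
  fix a :: 'a assume a: "a * x * a = 0" for x
  have "a \<in> M" if M: "maximal_left_ideal M" for M
  proof (rule ccontr)
    assume "a \<notin> M"
    have lM: "left_ideal M" using M by (simp add: maximal_left_ideal_def)
    define J where "J = {m + x * a | m x. m \<in> M}"
    have "left_ideal J" unfolding left_ideal_def
    proof safe
      have "0 = 0 + 0 * a" by simp
      then show "0 \<in> J" using left_idealD(1)[OF lM] unfolding J_def by blast
    next
      fix u v assume "u \<in> J" "v \<in> J"
      then obtain m x n y where *: "m \<in> M" "n \<in> M" "u = m + x * a" "v = n + y * a"
        by (auto simp: J_def)
      then have "u + v = (m + n) + (x + y) * a" "m + n \<in> M"
        using left_idealD(2)[OF lM] by (auto simp: algebra_simps)
      then show "u + v \<in> J" unfolding J_def by blast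
    next
      fix z u assume "u \<in> J"
      then obtain m x where *: "m \<in> M" "u = m + x * a" by (auto simp: J_def)
      then have "z * u = z * m + (z * x) * a" "z * m \<in> M"
        using left_idealD(3)[OF lM] by (auto simp: algebra_simps)
      then show "z * u \<in> J" unfolding J_def by blast
    qed
    moreover have "M \<subseteq> J"
    proof
      fix m assume "m \<in> M"
      moreover have "m = m + 0 * a" by simp
      ultimately show "m \<in> J" unfolding J_def by blast
    qed
    moreover have "a \<in> J"
    proof -
      have "a = 0 + 1 * a" by simp
      then show ?thesis using left_idealD(1)[OF lM] unfolding J_def by blast
    qed
    ultimately have "J = UNIV" using M \<open>a \<notin> M\<close> by (auto simp: maximal_left_ideal_def)
    then obtain m x where mx: "m \<in> M" "1 = m + x * a" unfolding J_def by blast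
    have "(1 + x * a) * m = (1 + x * a) * (1 - x * a)" using mx(2) by (metis add_diff_cancel_right')
    also have "\<dots> = 1 - x * (a * x * a)" by (simp add: algebra_simps)
    finally have "1 \<in> M" using left_idealD(3)[OF lM mx(1), of "1 + x * a"] a by simp
    then have "M = UNIV" using left_idealD(3)[OF lM, of 1] by auto
    then show False using M by (simp add: maximal_left_ideal_def)
  qed
  then have "a \<in> jacobson_radical" by (auto simp: jacobson_radical_def)
  then show "a = 0" using assms by (auto simp: semisimple_def)
qed

text \<open>The corner \<open>e A e\<close> is required to consist of scalars, which is the form in
  which minimality is applied; for an idempotent from a minimal left ideal this is supplied by
  Gelfand--Mazur.\<close>

definition minimal_idempotent :: "'a::complex_banach_algebra_1 \<Rightarrow> bool" where
  "minimal_idempotent e \<longleftrightarrow> e * e = e \<and> e \<noteq> 0 \<and> (\<forall>x. \<exists>c. e * x * e = c *\<^sub>C e)"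

context semiprime
begin

text \<open>Brauer's argument: semiprimeness gives \<open>y\<close> in \<open>L\<close> for which
  right multiplication is nonzero on \<open>L\<close>, hence bijective by minimality, and the
  preimage \<open>e\<close> of \<open>y\<close> is idempotent. Its corner is a division algebra,
  hence consists of scalars.\<close>

lemma minimal_left_ideal_idempotent:
  assumes L: "minimal_left_ideal (L :: 'a set)"
  obtains e where "e \<in> L" "minimal_idempotent e"
proof -
  note lL = minimal_left_idealD(1)[OF L]
  obtain a where a: "a \<in> L" "a \<noteq> 0" using minimal_left_idealD(2)[OF L] by blast
  obtain x where x: "a * x * a \<noteq> 0" using semiprime a(2) by blast
  define y where "y = x * a"
  have y: "y \<in> L" "a * y \<noteq> 0" using left_idealD(3)[OF lL a(1)] x by (simp_all add: y_def mult.assoc)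
  have "(\<lambda>z. z * y) ` L = L"
  proof (rule minimal_left_idealD(3)[OF L])
    show "left_ideal ((\<lambda>z. z * y) ` L)" by (rule left_ideal_image_mult[OF lL])
    show "(\<lambda>z. z * y) ` L \<subseteq> L" using left_idealD(3)[OF lL y(1)] by blast
    show "a * y \<in> (\<lambda>z. z * y) ` L" using a(1) by blast
  qed (rule y(2))
  then obtain e where e: "e \<in> L" "e * y = y" using y(1) by (metis imageE)
  define K where "K = {z\<in>L. z * y = 0}"
  have K: "left_ideal K" using lL by (auto simp: K_def left_ideal_def distrib_right mult.assoc)
  have "K = {0} \<or> K = L" using L K by (auto simp: minimal_left_ideal_def K_def)
  then have "K = {0}" using a(1) y(2) by (auto simp: K_def)
  moreover have "e * e - e \<in> K"
    using left_ideal_diff[OF lL left_idealD(3)[OF lL e(1)] e(1)] e(2)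
    by (simp add: K_def left_diff_distrib mult.assoc)
  ultimately have ee: "e * e = e" by auto
  have ee': "e * (e * x) = e * x" for x using ee by (metis mult.assoc)
  have e0: "e \<noteq> 0" using e(2) y(2) by auto
  \<comment> \<open>A nonzero \<open>g\<close> of the corner generates \<open>L\<close> as a left
    ideal, so \<open>e = z * g\<close>; compressing \<open>z\<close> to the corner gives a left
    inverse.\<close>
  have left_inv: "\<exists>h. e * h = h \<and> h * e = h \<and> h * g = e"
    if g: "e * g = g" "g * e = g" "g \<noteq> 0" for g
  proof -
    have "range (\<lambda>z. z * g) = L"
    proof (rule minimal_left_idealD(3)[OF L left_ideal_principal _ _ g(3)])
      have "g \<in> L" using left_idealD(3)[OF lL e(1), of g] g(2) by simp
      then show "range (\<lambda>z. z * g) \<subseteq> L" using left_idealD(3)[OF lL] by blast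
      show "g \<in> range (\<lambda>z. z * g)" by (rule range_eqI[of _ _ 1]) simp
    qed
    then obtain z where z: "e = z * g" using e(1) by (metis imageE)
    have "e * (e * z * e) = e * z * e" "e * z * e * e = e * z * e"
      using ee ee' by (simp_all add: mult.assoc)
    moreover have "e * z * e * g = e" using z g(1) ee by (simp add: mult.assoc)
    ultimately show ?thesis by blast
  qed
  have "\<exists>c. e * x * e = c *\<^sub>C e" for x
  proof -
    define b where "b = e * x * e"
    have b: "e * b = b" "b * e = b" using ee ee' by (simp_all add: b_def mult.assoc)
    obtain c where c: "\<nexists>g. e * g = g \<and> g * e = g \<and> g * (c *\<^sub>C e - b) = e \<and> (c *\<^sub>C e - b) * g = e"
      using corner_spectrum_nonempty[OF ee e0 b] by blast
    define g where "g = c *\<^sub>C e - b"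
    have g: "e * g = g" "g * e = g" using b ee by (simp_all add: g_def algebra_simps scaleC_simps)
    have "g = 0"
    proof (rule ccontr)
      assume "g \<noteq> 0"
      then obtain h where h: "e * h = h" "h * e = h" "h * g = e" using left_inv g by blast
      then have "h \<noteq> 0" using e0 by auto
      then obtain k where k: "k * e = k" "k * h = e" using left_inv h by blast
      \<comment> \<open>The left inverse \<open>h\<close> of \<open>g\<close> has a left inverse
        \<open>k\<close> of its own, and associativity forces \<open>k = g\<close>. So
        \<open>h\<close> is a two-sided inverse, against the choice of \<open>c\<close>.\<close>
      have "k = k * (h * g)" using h(3) k(1) by simp
      also have "\<dots> = g" using k(2) g(1) by (simp flip: mult.assoc)
      finally have "g * h = e" using k(2) by simp
      then show False using c h unfolding g_def by blast
    qed
    then have "e * x * e = c *\<^sub>C e" by (simp add: g_def b_def)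
    then show ?thesis by blast
  qed
  then have "minimal_idempotent e" using ee e0 by (simp add: minimal_idempotent_def)
  then show thesis using that e(1) by blast
qed

text \<open>A minimal left ideal lies inside \<open>J\<close> or meets it only in \<open>0\<close>.
  With \<open>e\<close> from one of the first kind and \<open>f\<close> from one of the second,
  \<open>e A f\<close> lies in both \<open>J\<close> and the second ideal.\<close>

lemma orthogonal_minimal_idempotents:
  fixes J :: "'a set"
  assumes J: "two_sided_ideal J" "J \<subseteq> Soc" "J \<noteq> {0}" "J \<noteq> Soc"
  obtains e f :: 'a where "minimal_idempotent e" "minimal_idempotent f" "e \<in> Soc" "f \<in> Soc"
    "\<And>x. e * x * f = 0"
proof -
  have lJ: "left_ideal J" and rJ: "\<And>x a. x \<in> J \<Longrightarrow> x * a \<in> J"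
    using J(1) by (auto simp: two_sided_ideal_def)
  have "\<exists>L x j. minimal_left_ideal L \<and> x \<in> L \<and> j \<in> J \<and> j * x \<noteq> 0"
  proof (rule ccontr)
    assume *: "\<not> ?thesis"
    have "j * s = 0" if "s \<in> Soc" "j \<in> J" for j s
      using that
    proof (induction rule: Soc_induct)
      case (add s L x)
      then have "j * x = 0" using * by blast
      with add show ?case by (simp add: distrib_left)
    qed simp
    \<comment> \<open>Were \<open>J\<close> to annihilate the socle from the left, it would
      annihilate \<open>A j\<close>, which lies in \<open>J\<close> and so in the socle; then
      \<open>j A j = 0\<close>.\<close>
    then have ann: "j * (x * j) = 0" if "j \<in> J" for j x
      using that left_idealD(3)[OF lJ that, of x] J(2) by blast
    have "j = 0" if "j \<in> J" for j
      by (rule semiprime) (simp add: mult.assoc ann[OF that])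
    then have "J = {0}" using left_idealD(1)[OF lJ] by blast
    with J(3) show False ..
  qed
  then obtain L x j where L: "minimal_left_ideal L" "x \<in> L" "j \<in> J" "j * x \<noteq> 0" by blast
  have "J \<inter> L = L"
  proof (rule minimal_left_idealD(3)[OF L(1) _ _ _ L(4)])
    show "left_ideal (J \<inter> L)" by (rule left_ideal_Int[OF lJ minimal_left_idealD(1)[OF L(1)]])
    show "j * x \<in> J \<inter> L" using rJ[OF L(3)] left_idealD(3)[OF minimal_left_idealD(1)[OF L(1)] L(2)] by blast
  qed simp
  then have "L \<subseteq> J" by blast
  obtain e where e: "e \<in> L" "minimal_idempotent e" using minimal_left_ideal_idempotent[OF L(1)] by blast
  have "\<exists>L'. minimal_left_ideal L' \<and> \<not> L' \<subseteq> J"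
  proof (rule ccontr)
    assume *: "\<not> ?thesis"
    have "s \<in> J" if "s \<in> Soc" for s using that
    proof (induction rule: Soc_induct)
      case (add s L x)
      then have "x \<in> J" using * by blast
      then show ?case using add left_idealD(2)[OF lJ] by blast
    qed (rule left_idealD(1)[OF lJ])
    then show False using J(2,4) by blast
  qed
  then obtain L' where L': "minimal_left_ideal L'" "\<not> L' \<subseteq> J" by blast
  obtain f where f: "f \<in> L'" "minimal_idempotent f" using minimal_left_ideal_idempotent[OF L'(1)] by blast
  have lL': "left_ideal L'" using minimal_left_idealD(1)[OF L'(1)] .
  have "J \<inter> L' = {0} \<or> J \<inter> L' = L'"
    using left_ideal_Int[OF lJ lL'] L'(1) by (auto simp: minimal_left_ideal_def)
  then have int: "J \<inter> L' = {0}" using L'(2) by blast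
  have "e * x * f = 0" for x
  proof -
    have "e * x * f \<in> J" using rJ e(1) \<open>L \<subseteq> J\<close> by blast
    moreover have "e * x * f \<in> L'" using left_idealD(3)[OF lL' f(1)] by blast
    ultimately show ?thesis using int by blast
  qed
  moreover have "e \<in> Soc" "f \<in> Soc"
    using minimal_left_ideal_subset_Soc[OF L(1)] minimal_left_ideal_subset_Soc[OF L'(1)] e(1) f(1) by blast+
  ultimately show thesis using that[OF e(2) f(2)] by simp
qed

end

section \<open>Frames and the trace on the ideal generated by a minimal idempotent\<close>

locale minimal_idempotent_algebra = semiprime A
  for A :: "'a::complex_banach_algebra_1 itself" +
  fixes e :: 'a
  assumes minimal_idempotent: "minimal_idempotent e"
begin

section \<open>The pairing between \<open>A e\<close> and \<open>e A\<close>\<close>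

lemma ee: "e * e = e" and e_nonzero: "e \<noteq> 0"
  using minimal_idempotent by (auto simp: minimal_idempotent_def)

lemmas ee_assoc = mult_absorb[OF ee]

definition sc :: "'a \<Rightarrow> complex" where "sc z = (THE c. e * z * e = c *\<^sub>C e)"

lemma sc_unique: "e * z * e = c *\<^sub>C e \<Longrightarrow> sc z = c"
  unfolding sc_def using e_nonzero by (intro the_equality) auto

lemma sc_eq: "e * z * e = sc z *\<^sub>C e"
proof -
  obtain c where c: "e * z * e = c *\<^sub>C e"
    using minimal_idempotent by (auto simp: minimal_idempotent_def)
  show ?thesis using c sc_unique[OF c] by simp
qed

lemma sc_e [simp]: "sc e = 1"
  by (rule sc_unique) (simp add: ee scaleC_simps)

lemma sc_add: "sc (x + y) = sc x + sc y"
  by (rule sc_unique) (simp add: distrib_left distrib_right sc_eq scaleC_simps)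

lemma sc_scaleC: "sc (c *\<^sub>C x) = c * sc x"
  by (rule sc_unique) (simp add: scaleC_simps sc_eq)

lemma sc_zero [simp]: "sc 0 = 0"
  by (rule sc_unique) simp

lemma sc_sum: "sc (\<Sum>i\<in>I. f i) = (\<Sum>i\<in>I. sc (f i))"
  by (induction I rule: infinite_finite_induct) (auto simp: sc_add)

lemma sc_scaleR: "sc (r *\<^sub>R x) = r *\<^sub>R sc x"
  by (simp add: scaleR_scaleC sc_scaleC scaleR_conv_of_real)

lemma bounded_linear_sc: "bounded_linear sc"
proof (rule bounded_linear_intro[where K = "norm e"])
  fix x
  have "cmod (sc x) * norm e = norm (e * x * e)" by (simp add: sc_eq norm_scaleC)
  also have "\<dots> \<le> norm e * norm x * norm e"
    by (meson norm_mult_ineq mult_right_mono norm_ge_zero order_trans)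
  finally show "cmod (sc x) \<le> norm x * norm e" using e_nonzero by (simp add: mult.commute)
qed (simp_all add: sc_add sc_scaleR)

lemma pairing: "e * y = y \<Longrightarrow> x * e = x \<Longrightarrow> y * x = sc (y * x) *\<^sub>C e"
  using sc_eq[of "y * x"] by (metis mult.assoc)

text \<open>\<open>y * x\<close> is a scalar multiple of \<open>e\<close>, so it can be pulled out.
  Through this, \<open>sc\<close> of a product of operators expands into products of matrix
  entries.\<close>

lemma sc_mult_pairing:
  assumes "e * y = y" "x * e = x" shows "sc (y * x * z) = sc (y * x) * sc z"
proof -
  have "y * x * z = sc (y * x) *\<^sub>C (e * z)"
    by (subst pairing[OF assms]) (simp add: scaleC_simps)
  moreover have "sc (e * z) = sc z" by (rule sc_unique) (simp add: ee_assoc mult.assoc sc_eq[simplified mult.assoc])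
  ultimately show ?thesis by (simp add: sc_scaleC)
qed

text \<open>Nondegeneracy of the pairing: for \<open>x\<close> in \<open>A e\<close> the element
  \<open>x * z * x\<close> is \<open>sc (z * x)\<close> times \<open>x\<close>, and semiprimeness
  supplies \<open>z\<close> for which it is nonzero.\<close>

lemma ex_dual_covector:
  assumes x: "x * e = x" "x \<noteq> 0" obtains y where "e * y = y" "y * x = e"
proof -
  obtain z where z: "x * z * x \<noteq> 0" using semiprime x(2) by blast
  define c where "c = sc (z * x)"
  have c: "e * z * x = c *\<^sub>C e" using sc_eq[of "z * x"] x(1) by (simp add: c_def mult.assoc)
  have "x * z * x = x * (e * z * x)" using x(1) by (metis mult.assoc)
  also have "\<dots> = c *\<^sub>C x" using x(1) by (simp add: c scaleC_simps)
  finally have "c \<noteq> 0" using z by auto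
  show thesis
    by (rule that[of "inverse c *\<^sub>C (e * z)"])
      (use \<open>c \<noteq> 0\<close> c in \<open>simp_all add: ee_assoc scaleC_simps\<close>)
qed

lemma ex_dual_vector:
  assumes y: "e * y = y" "y \<noteq> 0" obtains x where "x * e = x" "y * x = e"
proof -
  obtain z where z: "y * z * y \<noteq> 0" using semiprime y(2) by blast
  define c where "c = sc (y * z)"
  have c: "y * z * e = c *\<^sub>C e" using sc_eq[of "y * z"] y(1) by (simp add: c_def flip: mult.assoc)
  have "y * z * y = (y * z * e) * y" using y(1) by (metis mult.assoc)
  also have "\<dots> = c *\<^sub>C y" using y(1) by (simp add: c scaleC_simps)
  finally have "c \<noteq> 0" using z by auto
  show thesis
    by (rule that[of "inverse c *\<^sub>C (z * e)"])
      (use \<open>c \<noteq> 0\<close> c in \<open>simp_all add: ee mult.assoc scaleC_simps\<close>)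
qed

text \<open>Subtract from \<open>z\<close> its component along \<open>x\<close>, take a covector
  dual to the rest, and correct it to \<open>y2\<close>, which vanishes at \<open>x\<close> and is
  \<open>e\<close> at \<open>z\<close>. Then \<open>y0 - d *\<^sub>C y2\<close> cancels the value of
  \<open>y0\<close> at \<open>z\<close>.\<close>

lemma ex_separating_covector:
  assumes x: "x * e = x" "x \<noteq> 0" and z: "z * e = z" "\<And>c. z \<noteq> c *\<^sub>C x"
  obtains y where "e * y = y" "y * x = e" "y * z = 0"
proof -
  obtain y0 where y0: "e * y0 = y0" "y0 * x = e" using ex_dual_covector[OF x] by blast
  define d where "d = sc (y0 * z)"
  have d: "y0 * z = d *\<^sub>C e" using pairing[OF y0(1) z(1)] by (simp add: d_def)
  define z' where "z' = z - d *\<^sub>C x"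
  have "z' * e = z'" "z' \<noteq> 0" using z x by (simp_all add: z'_def left_diff_distrib scaleC_simps)
  then obtain y1 where y1: "e * y1 = y1" "y1 * z' = e" using ex_dual_covector by blast
  define k where "k = sc (y1 * x)"
  have k: "y1 * x = k *\<^sub>C e" using pairing[OF y1(1) x(1)] by (simp add: k_def)
  define y2 where "y2 = y1 - k *\<^sub>C y0"
  have y2: "e * y2 = y2" "y2 * x = 0"
    using y0 y1 k by (simp_all add: y2_def left_diff_distrib right_diff_distrib scaleC_simps)
  have "y0 * z' = 0" using y0 d by (simp add: z'_def right_diff_distrib scaleC_simps)
  then have "y2 * z' = e" using y1(2) by (simp add: y2_def left_diff_distrib scaleC_simps)
  then have y2z: "y2 * z = e" using y2(2) by (simp add: z'_def right_diff_distrib scaleC_simps)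
  show thesis
    by (rule that[of "y0 - d *\<^sub>C y2"])
      (simp_all add: left_diff_distrib right_diff_distrib scaleC_simps y0 y2 d y2z)
qed

text \<open>A frame is a basis \<open>x\<close> of a finite-dimensional subspace of \<open>A e\<close> together with a dual system
  \<open>y\<close> in \<open>e A\<close>; then \<open>p\<close> is an idempotent whose range on \<open>A e\<close> is spanned by \<open>x\<close>.\<close>

definition frame :: "nat \<Rightarrow> (nat \<Rightarrow> 'a) \<Rightarrow> (nat \<Rightarrow> 'a) \<Rightarrow> 'a \<Rightarrow> bool" where
  "frame n x y p \<longleftrightarrow> (\<forall>i<n. x i * e = x i \<and> e * y i = y i) \<and>
     (\<forall>i<n. \<forall>j<n. y i * x j = (if i = j then e else 0)) \<and> p = (\<Sum>i<n. x i * y i)"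

lemma frameD:
  assumes "frame n x y p"
  shows "i < n \<Longrightarrow> x i * e = x i" "i < n \<Longrightarrow> e * y i = y i"
    "i < n \<Longrightarrow> j < n \<Longrightarrow> y i * x j = (if i = j then e else 0)" "p = (\<Sum>i<n. x i * y i)"
  using assms by (auto simp: frame_def)

lemma frame_proj_vector:
  assumes f: "frame n x y p" and j: "j < n" shows "p * x j = x j"
proof -
  have "p * x j = (\<Sum>i<n. x i * (y i * x j))" by (simp add: frameD(4)[OF f] sum_distrib_right mult.assoc)
  also have "\<dots> = (\<Sum>i<n. if i = j then x i * e else 0)"
    using frameD(3)[OF f] j by (intro sum.cong) auto
  finally show ?thesis using frameD(1)[OF f j] j by simp
qed

lemma covector_frame_proj:
  assumes f: "frame n x y p" and j: "j < n" shows "y j * p = y j"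
proof -
  have "y j * p = (\<Sum>i<n. y j * x i * y i)" by (simp add: frameD(4)[OF f] sum_distrib_left mult.assoc)
  also have "\<dots> = (\<Sum>i<n. if i = j then e * y i else 0)"
    using frameD(3)[OF f] j by (intro sum.cong) auto
  finally show ?thesis using frameD(2)[OF f j] j by simp
qed

lemma frame_idempotent: assumes f: "frame n x y p" shows "p * p = p"
proof -
  have "p * (\<Sum>i<n. x i * y i) = (\<Sum>i<n. x i * y i)"
    unfolding sum_distrib_left using frame_proj_vector[OF f]
    by (intro sum.cong) (auto simp flip: mult.assoc)
  then show ?thesis using frameD(4)[OF f] by simp
qed

lemma frame_zero: "frame 0 x y 0"
  by (simp add: frame_def)

lemma frame_e: "frame 1 (\<lambda>_. e) (\<lambda>_. e) e"
  by (simp add: frame_def ee)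

lemma frame_append:
  assumes f: "frame n x y p" and v: "v * e = v" "p * v = 0" and w: "e * w = w" "w * p = 0"
    and wv: "w * v = e"
  shows "frame (Suc n) (x(n := v)) (y(n := w)) (p + v * w)"
proof -
  have "y i * v = 0" if "i < n" for i
    using covector_frame_proj[OF f that] v(2) by (metis mult.assoc mult_zero_right)
  moreover have "w * x i = 0" if "i < n" for i
    using frame_proj_vector[OF f that] w(2) by (metis mult.assoc mult_zero_left)
  ultimately show ?thesis unfolding frame_def
    using frameD[OF f] v w wv by (auto simp: less_Suc_eq)
qed

text \<open>A Gram--Schmidt step that stays inside \<open>a A e\<close>: \<open>p\<close> itself is
  \<open>a\<close> times an element, so the part \<open>v\<close> of \<open>a * u\<close>
  complementary to \<open>p\<close> is again in \<open>a A e\<close>. With \<open>a = 1\<close> it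
  enlarges an arbitrary frame.\<close>

lemma frame_extend_vector_in:
  assumes f: "frame n x y p" and x: "\<And>i. i < n \<Longrightarrow> \<exists>u. u * e = u \<and> x i = a * u"
    and u: "u * e = u"
  obtains n' x' y' p' where "frame n' x' y' p'" "\<And>i. i < n' \<Longrightarrow> \<exists>u. u * e = u \<and> x' i = a * u"
    "p' * p = p" "p * p' = p" "p' * (a * u) = a * u"
proof -
  note pp = frame_idempotent[OF f]
  define v where "v = a * u - p * (a * u)"
  show thesis
  proof (cases "v = 0")
    case True
    then show ?thesis using that[OF f x pp pp] by (simp add: v_def)
  next
    case False
    have ve: "v * e = v" using u by (simp add: v_def left_diff_distrib mult.assoc)
    have pv: "p * v = 0" using pp by (simp add: v_def right_diff_distrib flip: mult.assoc)
    obtain w0 where w0: "e * w0 = w0" "w0 * v = e" using ex_dual_covector[OF ve False] by blast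
    \<comment> \<open>Subtracting \<open>w0 * p\<close> makes the covector vanish on the old range;
      the value at \<open>v\<close> survives because \<open>p * v = 0\<close>.\<close>
    define w where "w = w0 - w0 * p"
    have w: "e * w = w" "w * p = 0" "w * v = e"
      using w0 pp pv mult_absorb[OF w0(1)]
      by (simp_all add: w_def right_diff_distrib left_diff_distrib mult.assoc)
    obtain t where t: "\<And>i. i < n \<Longrightarrow> t i * e = t i \<and> x i = a * t i"
      using x by metis
    have "p = a * (\<Sum>i<n. t i * y i)"
      unfolding frameD(4)[OF f] sum_distrib_left using t by (intro sum.cong) (auto simp: mult.assoc)
    then have v_in: "v = a * (u - (\<Sum>i<n. t i * y i) * (a * u))"
      by (simp add: v_def right_diff_distrib mult.assoc)
    have "(u - (\<Sum>i<n. t i * y i) * (a * u)) * e = u - (\<Sum>i<n. t i * y i) * (a * u)"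
      using u by (simp add: left_diff_distrib mult.assoc)
    with v_in have v_in': "\<exists>u. u * e = u \<and> v = a * u" by blast
    have "(p + v * w) * p = p" "p * (p + v * w) = p"
      using pp pv w mult_absorb[OF pv] by (simp_all add: distrib_left distrib_right mult.assoc)
    moreover have "(p + v * w) * (a * u) = a * u"
    proof -
      have au: "a * u = v + p * (a * u)" by (simp add: v_def)
      have "w * (p * (a * u)) = 0" using w(2) by (simp flip: mult.assoc)
      then have "w * (a * u) = e" using w(3) by (subst au) (simp add: distrib_left)
      then have "(p + v * w) * (a * u) = p * (a * u) + v" using ve by (simp add: distrib_right mult.assoc)
      then show ?thesis by (simp add: v_def)
    qed
    moreover have "\<exists>u. u * e = u \<and> (x(n := v)) i = a * u" if "i < Suc n" for i
      using x[of i] v_in' that by (cases "i = n") auto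
    ultimately show ?thesis using that[OF frame_append[OF f ve pv w]] by blast
  qed
qed

section \<open>Enlarging frame projections\<close>

definition frame_proj :: "'a \<Rightarrow> bool" where
  "frame_proj p \<longleftrightarrow> (\<exists>n x y. frame n x y p)"

lemma frame_proj_idempotent: "frame_proj p \<Longrightarrow> p * p = p"
  using frame_idempotent by (auto simp: frame_proj_def)

lemma frame_proj_extend_vector:
  assumes p: "frame_proj p" and v: "v * e = v"
  obtains p' where "frame_proj p'" "p' * p = p" "p * p' = p" "p' * v = v"
proof -
  obtain n x y where f: "frame n x y p" using p by (auto simp: frame_proj_def)
  have "\<exists>u. u * e = u \<and> x i = 1 * u" if "i < n" for i using frameD(1)[OF f that] by auto
  then obtain n' x' y' p' where "frame n' x' y' p'" "p' * p = p" "p * p' = p" "p' * (1 * v) = 1 * v"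
    using frame_extend_vector_in[OF f _ v, of 1] by metis
  then show thesis using that by (auto simp: frame_proj_def)
qed

lemma frame_proj_extend_covector:
  assumes p: "frame_proj p" and u: "e * u = u"
  obtains p' where "frame_proj p'" "p' * p = p" "p * p' = p" "u * p' = u"
proof -
  note pp = frame_proj_idempotent[OF p]
  obtain n x y where f: "frame n x y p" using p by (auto simp: frame_proj_def)
  define w where "w = u - u * p"
  show thesis
  proof (cases "w = 0")
    case True
    then show ?thesis using that[OF p pp pp] by (simp add: w_def)
  next
    case False
    have we: "e * w = w" using u by (simp add: w_def right_diff_distrib flip: mult.assoc)
    have wp: "w * p = 0" using pp by (simp add: w_def left_diff_distrib mult.assoc)
    obtain v0 where v0: "v0 * e = v0" "w * v0 = e" using ex_dual_vector[OF we False] by blast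
    define v where "v = v0 - p * v0"
    have v: "v * e = v" "p * v = 0" "w * v = e"
      using v0 pp wp mult_absorb[OF pp] mult_absorb[OF wp]
      by (simp_all add: v_def right_diff_distrib left_diff_distrib mult.assoc)
    have "(p + v * w) * p = p" "p * (p + v * w) = p"
      using pp wp v mult_absorb[OF v(2)] by (simp_all add: distrib_left distrib_right mult.assoc)
    moreover have "u * (p + v * w) = u"
    proof -
      have au: "u = w + u * p" by (simp add: w_def)
      have "u * p * v = 0" using v(2) by (simp add: mult.assoc)
      then have "u * v = e" using v(3) by (subst au) (simp add: distrib_right)
      then have "u * (p + v * w) = u * p + w" using we by (simp add: distrib_left flip: mult.assoc)
      then show ?thesis by (simp add: w_def)
    qed
    moreover have "frame_proj (p + v * w)"
      using frame_append[OF f v(1,2) we wp v(3)] by (auto simp: frame_proj_def)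
    ultimately show ?thesis using that by blast
  qed
qed

text \<open>The two-sided ideal generated by \<open>e\<close>.\<close>

inductive_set F :: "'a set" where
  zero: "0 \<in> F"
| add: "b \<in> F \<Longrightarrow> x * e = x \<Longrightarrow> e * y = y \<Longrightarrow> b + x * y \<in> F"

lemma F_rank_one: "x * e = x \<Longrightarrow> e * y = y \<Longrightarrow> x * y \<in> F"
  using F.add[OF F.zero] by simp

lemma F_add: assumes "b \<in> F" "c \<in> F" shows "b + c \<in> F"
  using assms(2)
proof induction
  case (add c x y)
  then show ?case using F.add[of "b + c" x y] by (simp add: add.assoc)
qed (use assms(1) in simp)

lemma F_mult_left: "b \<in> F \<Longrightarrow> a * b \<in> F"
proof (induction rule: F.induct)
  case (add b x y)
  then show ?case using F.add[of "a * b" "a * x" y] by (simp add: distrib_left mult.assoc)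
qed (simp add: F.zero)

lemma F_mult_right: "b \<in> F \<Longrightarrow> b * a \<in> F"
proof (induction rule: F.induct)
  case (add b x y)
  then show ?case using F.add[of "b * a" x "y * a"] by (simp add: distrib_right flip: mult.assoc)
qed (simp add: F.zero)

lemma F_scaleC: "b \<in> F \<Longrightarrow> c *\<^sub>C b \<in> F"
  using F_mult_left[of b "c *\<^sub>C 1"] by (simp add: scaleC_simps)

lemma F_diff: "b \<in> F \<Longrightarrow> c \<in> F \<Longrightarrow> b - c \<in> F"
  using F_add[of b "- c"] F_scaleC[of c "-1"] by (simp add: scaleC_simps)

lemma F_sum: "(\<And>i. i \<in> I \<Longrightarrow> f i \<in> F) \<Longrightarrow> (\<Sum>i\<in>I. f i) \<in> F"
  by (induction I rule: infinite_finite_induct) (auto simp: F.zero F_add)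

lemma e_in_F: "e \<in> F"
  using F_rank_one[OF ee ee] ee by simp

lemma two_sided_ideal_F: "two_sided_ideal F"
  by (simp add: two_sided_ideal_def left_ideal_def F.zero F_add F_mult_left F_mult_right)

lemma frame_in_F: "frame n x y p \<Longrightarrow> p \<in> F"
  using F_sum[of "{..<n}" "\<lambda>i. x i * y i"] F_rank_one by (auto simp: frame_def)

text \<open>Frame projections are local units of \<open>F\<close>: each rank-one summand is absorbed
  by adjoining its vector and then its covector. Starting above a given \<open>p\<close> is what
  lets several elements share one frame.\<close>

lemma F_dominate:
  assumes "b \<in> F" "frame_proj p"
  obtains q where "frame_proj q" "q * p = p" "p * q = p" "q * b = b" "b * q = b"
proof -
  from assms have "\<exists>q. frame_proj q \<and> q * p = p \<and> p * q = p \<and> q * b = b \<and> b * q = b"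
  proof (induction)
    case zero
    then show ?case using frame_proj_idempotent by (intro exI[of _ p]) auto
  next
    case (add b x y)
    then obtain q where q: "frame_proj q" "q * p = p" "p * q = p" "q * b = b" "b * q = b" by blast
    obtain r where r: "frame_proj r" "r * q = q" "q * r = q" "r * x = x"
      using frame_proj_extend_vector[OF q(1) add.hyps(2)] by blast
    obtain s where s: "frame_proj s" "s * r = r" "r * s = r" "y * s = y"
      using frame_proj_extend_covector[OF r(1) add.hyps(3)] by blast
    have "s * q = q" "q * s = q" using r s by (metis mult.assoc)+
    moreover have "s * x = x" using r s by (metis mult.assoc)
    moreover have "s * b = b" "b * s = b" "s * p = p" "p * s = p"
      using q \<open>s * q = q\<close> \<open>q * s = q\<close> by (metis mult.assoc)+
    ultimately have "s * p = p" "p * s = p" "s * (b + x * y) = b + x * y" "(b + x * y) * s = b + x * y"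
      using s(4) mult_absorb[OF \<open>s * x = x\<close>] by (simp_all add: distrib_left distrib_right mult.assoc)
    with s(1) show ?case by blast
  qed
  then show thesis using that by blast
qed

section \<open>Frame independence and cyclicity of \<open>tau\<close>\<close>

lemma trace_exchange:
  assumes f: "frame n x y p" and g: "frame m u v q"
  shows "(\<Sum>i<n. sc (y i * b * q * c * x i)) = (\<Sum>j<m. sc (v j * c * p * b * u j))"
proof -
  have 1: "sc (y i * b * q * c * x i) = (\<Sum>j<m. sc (y i * b * u j) * sc (v j * c * x i))"
    if i: "i < n" for i
  proof -
    have "y i * b * q * c * x i = (\<Sum>j<m. y i * b * u j * (v j * c * x i))"
      by (simp add: frameD(4)[OF g] sum_distrib_left sum_distrib_right mult.assoc)
    moreover have "sc (y i * b * u j * (v j * c * x i)) = sc (y i * b * u j) * sc (v j * c * x i)"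
      if "j < m" for j
      by (rule sc_mult_pairing[OF mult_absorb[OF frameD(2)[OF f i]] frameD(1)[OF g that]])
    ultimately show ?thesis by (simp add: sc_sum)
  qed
  have 2: "sc (v j * c * p * b * u j) = (\<Sum>i<n. sc (v j * c * x i) * sc (y i * b * u j))"
    if j: "j < m" for j
  proof -
    have "v j * c * p * b * u j = (\<Sum>i<n. v j * c * x i * (y i * b * u j))"
      by (simp add: frameD(4)[OF f] sum_distrib_left sum_distrib_right mult.assoc)
    moreover have "sc (v j * c * x i * (y i * b * u j)) = sc (v j * c * x i) * sc (y i * b * u j)"
      if "i < n" for i
      by (rule sc_mult_pairing[OF mult_absorb[OF frameD(2)[OF g j]] frameD(1)[OF f that]])
    ultimately show ?thesis by (simp add: sc_sum)
  qed
  \<comment> \<open>Both traces are the same double sum over the matrix entries of \<open>b\<close>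
    and \<open>c\<close> between the two frames, as for \<open>tr (B C) = tr (C B)\<close>.\<close>
  have "(\<Sum>i<n. sc (y i * b * q * c * x i)) =
      (\<Sum>i<n. \<Sum>j<m. sc (y i * b * u j) * sc (v j * c * x i))"
    by (intro sum.cong refl 1) simp
  also have "\<dots> = (\<Sum>j<m. \<Sum>i<n. sc (y i * b * u j) * sc (v j * c * x i))"
    by (rule sum.swap)
  also have "\<dots> = (\<Sum>j<m. sc (v j * c * p * b * u j))"
    by (intro sum.cong refl) (simp add: 2 mult.commute)
  finally show ?thesis .
qed

text \<open>The matrix trace in any frame whose range contains that of \<open>b\<close>. A frame
  that fixes \<open>b\<close> from the left suffices, which fits range frames.\<close>

definition tau :: "'a \<Rightarrow> complex" where
  "tau b = (THE c. \<forall>n x y p. frame n x y p \<longrightarrow> p * b = b \<longrightarrow> c = (\<Sum>i<n. sc (y i * b * x i)))"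

lemma trace_frame_independent:
  assumes "frame n x y p" "frame m u v q" "q * b = b" "b * p = b"
  shows "(\<Sum>i<n. sc (y i * b * x i)) = (\<Sum>j<m. sc (v j * b * u j))"
  using trace_exchange[OF assms(1,2), of 1 b] assms(3,4) mult_absorb[OF assms(3)]
    mult_absorb[OF assms(4)] by (simp add: mult.assoc)

lemma tau_frame:
  assumes f: "frame n x y p" and b: "p * b = b"
  shows "tau b = (\<Sum>i<n. sc (y i * b * x i))"
proof -
  have "b \<in> F" using F_mult_right[OF frame_in_F[OF f], of b] b by simp
  moreover have "frame_proj p" using f by (auto simp: frame_proj_def)
  ultimately obtain r where r: "frame_proj r" "b * r = b" using F_dominate by blast
  then obtain k s t where rf: "frame k s t r" by (auto simp: frame_proj_def)
  \<comment> \<open>The exchange compares a frame absorbing \<open>b\<close> on the right with one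
    absorbing it on the left. Two frames of the latter kind are therefore compared through
    \<open>r\<close>.\<close>
  have indep: "(\<Sum>i<n. sc (y i * b * x i)) = (\<Sum>i<n'. sc (y' i * b * x' i))"
    if "frame n' x' y' p'" "p' * b = b" for n' x' y' p'
  proof -
    have "(\<Sum>i<k. sc (t i * b * s i)) = (\<Sum>i<n. sc (y i * b * x i))"
      by (rule trace_frame_independent[OF rf f b r(2)])
    moreover have "(\<Sum>i<k. sc (t i * b * s i)) = (\<Sum>i<n'. sc (y' i * b * x' i))"
      by (rule trace_frame_independent[OF rf that r(2)])
    ultimately show ?thesis by simp
  qed
  show "tau b = (\<Sum>i<n. sc (y i * b * x i))" unfolding tau_def
  proof (rule the_equality)
    show "\<forall>n' x' y' p'. frame n' x' y' p' \<longrightarrow> p' * b = b \<longrightarrow>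
        (\<Sum>i<n. sc (y i * b * x i)) = (\<Sum>i<n'. sc (y' i * b * x' i))"
      using indep by blast
  next
    fix c assume "\<forall>n x y p. frame n x y p \<longrightarrow> p * b = b \<longrightarrow> c = (\<Sum>i<n. sc (y i * b * x i))"
    from this[rule_format, OF f b] show "c = (\<Sum>i<n. sc (y i * b * x i))" .
  qed
qed

lemma ex_frame:
  assumes "b \<in> F" "c \<in> F"
  obtains n x y p where "frame n x y p" "p * b = b" "b * p = b" "p * c = c" "c * p = c"
proof -
  have "frame_proj 0" unfolding frame_proj_def using frame_zero by blast
  then obtain q where q: "frame_proj q" "q * b = b" "b * q = b"
    using F_dominate[OF assms(1)] by blast
  obtain p where p: "frame_proj p" "p * q = q" "q * p = q" "p * c = c" "c * p = c"
    using F_dominate[OF assms(2) q(1)] by blast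
  moreover have "p * b = b" "b * p = b" using p q by (metis mult.assoc)+
  ultimately show thesis using that by (auto simp: frame_proj_def)
qed

lemma tau_frame_right:
  assumes f: "frame n x y p" and b: "b * p = b"
  shows "tau b = (\<Sum>i<n. sc (y i * b * x i))"
proof -
  have "b \<in> F" using F_mult_left[OF frame_in_F[OF f], of b] b by simp
  then obtain m u v q where g: "frame m u v q" "q * b = b" using ex_frame F.zero by metis
  then show ?thesis using tau_frame trace_frame_independent[OF f g b] by simp
qed

lemma tau_add: assumes "b \<in> F" "c \<in> F" shows "tau (b + c) = tau b + tau c"
proof -
  obtain n x y p where f: "frame n x y p" "p * b = b" "p * c = c" using ex_frame[OF assms] by metis
  then show ?thesis using tau_frame[OF f(1)]
    by (simp add: distrib_left distrib_right sc_add sum.distrib)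
qed

lemma tau_scaleC: assumes "b \<in> F" shows "tau (c *\<^sub>C b) = c * tau b"
proof -
  obtain n x y p where f: "frame n x y p" "p * b = b" using ex_frame[OF assms assms] by metis
  then show ?thesis using tau_frame[OF f(1)]
    by (simp add: scaleC_simps sc_scaleC sum_distrib_left)
qed

lemma tau_diff: "b \<in> F \<Longrightarrow> c \<in> F \<Longrightarrow> tau (b - c) = tau b - tau c"
  using tau_add[of b "(-1) *\<^sub>C c"] tau_scaleC[of c "-1"] F_scaleC[of c "-1"]
  by (simp add: scaleC_simps)

lemma tau_zero [simp]: "tau 0 = 0"
  using tau_scaleC[OF F.zero, of 0] by simp

lemma tau_commute: assumes "b \<in> F" shows "tau (b * c) = tau (c * b)"
proof -
  obtain n x y p where f: "frame n x y p" "p * b = b" "b * p = b" using ex_frame[OF assms assms] by metis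
  have "tau (b * c) = (\<Sum>i<n. sc (y i * (b * c) * x i))"
    by (rule tau_frame[OF f(1)]) (rule mult_absorb[OF f(2)])
  also have "\<dots> = (\<Sum>i<n. sc (y i * b * p * c * x i))"
    using mult_absorb[OF f(3)] by (simp add: mult.assoc)
  also have "\<dots> = (\<Sum>j<n. sc (y j * c * p * b * x j))" by (rule trace_exchange[OF f(1) f(1)])
  also have "\<dots> = (\<Sum>j<n. sc (y j * (c * b) * x j))"
    using mult_absorb[OF f(2)] by (simp add: mult.assoc)
  also have "\<dots> = tau (c * b)"
    by (rule tau_frame_right[OF f(1), symmetric]) (simp add: mult.assoc f(3))
  finally show ?thesis .
qed

lemma tau_frame_proj: assumes f: "frame n x y p" shows "tau p = of_nat n"
proof -
  have "tau p = (\<Sum>i<n. sc (y i * p * x i))" by (rule tau_frame[OF f frame_idempotent[OF f]])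
  also have "\<dots> = (\<Sum>i<n. 1)"
    using covector_frame_proj[OF f] frameD(3)[OF f] by (intro sum.cong) auto
  finally show ?thesis by simp
qed

lemma tau_rank_one: assumes "x * e = x" "e * y = y" shows "tau (x * y) = sc (y * x)"
proof -
  have "x * e \<in> F" by (rule F_mult_left[OF e_in_F])
  then have "tau (x * y) = tau (y * x)" using tau_commute[of x y] assms(1) by simp
  then show ?thesis
    using pairing[OF assms(2,1)] tau_scaleC[OF e_in_F, of "sc (y * x)"] tau_frame_proj[OF frame_e]
    by simp
qed

text \<open>\<open>a A e\<close> is spanned by the finitely many \<open>a * s j\<close>; the
  Gram--Schmidt step adjoins them in turn. Since every \<open>x i\<close> is in \<open>a A e\<close>
  and \<open>p * a = a\<close>, the frame spans exactly the range of \<open>a\<close>, and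
  \<open>n\<close> will be its rank.\<close>

lemma ex_range_frame:
  assumes "a \<in> F"
  obtains n x y p u where "frame n x y p" "p * a = a"
    "\<And>i. i < n \<Longrightarrow> u i * e = u i" "\<And>i. i < n \<Longrightarrow> x i = a * u i"
proof -
  obtain m s t q where g: "frame m s t q" "a * q = a" using ex_frame[OF assms assms] by metis
  have "\<exists>n x y p. frame n x y p \<and> (\<forall>i<n. \<exists>u. u * e = u \<and> x i = a * u) \<and>
    (\<forall>j<k. p * (a * s j) = a * s j)" if "k \<le> m" for k
    using that
  proof (induction k)
    case 0
    then show ?case using frame_zero by fastforce
  next
    case (Suc k)
    then obtain n x y p where f: "frame n x y p" "\<And>i. i < n \<Longrightarrow> \<exists>u. u * e = u \<and> x i = a * u"
      "\<And>j. j < k \<Longrightarrow> p * (a * s j) = a * s j" by auto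
    have "s k * e = s k" using frameD(1)[OF g(1)] Suc.prems by simp
    then obtain n' x' y' p' where f': "frame n' x' y' p'"
      "\<And>i. i < n' \<Longrightarrow> \<exists>u. u * e = u \<and> x' i = a * u"
      "p' * p = p" "p' * (a * s k) = a * s k"
      using frame_extend_vector_in[OF f(1,2)] by metis
    have "p' * (a * s j) = a * s j" if "j < k" for j
      using f(3)[OF that] f'(3) by (metis mult.assoc)
    then have "\<forall>j<Suc k. p' * (a * s j) = a * s j" using f'(4) by (auto simp: less_Suc_eq)
    then show ?case using f'(1,2) by blast
  qed
  then obtain n x y p where f: "frame n x y p" "\<forall>i<n. \<exists>u. u * e = u \<and> x i = a * u"
    "\<forall>j<m. p * (a * s j) = a * s j" by blast
  have "a = (\<Sum>j<m. a * s j * t j)"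
    using g by (metis (no_types, lifting) frameD(4) mult.assoc sum.cong sum_distrib_left)
  then have "p * a = (\<Sum>j<m. p * (a * s j) * t j)" by (metis (no_types, lifting) mult.assoc sum.cong sum_distrib_left)
  also have "\<dots> = a" using f(3) \<open>a = (\<Sum>j<m. a * s j * t j)\<close> by simp
  finally have pa: "p * a = a" .
  obtain u where "\<forall>i<n. u i * e = u i \<and> x i = a * u i" using f(2) by metis
  then show thesis using that[OF f(1) pa] by blast
qed

text \<open>A range frame of \<open>q\<close> has the right vectors; replacing the covectors by
  \<open>y i * q\<close> turns the frame projection into \<open>q\<close> itself.\<close>

lemma idempotent_frame:
  assumes "q \<in> F" "q * q = q" obtains n x y where "frame n x y q"
proof -
  obtain n x y p u where f: "frame n x y p" "p * q = q"
    "\<And>i. i < n \<Longrightarrow> u i * e = u i" "\<And>i. i < n \<Longrightarrow> x i = q * u i"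
    using ex_range_frame[OF assms(1)] by metis
  have qx: "q * x i = x i" if "i < n" for i using f(4)[OF that] assms(2) by (metis mult.assoc)
  have "q = (\<Sum>i<n. x i * (y i * q))"
    using f(2) frameD(4)[OF f(1)] by (simp add: sum_distrib_right mult.assoc)
  moreover have "y i * q * x j = y i * x j" if "i < n" "j < n" for i j
    using qx[OF that(2)] by (simp add: mult.assoc)
  ultimately have "frame n x (\<lambda>i. y i * q) q"
    unfolding frame_def using frameD[OF f(1)] by (auto simp flip: mult.assoc)
  then show thesis by (rule that)
qed

lemma idempotent_frame_tau:
  assumes "q \<in> F" "q * q = q" "tau q = of_nat n" obtains x y where "frame n x y q"
proof -
  obtain m x y where f: "frame m x y q" using idempotent_frame[OF assms(1,2)] by blast
  then have "m = n" using tau_frame_proj[OF f] assms(3) by simp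
  then show thesis using that f by blast
qed

text \<open>This takes the place of dimension counting: an idempotent contained in another one of
  equal trace is equal to it.\<close>

lemma idempotent_tau_zero: "q \<in> F \<Longrightarrow> q * q = q \<Longrightarrow> tau q = 0 \<Longrightarrow> q = 0"
  using idempotent_frame_tau[of q 0] by (auto simp: frame_def)

end

section \<open>Triangularisation\<close>

lemma unit_elt_mult_iff_right:
  assumes "unit_elt y" shows "unit_elt (x * y) \<longleftrightarrow> unit_elt x"
proof
  obtain y' where *: "y * y' = 1" "y' * y = 1" using assms unfolding unit_elt_def by blast
  then have "unit_elt y'" unfolding unit_elt_def by blast
  moreover assume "unit_elt (x * y)"
  ultimately have "unit_elt (x * y * y')" by (metis unit_elt_mult)
  then show "unit_elt x" using * by (simp add: mult.assoc)
qed (rule unit_elt_mult[OF _ assms])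

lemma unit_elt_one: "unit_elt 1"
  by (auto simp: unit_elt_def)

lemma nonzero_spectrum_zero: "nonzero_spectrum (0 :: 'a::complex_banach_algebra_1) = {}"
  using unit_elt_scaleC_iff[of _ "1::'a"] unit_elt_one by (auto simp: nonzero_spectrum_iff)

text \<open>Because \<open>C * U = 0\<close>, the product of \<open>c - C\<close> and
  \<open>c - U\<close> is \<open>c\<close> times \<open>c - (U + C)\<close>. The second factor is
  invertible for \<open>c\<close> different from \<open>0\<close> and \<open>m\<close>, as
  \<open>U\<close> satisfies \<open>U * U = m *\<^sub>C U\<close>; the point \<open>m\<close> is
  settled by hypothesis.\<close>

lemma nonzero_spectrum_triangular:
  fixes U C :: "'a::complex_banach_algebra_1"
  assumes CU: "C * U = 0" and UU: "U * U = m *\<^sub>C U" and m: "m \<in> spectrum (U + C)"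
  shows "nonzero_spectrum (U + C) = nonzero_spectrum C \<union> ({m} - {0})"
proof -
  have "unit_elt (c *\<^sub>C 1 - (U + C)) \<longleftrightarrow> unit_elt (c *\<^sub>C 1 - C)" if c: "c \<noteq> 0" "c \<noteq> m" for c
  proof -
    \<comment> \<open>\<open>k\<close> solves \<open>(c - U) * (1 + k U) = c\<close>, that is,
      \<open>c k - m k = 1\<close>.\<close>
    define k where "k = inverse (c - m)"
    define W where "W = inverse c *\<^sub>C (1 + k *\<^sub>C U)"
    have "(c - m) * k = 1" using c by (simp add: k_def)
    then have "c * k = 1 + m * k" by (simp add: algebra_simps)
    then have k: "c *\<^sub>C k *\<^sub>C U = U + (m * k) *\<^sub>C U" by (simp add: scaleC_simps)
    have "(c *\<^sub>C 1 - U) * (1 + k *\<^sub>C U) = c *\<^sub>C 1 + c *\<^sub>C k *\<^sub>C U - U - k *\<^sub>C (U * U)"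
      by (simp add: algebra_simps scaleC_simps)
    then have 1: "(c *\<^sub>C 1 - U) * (1 + k *\<^sub>C U) = c *\<^sub>C 1"
      unfolding k UU by (simp add: scaleC_simps mult.commute)
    have "(1 + k *\<^sub>C U) * (c *\<^sub>C 1 - U) = c *\<^sub>C 1 + c *\<^sub>C k *\<^sub>C U - U - k *\<^sub>C (U * U)"
      by (simp add: algebra_simps scaleC_simps)
    then have 2: "(1 + k *\<^sub>C U) * (c *\<^sub>C 1 - U) = c *\<^sub>C 1"
      unfolding k UU by (simp add: scaleC_simps mult.commute)
    have "(c *\<^sub>C 1 - U) * W = 1" "W * (c *\<^sub>C 1 - U) = 1"
      unfolding W_def mult_scaleC_left mult_scaleC_right 1 2 using c by (simp_all add: scaleC_simps)
    then have U: "unit_elt (c *\<^sub>C 1 - U)" unfolding unit_elt_def by blast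
    have "(c *\<^sub>C 1 - C) * (c *\<^sub>C 1 - U) = c *\<^sub>C (c *\<^sub>C 1 - (U + C))"
      using CU by (simp add: algebra_simps scaleC_simps)
    then show ?thesis
      using unit_elt_mult_iff_right[OF U, of "c *\<^sub>C 1 - C"] unit_elt_scaleC_iff[OF c(1)] by metis
  qed
  then have "c \<in> nonzero_spectrum (U + C) \<longleftrightarrow> c \<in> nonzero_spectrum C" if "c \<noteq> m" for c
    using that unfolding nonzero_spectrum_iff by blast
  moreover have "m \<in> nonzero_spectrum (U + C)" if "m \<noteq> 0"
    using that m by (simp add: nonzero_spectrum_def)
  ultimately have "c \<in> nonzero_spectrum (U + C) \<longleftrightarrow> c \<in> nonzero_spectrum C \<union> ({m} - {0})" for c
    by (cases "c = m") (auto simp: nonzero_spectrum_iff)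
  then show ?thesis by blast
qed

text \<open>The remainder is kept in the form \<open>U * z * C\<close> because cyclicity and
  \<open>C * U = 0\<close> make its trace vanish.\<close>

lemma power_triangular:
  fixes U C :: "'a::complex_banach_algebra_1"
  assumes CU: "C * U = 0" and UU: "U * U = m *\<^sub>C U"
  shows "\<exists>z. (U + C) ^ Suc k = C ^ Suc k + m ^ k *\<^sub>C U + U * z * C"
proof (induction k)
  case 0 show ?case by (intro exI[of _ 0]) (simp add: scaleC_simps)
next
  case (Suc k)
  then obtain z where z: "(U + C) ^ Suc k = C ^ Suc k + m ^ k *\<^sub>C U + U * z * C" by blast
  have CU': "C * (U * w) = 0" and UU': "U * (U * w) = m *\<^sub>C (U * w)" for w
    using CU UU by (simp_all flip: mult.assoc add: scaleC_simps)
  have "(U + C) ^ Suc (Suc k) = (U + C) * (C ^ Suc k + m ^ k *\<^sub>C U + U * z * C)"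
    unfolding power_Suc[of _ "Suc k"] z ..
  also have "\<dots> = C * C ^ Suc k + U * C ^ Suc k + (m * m ^ k) *\<^sub>C U + m *\<^sub>C (U * z * C)"
    by (simp add: distrib_left distrib_right mult.assoc CU CU' UU UU' scaleC_simps mult.commute[of m]
        del: power_Suc)
  also have "U * C ^ Suc k = U * C ^ k * C" by (simp add: power_Suc2 mult.assoc del: power_Suc)
  also have "C * C ^ Suc k + U * C ^ k * C + (m * m ^ k) *\<^sub>C U + m *\<^sub>C (U * z * C) =
      C ^ Suc (Suc k) + m ^ Suc k *\<^sub>C U + U * (C ^ k + m *\<^sub>C z) * C"
    by (simp add: distrib_left distrib_right scaleC_simps)
  finally show ?case by blast
qed

section \<open>Eigenvectors in the range of a frame projection\<close>

context minimal_idempotent_algebra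
begin

text \<open>A range frame of \<open>a\<close> gives a right inverse \<open>U\<close> onto the
  idempotent \<open>q'\<close>. The defect \<open>p - U * a\<close> is killed by \<open>a\<close>,
  so injectivity gives \<open>U * a = p\<close>. Then \<open>q' = a * U\<close> and \<open>p\<close>
  have equal trace by cyclicity, and hence coincide.\<close>

lemma corner_injective_imp_invertible:
  assumes f: "frame n x y p" and a: "p * a = a" "a * p = a"
    and inj: "\<And>v. v * e = v \<Longrightarrow> p * v = v \<Longrightarrow> a * v = 0 \<Longrightarrow> v = 0"
  obtains g where "p * g = g" "g * p = g" "g * a = p" "a * g = p"
proof -
  note pp = frame_idempotent[OF f] and pF = frame_in_F[OF f]
  have aF: "a \<in> F" using F_mult_right[OF pF, of a] a by simp
  obtain r s t q u where g: "frame r s t q" "q * a = a"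
    "\<And>i. i < r \<Longrightarrow> u i * e = u i" "\<And>i. i < r \<Longrightarrow> s i = a * u i"
    using ex_range_frame[OF aF] by metis
  define V where "V = (\<Sum>i<r. u i * t i)"
  have q: "q = a * V"
    unfolding V_def frameD(4)[OF g(1)] sum_distrib_left using g(4)
    by (intro sum.cong) (simp_all add: mult.assoc)
  define U where "U = p * V * p"
  define q' where "q' = q * p"
  have aU: "a * U = q'" using a mult_absorb[OF a(2)] by (simp add: U_def q'_def q mult.assoc)
  have U: "p * U = U" "U * p = U"
    using pp mult_absorb[OF pp] by (simp_all add: U_def mult.assoc)
  have q'a: "q' * a = a" using a g(2) by (simp add: q'_def mult.assoc)
  have pq': "p * q' = q'" "q' * p = q'"
    using mult_absorb[OF a(1)] pp by (simp_all add: q'_def q mult.assoc)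
  have q'q': "q' * q' = q'" using q'a aU by (metis mult.assoc)
  define h where "h = p - U * a"
  have UaUa: "U * a * (U * a) = U * a" using q'a aU by (metis mult.assoc)
  have ah: "a * h = 0" using a q'a mult_absorb[OF aU] by (simp add: h_def right_diff_distrib)
  have ph: "p * h = h" "h * p = h"
    using pp mult_absorb[OF U(1)] a by (simp_all add: h_def algebra_simps)
  have "h * x i = 0" if "i < n" for i
    using that inj[of "h * x i"] frameD(1)[OF f that] mult_absorb[OF ph(1)] mult_absorb[OF ah]
    by (simp add: mult.assoc)
  then have "h * p = 0"
    unfolding frameD(4)[OF f] sum_distrib_left by (intro sum.neutral) (auto simp flip: mult.assoc)
  then have Ua: "U * a = p" using ph by (simp add: h_def)
  have "tau q' = tau p" using tau_commute[OF aF, of U] aU Ua by simp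
  then have "tau (p - q') = 0"
    using tau_diff[OF pF] F_mult_right[OF aF, of U] aU by simp
  moreover have "(p - q') * (p - q') = p - q'" using pp q'q' pq' by (simp add: algebra_simps)
  moreover have "p - q' \<in> F" using F_diff[OF pF] F_mult_right[OF aF, of U] aU by simp
  ultimately have "p = q'" using idempotent_tau_zero[of "p - q'"] by simp
  then show thesis using that[OF U Ua] aU by simp
qed

lemma not_invertible_imp_eigenvector:
  assumes f: "frame n x y p" and b: "p * b = b"
    and not_inv: "\<nexists>g. p * g = g \<and> g * p = g \<and> g * (c *\<^sub>C p - b * p) = p \<and> (c *\<^sub>C p - b * p) * g = p"
  obtains v where "v * e = v" "v \<noteq> 0" "p * v = v" "b * v = c *\<^sub>C v"
proof (rule ccontr)
  note obt = that
  assume "\<not> thesis"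
  have no: "v = 0" if v: "v * e = v" "p * v = v" "b * v = c *\<^sub>C v" for v
    using obt[OF v(1) _ v(2,3)] \<open>\<not> thesis\<close> by blast
  note pp = frame_idempotent[OF f]
  define a where "a = c *\<^sub>C p - b * p"
  have a: "p * a = a" "a * p = a"
    using pp mult_absorb[OF b] by (simp_all add: a_def right_diff_distrib left_diff_distrib scaleC_simps mult.assoc)
  have inj: "v = 0" if "v * e = v" "p * v = v" "a * v = 0" for v
  proof (rule no[OF that(1,2)])
    have "a * v = c *\<^sub>C v - b * v" using that(2) by (simp add: a_def left_diff_distrib scaleC_simps mult.assoc)
    then show "b * v = c *\<^sub>C v" using that(3) by simp
  qed
  obtain g where "p * g = g" "g * p = g" "g * a = p" "a * g = p"
    using corner_injective_imp_invertible[OF f a inj] by blast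
  then show False using not_inv[folded a_def] by blast
qed

text \<open>Gelfand--Mazur in the corner of \<open>p\<close> replaces a root of the characteristic
  polynomial.\<close>

lemma ex_eigenvector:
  assumes f: "frame n x y p" and n: "n > 0" and b: "p * b = b"
  obtains c v where "v * e = v" "v \<noteq> 0" "p * v = v" "b * v = c *\<^sub>C v"
proof -
  note pp = frame_idempotent[OF f]
  have "p \<noteq> 0" using tau_frame_proj[OF f] n by auto
  moreover have "p * (b * p) = b * p" "b * p * p = b * p"
    using pp mult_absorb[OF b] by (simp_all add: mult.assoc)
  ultimately obtain c where
    "\<nexists>g. p * g = g \<and> g * p = g \<and> g * (c *\<^sub>C p - b * p) = p \<and> (c *\<^sub>C p - b * p) * g = p"
    using corner_spectrum_nonempty[OF pp] by metis
  from not_invertible_imp_eigenvector[OF f b this] show thesis using that by blast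
qed

lemma nonzero_spectrum_eigenvector:
  assumes f: "frame n x y p" and b: "p * b = b" and c: "c \<in> nonzero_spectrum b"
  obtains v where "v * e = v" "v \<noteq> 0" "p * v = v" "b * v = c *\<^sub>C v"
proof -
  note pp = frame_idempotent[OF f]
  have c': "c \<in> nonzero_spectrum (b * p)" using c b nonzero_spectrum_commute[of b p] by simp
  then have c0: "c \<noteq> 0" by (simp add: nonzero_spectrum_def)
  have "\<nexists>g. p * g = g \<and> g * p = g \<and> g * (c *\<^sub>C p - b * p) = p \<and> (c *\<^sub>C p - b * p) * g = p"
  proof
    assume "\<exists>g. p * g = g \<and> g * p = g \<and> g * (c *\<^sub>C p - b * p) = p \<and> (c *\<^sub>C p - b * p) * g = p"
    then obtain g where g: "p * g = g" "g * p = g" "g * (c *\<^sub>C p - b * p) = p" "(c *\<^sub>C p - b * p) * g = p"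
      by blast
    \<comment> \<open>The corner inverse is completed by \<open>inverse c\<close> on the complement
      of \<open>p\<close>, where \<open>c *\<^sub>C 1 - b * p\<close> acts as
      \<open>c\<close>.\<close>
    define h where "h = g + inverse c *\<^sub>C (1 - p)"
    define a where "a = c *\<^sub>C p - b * p"
    have a: "p * a = a" "a * p = a" using pp mult_absorb[OF b]
      by (simp_all add: a_def right_diff_distrib left_diff_distrib scaleC_simps mult.assoc)
    have ag: "a * g = p" "g * a = p" using g by (simp_all add: a_def)
    have "c *\<^sub>C 1 - b * p = a + c *\<^sub>C (1 - p)" by (simp add: a_def scaleC_simps)
    moreover have "(a + c *\<^sub>C (1 - p)) * h = 1" "h * (a + c *\<^sub>C (1 - p)) = 1"
      using c0 a g(1,2) ag pp by (simp_all add: h_def algebra_simps scaleC_simps)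
    ultimately have "unit_elt (c *\<^sub>C 1 - b * p)" unfolding unit_elt_def by metis
    then show False using c' by (simp add: nonzero_spectrum_iff)
  qed
  from not_invertible_imp_eigenvector[OF f b this] show thesis using that by blast
qed

lemma nonzero_spectrum_bound:
  assumes "frame n x y p" "p * b = b" "c \<in> nonzero_spectrum b"
  shows "cmod c \<le> norm b"
proof -
  obtain v where v: "v * e = v" "v \<noteq> 0" "p * v = v" "b * v = c *\<^sub>C v"
    by (rule nonzero_spectrum_eigenvector[OF assms])
  have "cmod c * norm v = norm (b * v)" unfolding v(4) norm_scaleC ..
  also have "\<dots> \<le> norm b * norm v" by (rule norm_mult_ineq)
  finally show ?thesis using v(2) by simp
qed

text \<open>\<open>v * w\<close> is an idempotent of trace \<open>1\<close> below \<open>p\<close>,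
  so the complement has trace \<open>n\<close>, and the trace of an idempotent is the size of its
  frames.\<close>

lemma frame_split:
  assumes f: "frame (Suc n) x y p" and v: "v * e = v" "p * v = v"
    and w: "e * w = w" "w * p = w" "w * v = e"
  obtains x' y' where "frame n x' y' (p - v * w)"
proof -
  note pp = frame_idempotent[OF f] and pF = frame_in_F[OF f]
  have gF: "v * w \<in> F" by (rule F_rank_one[OF v(1) w(1)])
  have "tau (v * w) = 1" using tau_rank_one[OF v(1) w(1)] w(3) by simp
  then have "tau (p - v * w) = of_nat n" using tau_diff[OF pF gF] tau_frame_proj[OF f] by simp
  moreover have "(p - v * w) * (p - v * w) = p - v * w"
    using pp v w mult_absorb[OF w(3)] mult_absorb[OF v(2)] by (simp add: algebra_simps)
  ultimately show thesis using idempotent_frame_tau[OF F_diff[OF pF gF]] that by blast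
qed

text \<open>Triangularisation of \<open>b\<close> on the range of \<open>p\<close>: the \<open>\<mu> i\<close> are the eigenvalues counted with
  multiplicity, and the perturbation \<open>d\<close> shifts the diagonal so as to split coinciding ones.\<close>

lemma ex_eigenvalues:
  assumes "frame n x y p" "p * b = b"
  shows "\<exists>\<mu> d. p * d = d \<and> d * p = d \<and>
    (\<forall>t. nonzero_spectrum (b + t *\<^sub>C d) = (\<lambda>i. \<mu> i + t * of_nat (Suc i)) ` {..<n} - {0} \<and>
      (\<forall>k. tau ((b + t *\<^sub>C d) ^ Suc k) = (\<Sum>i<n. (\<mu> i + t * of_nat (Suc i)) ^ Suc k)))"
  using assms
proof (induction n arbitrary: x y p b)
  case 0
  then have "p = 0" "b = 0" by (auto simp: frame_def)
  then show ?case by (intro exI[of _ "\<lambda>_. 0"] exI[of _ 0]) (simp add: nonzero_spectrum_zero scaleC_simps)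
next
  case (Suc n)
  note f = Suc.prems(1) and b = Suc.prems(2)
  note pp = frame_idempotent[OF f] and pF = frame_in_F[OF f]
  obtain m v where v: "v * e = v" "v \<noteq> 0" "p * v = v" "b * v = m *\<^sub>C v"
    by (rule ex_eigenvector[OF f zero_less_Suc b])
  obtain w0 where w0: "e * w0 = w0" "w0 * v = e" using ex_dual_covector[OF v(1,2)] by blast
  define w where "w = w0 * p"
  have w: "e * w = w" "w * v = e" "w * p = w"
    using w0 v(3) pp mult_absorb[OF w0(1)] by (simp_all add: w_def mult.assoc)
  define g where "g = v * w"
  have gg: "g * g = g" using w mult_absorb[OF w(2)] v by (simp add: g_def mult.assoc)
  have gp: "p * g = g" "g * p = g" using v w mult_absorb[OF v(3)] by (simp_all add: g_def mult.assoc)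
  have gv: "g * v = v" using v w by (simp add: g_def mult.assoc)
  have gF: "g \<in> F" unfolding g_def by (rule F_rank_one[OF v(1) w(1)])
  have tau_g: "tau g = 1" using tau_rank_one[OF v(1) w(1)] w(2) by (simp add: g_def)
  define p' where "p' = p - g"
  obtain x' y' where f': "frame n x' y' p'"
    using frame_split[OF f v(1,3) w(1,3,2)] unfolding p'_def g_def by blast
  note p'p' = frame_idempotent[OF f']
  have p'b: "p' * (p' * b) = p' * b" by (rule mult_absorb[OF p'p'])
  obtain \<mu> d where "p' * d = d \<and> d * p' = d \<and>
    (\<forall>t. nonzero_spectrum (p' * b + t *\<^sub>C d) = (\<lambda>i. \<mu> i + t * of_nat (Suc i)) ` {..<n} - {0} \<and>
      (\<forall>k. tau ((p' * b + t *\<^sub>C d) ^ Suc k) = (\<Sum>i<n. (\<mu> i + t * of_nat (Suc i)) ^ Suc k)))"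
    using Suc.IH[OF f' p'b] by (elim exE)
  then have d: "p' * d = d" "d * p' = d"
    and spec: "\<And>t. nonzero_spectrum (p' * b + t *\<^sub>C d) = (\<lambda>i. \<mu> i + t * of_nat (Suc i)) ` {..<n} - {0}"
    and pow: "\<And>t k. tau ((p' * b + t *\<^sub>C d) ^ Suc k) = (\<Sum>i<n. (\<mu> i + t * of_nat (Suc i)) ^ Suc k)"
    by simp_all
  have pp'g: "p' * g = 0" "g * p' = 0" "p * p' = p'" "p' * p = p'"
    using pp gg gp by (simp_all add: p'_def right_diff_distrib left_diff_distrib)
  have p'v: "p' * v = 0" using v(3) gv by (simp add: p'_def left_diff_distrib)
  \<comment> \<open>The new eigenvalue gets the shift \<open>n + 1\<close>, different from the
    shifts \<open>1\<close> to \<open>n\<close> already contained in \<open>d\<close>. Shifts start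
    at \<open>1\<close> so that zero eigenvalues move as well.\<close>
  define D where "D = d + of_nat (Suc n) *\<^sub>C g"
  have pd: "p * d = d" "d * p = d" using d pp'g by (metis mult.assoc)+
  have pD: "p * D = D" "D * p = D" using pd gp by (simp_all add: D_def distrib_left distrib_right scaleC_simps)
  have "d * v = 0" using d(2) p'v by (metis mult.assoc mult_zero_right)
  then have Dv: "D * v = of_nat (Suc n) *\<^sub>C v" using gv by (simp add: D_def distrib_right scaleC_simps)
  have p'D: "p' * D = d" using d(1) pp'g by (simp add: D_def distrib_left scaleC_simps)
  define \<nu> where "\<nu> = \<mu>(n := m)"
  have "nonzero_spectrum (b + t *\<^sub>C D) = (\<lambda>i. \<nu> i + t * of_nat (Suc i)) ` {..<Suc n} - {0} \<and>
      (\<forall>k. tau ((b + t *\<^sub>C D) ^ Suc k) = (\<Sum>i<Suc n. (\<nu> i + t * of_nat (Suc i)) ^ Suc k))" for t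
  proof -
    define B where "B = b + t *\<^sub>C D"
    define M where "M = m + t * of_nat (Suc n)"
    \<comment> \<open>\<open>v\<close> is an eigenvector of \<open>B\<close>, so \<open>B\<close> is
      block triangular for \<open>p = g + p'\<close>; \<open>U\<close> and \<open>C\<close> are its
      two block rows, and \<open>p' * B * g = 0\<close> gives \<open>C * U = 0\<close>.\<close>
    define U where "U = g * B"
    define C where "C = p' * B"
    have C: "C = p' * b + t *\<^sub>C d" by (simp add: C_def B_def distrib_left scaleC_simps p'D)
    have "p * B = B" using b pD by (simp add: B_def distrib_left scaleC_simps)
    then have UC: "U + C = B" by (simp add: U_def C_def p'_def algebra_simps)
    have Bv: "B * v = M *\<^sub>C v" using v(4) Dv
      by (simp add: B_def M_def distrib_right scaleC_simps del: of_nat_Suc)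
    then have Bg: "B * g = M *\<^sub>C g" by (simp add: g_def scaleC_simps flip: mult.assoc)
    have CU: "C * U = 0"
      using mult_absorb[OF Bg, of B] mult_absorb[OF pp'g(1)] by (simp add: C_def U_def mult.assoc scaleC_simps)
    have UU: "U * U = M *\<^sub>C U"
      using mult_absorb[OF Bg, of B] mult_absorb[OF gg] by (simp add: U_def mult.assoc scaleC_simps)
    have "M \<in> spectrum (U + C)" unfolding UC by (rule eigenvector_in_spectrum[OF Bv v(2)])
    from nonzero_spectrum_triangular[OF CU UU this]
    have "nonzero_spectrum B = nonzero_spectrum C \<union> ({M} - {0})" by (simp only: UC)
    moreover have "(\<lambda>i. \<nu> i + t * of_nat (Suc i)) ` {..<Suc n} =
        insert M ((\<lambda>i. \<mu> i + t * of_nat (Suc i)) ` {..<n})"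
      unfolding lessThan_Suc image_insert by (auto simp: \<nu>_def M_def)
    ultimately have 1: "nonzero_spectrum B = (\<lambda>i. \<nu> i + t * of_nat (Suc i)) ` {..<Suc n} - {0}"
      using spec[of t] C by auto
    have UF: "U \<in> F" unfolding U_def by (rule F_mult_right[OF gF])
    have CF: "C \<in> F" unfolding C_def using frame_in_F[OF f'] by (rule F_mult_right)
    have "tau U = tau (M *\<^sub>C g)" unfolding U_def using tau_commute[OF gF, of B] Bg by simp
    then have tauU: "tau U = M" using tau_scaleC[OF gF] tau_g by simp
    have "tau (B ^ Suc k) = (\<Sum>i<Suc n. (\<nu> i + t * of_nat (Suc i)) ^ Suc k)" for k
    proof -
      obtain z where z: "B ^ Suc k = C ^ Suc k + M ^ k *\<^sub>C U + U * z * C"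
        using power_triangular[OF CU UU] UC by metis
      have "C ^ Suc k \<in> F" using F_mult_right[OF CF] by simp
      moreover have "U * z * C \<in> F" by (rule F_mult_left[OF CF])
      moreover have "tau (U * z * C) = tau (C * (U * z))" using tau_commute[OF CF] by simp
      then have "tau (U * z * C) = 0" using mult_absorb[OF CU] by simp
      ultimately have "tau (B ^ Suc k) = tau (C ^ Suc k) + M ^ k * M"
        unfolding z using UF by (simp add: tau_add F_add F_scaleC tau_scaleC tauU del: power_Suc)
      then show ?thesis using pow[of t k] C by (simp add: \<nu>_def M_def mult.commute)
    qed
    with 1 show ?thesis by (simp only: B_def) blast
  qed
  then show ?case using pD by blast
qed

end

section \<open>Spectral rank and spectral trace\<close>

text \<open>Uniqueness of the count rests on \<open>E\<close>: two candidate values hold on a common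
  small disk and ball, and a rank-attaining point of that ball equates them.\<close>

lemma multiplicity_atI:
  fixes a :: "'a::complex_banach_algebra_1"
  assumes E: "\<And>\<epsilon>. \<epsilon> > 0 \<Longrightarrow> rank_attained a \<inter> ball 1 \<epsilon> \<noteq> {}"
    and \<delta>: "\<delta> > 0" and iso: "\<And>r. 0 < r \<Longrightarrow> r < \<delta> \<Longrightarrow> spectrum a \<inter> ball c r = {c}"
    and const: "\<And>r. 0 < r \<Longrightarrow> r < \<delta> \<Longrightarrow>
      \<exists>\<epsilon>>0. \<forall>x \<in> rank_attained a \<inter> ball 1 \<epsilon>. ecard (spectrum (x * a) \<inter> ball c r) = enat m"
  shows "multiplicity_at c a = m"
  unfolding multiplicity_at_def
proof (rule the_equality)
  show "\<forall>\<^sub>F r in at_right 0. spectrum a \<inter> ball c r = {c} \<and>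
     (\<exists>\<epsilon>>0. \<forall>x \<in> rank_attained a \<inter> ball 1 \<epsilon>. ecard (spectrum (x * a) \<inter> ball c r) = enat m)"
    unfolding eventually_at_right_field using \<delta> iso const by blast
next
  fix k assume "\<forall>\<^sub>F r in at_right 0. spectrum a \<inter> ball c r = {c} \<and>
     (\<exists>\<epsilon>>0. \<forall>x \<in> rank_attained a \<inter> ball 1 \<epsilon>. ecard (spectrum (x * a) \<inter> ball c r) = enat k)"
  then obtain b where b: "b > 0" "\<And>r. 0 < r \<Longrightarrow> r < b \<Longrightarrow>
     \<exists>\<epsilon>>0. \<forall>x \<in> rank_attained a \<inter> ball 1 \<epsilon>. ecard (spectrum (x * a) \<inter> ball c r) = enat k"
    unfolding eventually_at_right_field by blast
  define r where "r = min b \<delta> / 2"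
  have r: "0 < r" "r < b" "r < \<delta>" using b(1) \<delta> by (auto simp: r_def)
  obtain \<epsilon>1 where 1: "\<epsilon>1 > 0"
    "\<And>x. x \<in> rank_attained a \<inter> ball 1 \<epsilon>1 \<Longrightarrow> ecard (spectrum (x * a) \<inter> ball c r) = enat k"
    using b(2)[OF r(1,2)] by blast
  obtain \<epsilon>2 where 2: "\<epsilon>2 > 0"
    "\<And>x. x \<in> rank_attained a \<inter> ball 1 \<epsilon>2 \<Longrightarrow> ecard (spectrum (x * a) \<inter> ball c r) = enat m"
    using const[OF r(1,3)] by blast
  obtain x where "x \<in> rank_attained a \<inter> ball 1 (min \<epsilon>1 \<epsilon>2)"
    using E[of "min \<epsilon>1 \<epsilon>2"] 1(1) 2(1) unfolding min_less_iff_conj by blast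
  then have "x \<in> rank_attained a \<inter> ball 1 \<epsilon>1" "x \<in> rank_attained a \<inter> ball 1 \<epsilon>2" by auto
  then show "k = m" using 1(2) 2(2) by fastforce
qed

lemma convergent_subsequence_finite:
  fixes f :: "nat \<Rightarrow> nat \<Rightarrow> complex"
  assumes "\<And>i. i < n \<Longrightarrow> bounded (range (\<lambda>k. f k i))"
  shows "\<exists>s l. strict_mono (s :: nat \<Rightarrow> nat) \<and> (\<forall>i<n. (\<lambda>k. f (s k) i) \<longlonglongrightarrow> l i)"
  using assms
proof (induction n)
  case 0
  show ?case by (intro exI[of _ id]) (simp add: strict_mono_def)
next
  case (Suc n)
  then obtain s l where s: "strict_mono (s :: nat \<Rightarrow> nat)" "\<forall>i<n. (\<lambda>k. f (s k) i) \<longlonglongrightarrow> l i"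
    by (metis less_SucI)
  have "bounded (range (\<lambda>k. f (s k) n))"
    by (rule bounded_subset[OF Suc.prems[of n]]) auto
  then obtain r z where r: "strict_mono (r :: nat \<Rightarrow> nat)" "((\<lambda>k. f (s k) n) \<circ> r) \<longlonglongrightarrow> z"
    using bounded_imp_convergent_subsequence by blast
  have "(\<lambda>k. f ((s \<circ> r) k) i) \<longlonglongrightarrow> (l(n := z)) i" if "i < Suc n" for i
  proof (cases "i = n")
    case True
    then show ?thesis using r(2) by (simp add: comp_def)
  next
    case False
    then have "(\<lambda>k. f (s k) i) \<longlonglongrightarrow> l i" using s(2) that by simp
    from LIMSEQ_subseq_LIMSEQ[OF this r(1)] show ?thesis using False by (simp add: comp_def)
  qed
  moreover have "strict_mono (s \<circ> r)" by (rule strict_mono_o[OF s(1) r(1)])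
  ultimately show ?case by blast
qed

text \<open>A polynomial that vanishes at every value except \<open>c\<close> detects how often
  \<open>c\<close> occurs, and its sum over the values is a combination of power sums.\<close>

lemma power_sums_determine_multiplicities:
  fixes \<mu> \<nu> :: "nat \<Rightarrow> complex"
  assumes sums: "\<And>k. (\<Sum>i<n. \<nu> i ^ Suc k) = (\<Sum>i<n. \<mu> i ^ Suc k)" and c: "c \<noteq> 0"
  shows "card {i\<in>{..<n}. \<nu> i = c} = card {i\<in>{..<n}. \<mu> i = c}"
proof -
  define S where "S = (\<mu> ` {..<n} \<union> \<nu> ` {..<n}) - {c}"
  \<comment> \<open>The factor \<open>[:0, 1:]\<close> removes the constant coefficient, leaving the
    positive exponents covered by \<open>sums\<close>; it does not vanish at
    \<open>c\<close>.\<close>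
  define q where "q = [:0, 1:] * (\<Prod>s\<in>S. [:- s, 1:])"
  have q: "poly q z = z * (\<Prod>s\<in>S. z - s)" for z by (simp add: q_def poly_prod)
  have fin: "finite S" by (simp add: S_def)
  have qc: "poly q c \<noteq> 0" using c fin by (simp add: q S_def)
  have q0: "coeff q 0 = 0" by (simp add: q_def)
  have "(\<Sum>i<n. poly q (\<rho> i)) = (\<Sum>j\<le>degree q. coeff q j * (\<Sum>i<n. \<rho> i ^ j))" for \<rho>
    by (simp add: poly_altdef sum_distrib_left sum.swap[of _ _ "{..<n}"])
  moreover have "coeff q j * (\<Sum>i<n. \<nu> i ^ j) = coeff q j * (\<Sum>i<n. \<mu> i ^ j)" for j
    using q0 sums by (cases j) auto
  ultimately have eq: "(\<Sum>i<n. poly q (\<nu> i)) = (\<Sum>i<n. poly q (\<mu> i))" by (simp only:)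
  have "(\<Sum>i<n. poly q (\<rho> i)) = of_nat (card {i\<in>{..<n}. \<rho> i = c}) * poly q c"
    if "\<rho> = \<mu> \<or> \<rho> = \<nu>" for \<rho>
  proof -
    have "poly q (\<rho> i) = (if \<rho> i = c then poly q c else 0)" if "i < n" for i
    proof (cases "\<rho> i = c")
      case False
      then have "\<rho> i \<in> S" using that \<open>\<rho> = \<mu> \<or> \<rho> = \<nu>\<close> by (auto simp: S_def)
      then have "(\<Prod>s\<in>S. \<rho> i - s) = 0" using fin by (intro prod_zero) auto
      then show ?thesis using False by (simp add: q)
    qed simp
    then have "(\<Sum>i<n. poly q (\<rho> i)) = (\<Sum>i\<in>{..<n}. if \<rho> i = c then poly q c else 0)"
      by (intro sum.cong) auto
    then show ?thesis by (simp add: sum.If_cases Int_def)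
  qed
  then show ?thesis using eq qc by simp
qed

lemma tendsto_power_banach_algebra:
  fixes X :: "'b \<Rightarrow> 'a::complex_banach_algebra_1"
  assumes "(X \<longlongrightarrow> l) G" shows "((\<lambda>k. X k ^ j) \<longlongrightarrow> l ^ j) G"
  by (induction j) (auto intro!: tendsto_mult assms)

section \<open>Rank and multiplicities from range frames\<close>

context minimal_idempotent_algebra
begin

lemma ex_eigenvalues_basic:
  assumes "frame n x y p" "p * b = b"
  obtains \<mu> where "nonzero_spectrum b = \<mu> ` {..<n} - {0}"
    "\<And>k. tau (b ^ Suc k) = (\<Sum>i<n. \<mu> i ^ Suc k)"
proof -
  obtain \<mu> d where *: "\<forall>t. nonzero_spectrum (b + t *\<^sub>C d) = (\<lambda>i. \<mu> i + t * of_nat (Suc i)) ` {..<n} - {0} \<and>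
      (\<forall>k. tau ((b + t *\<^sub>C d) ^ Suc k) = (\<Sum>i<n. (\<mu> i + t * of_nat (Suc i)) ^ Suc k))"
    using ex_eigenvalues[OF assms] by (elim exE conjE)
  show thesis using *[rule_format, of 0] by (intro that[of \<mu>]) simp_all
qed

lemma spectral_rank_le_frame:
  assumes f: "frame n x y p" and a: "p * a = a" shows "spectral_rank a \<le> enat n"
  unfolding spectral_rank_def
proof (rule SUP_least)
  fix z
  have "p * (a * z) = a * z" by (rule mult_absorb[OF a])
  then obtain \<mu> where \<mu>: "nonzero_spectrum (a * z) = \<mu> ` {..<n} - {0}"
    using ex_eigenvalues_basic[OF f] by metis
  have "card (\<mu> ` {..<n} - {0}) \<le> card (\<mu> ` {..<n})" by (intro card_mono) auto
  also have "\<dots> \<le> n" using card_image_le[of "{..<n}" \<mu>] by simp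
  finally show "ecard (nonzero_spectrum (z * a)) \<le> enat n"
    unfolding nonzero_spectrum_commute[of z] \<mu> by (simp add: ecard_def)
qed

text \<open>In a range frame \<open>p\<close> is a right multiple of \<open>a\<close>, so
  \<open>d = a * v\<close> and the additive perturbation \<open>a + t *\<^sub>C d\<close> is the
  product of \<open>a\<close> with \<open>1 + t *\<^sub>C v\<close>. A small generic
  \<open>t\<close> makes all \<open>n\<close> eigenvalues nonzero and distinct.\<close>

lemma range_frame_generic:
  assumes f: "frame n x y p" and a: "p * a = a" and u: "\<And>i. i < n \<Longrightarrow> x i = a * u i" and \<epsilon>: "\<epsilon> > 0"
  shows "\<exists>z\<in>ball 1 \<epsilon>. ecard (nonzero_spectrum (z * a)) = enat n"
proof -
  obtain \<mu> d where d: "p * d = d" and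
    *: "\<forall>t. nonzero_spectrum (a + t *\<^sub>C d) = (\<lambda>i. \<mu> i + t * of_nat (Suc i)) ` {..<n} - {0} \<and>
      (\<forall>k. tau ((a + t *\<^sub>C d) ^ Suc k) = (\<Sum>i<n. (\<mu> i + t * of_nat (Suc i)) ^ Suc k))"
    using ex_eigenvalues[OF f a] by (elim exE conjE)
  define v where "v = (\<Sum>i<n. u i * y i) * d"
  have "a * (\<Sum>i<n. u i * y i) = p"
    unfolding frameD(4)[OF f] sum_distrib_left using u by (intro sum.cong) (simp_all add: mult.assoc)
  then have av: "a * v = d" using d by (simp add: v_def flip: mult.assoc)
  \<comment> \<open>The values of \<open>t\<close> at which a shifted eigenvalue vanishes or two of
    them collide. The pairs \<open>i = j\<close> contribute \<open>0\<close> through division by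
    zero, which a nonzero \<open>t\<close> avoids.\<close>
  define Bad where "Bad = (\<lambda>i. - \<mu> i / of_nat (Suc i)) ` {..<n} \<union>
    (\<lambda>(i, j). (\<mu> i - \<mu> j) / (of_nat j - of_nat i)) ` ({..<n} \<times> {..<n})"
  have "finite Bad" by (simp add: Bad_def)
  then obtain \<delta> where \<delta>: "\<delta> > 0" "\<And>t. t \<in> Bad \<Longrightarrow> t \<noteq> 0 \<Longrightarrow> \<delta> \<le> dist 0 t"
    using finite_set_avoid by metis
  have nv: "norm v + 1 > 0" using norm_ge_zero[of v] by linarith
  define r where "r = \<epsilon> / (norm v + 1)"
  have r: "r > 0" using \<epsilon> nv by (simp add: r_def)
  define s where "s = min \<delta> r / 2"
  have s: "s > 0" "s < \<delta>" "s < r" using \<delta>(1) r by (auto simp: s_def min_def)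
  define t where "t = complex_of_real s"
  have t: "t \<noteq> 0" "t \<notin> Bad" using s \<delta>(2)[of t] by (auto simp: t_def)
  define \<nu> where "\<nu> i = \<mu> i + t * of_nat (Suc i)" for i
  have nz: "\<nu> i \<noteq> 0" if "i < n" for i
  proof
    assume "\<nu> i = 0"
    then have "t * of_nat (Suc i) = - \<mu> i"
      by (simp add: \<nu>_def eq_neg_iff_add_eq_0 add.commute del: of_nat_Suc)
    then have "t = - \<mu> i / of_nat (Suc i)"
      by (simp only: nonzero_eq_divide_eq[OF of_nat_neq_0])
    then show False using t(2) that by (auto simp: Bad_def)
  qed
  have "inj_on \<nu> {..<n}"
  proof (rule inj_onI)
    fix i j assume ij: "i \<in> {..<n}" "j \<in> {..<n}" "\<nu> i = \<nu> j"
    show "i = j"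
    proof (rule ccontr)
      assume "i \<noteq> j"
      then have "of_nat j - of_nat i \<noteq> (0::complex)" by simp
      moreover have "t * (of_nat j - of_nat i) = \<mu> i - \<mu> j" using ij(3) by (simp add: \<nu>_def algebra_simps)
      ultimately have "t = (\<mu> i - \<mu> j) / (of_nat j - of_nat i)" by (simp add: nonzero_eq_divide_eq)
      then have "t \<in> Bad" using ij(1,2) unfolding Bad_def by force
      then show False using t(2) by simp
    qed
  qed
  then have "card (\<nu> ` {..<n}) = n" by (simp add: card_image)
  moreover have "\<nu> ` {..<n} - {0} = \<nu> ` {..<n}" using nz by auto
  moreover have "nonzero_spectrum (a + t *\<^sub>C d) = \<nu> ` {..<n} - {0}"
    using *[rule_format, of t] by (simp add: \<nu>_def)
  moreover have "a * (1 + t *\<^sub>C v) = a + t *\<^sub>C d" by (simp add: distrib_left scaleC_simps av)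
  ultimately have "ecard (nonzero_spectrum (a * (1 + t *\<^sub>C v))) = enat n" by (simp add: ecard_def)
  moreover have "1 + t *\<^sub>C v \<in> ball 1 \<epsilon>"
  proof -
    have "s * norm v \<le> s * (norm v + 1)" using s(1) by (intro mult_left_mono) auto
    also have "\<dots> < \<epsilon>" using s(3) nv by (simp add: r_def less_divide_eq)
    finally show ?thesis using s(1) by (simp add: dist_norm norm_scaleC t_def)
  qed
  ultimately show ?thesis using nonzero_spectrum_commute[of a] by metis
qed

lemma range_frame_rank:
  assumes f: "frame n x y p" and a: "p * a = a" and u: "\<And>i. i < n \<Longrightarrow> x i = a * u i"
  shows "spectral_rank a = enat n" "\<epsilon> > 0 \<Longrightarrow> rank_attained a \<inter> ball 1 \<epsilon> \<noteq> {}"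
proof -
  obtain z where z: "ecard (nonzero_spectrum (z * a)) = enat n"
    using range_frame_generic[OF f a u, of 1] by auto
  have "enat n \<le> spectral_rank a" unfolding spectral_rank_def z[symmetric] by (rule SUP_upper) simp
  then show rank: "spectral_rank a = enat n" using spectral_rank_le_frame[OF f a] by simp
  show "rank_attained a \<inter> ball 1 \<epsilon> \<noteq> {}" if "\<epsilon> > 0"
    using range_frame_generic[OF f a u that] rank by (auto simp: rank_attained_def)
qed

text \<open>The frame of \<open>a\<close> serves for all \<open>a * X k\<close> at once, so
  \<open>tau\<close> is one fixed finite sum of continuous expressions along the filter.\<close>

lemma tendsto_tau_power:
  assumes f: "frame n x y p" and a: "p * a = a" and X: "(X \<longlongrightarrow> 1) G"
  shows "((\<lambda>k. tau ((a * X k) ^ Suc j)) \<longlongrightarrow> tau (a ^ Suc j)) G"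
proof -
  have tau: "tau ((a * z) ^ Suc j) = (\<Sum>i<n. sc (y i * (a * z) ^ Suc j * x i))" for z
    by (rule tau_frame[OF f]) (simp add: mult.assoc mult_absorb[OF a])
  have "((\<lambda>k. \<Sum>i<n. sc (y i * (a * X k) ^ Suc j * x i)) \<longlongrightarrow> (\<Sum>i<n. sc (y i * (a * 1) ^ Suc j * x i))) G"
    by (intro tendsto_sum bounded_linear.tendsto[OF bounded_linear_sc] tendsto_mult
        tendsto_power_banach_algebra tendsto_const X)
  then show ?thesis unfolding tau[symmetric] by simp
qed

text \<open>Upper semicontinuity of the eigenvalue counts: along a sequence \<open>X k \<rightarrow> 1\<close> the eigenvalues
  of \<open>a * X k\<close> subconverge, and the limits have the power sums of the eigenvalues of \<open>a\<close>.\<close>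

lemma multiplicity_at_eq:
  assumes f: "frame n x y p" and a: "p * a = a" and u: "\<And>i. i < n \<Longrightarrow> x i = a * u i"
    and \<mu>: "nonzero_spectrum a = \<mu> ` {..<n} - {0}" "\<And>k. tau (a ^ Suc k) = (\<Sum>i<n. \<mu> i ^ Suc k)"
    and c: "c \<in> nonzero_spectrum a"
  shows "multiplicity_at c a = card {i\<in>{..<n}. \<mu> i = c}"
proof -
  note rank = range_frame_rank[OF f a u]
  have c0: "c \<noteq> 0" using c by (simp add: nonzero_spectrum_def)
  \<comment> \<open>\<open>0\<close> is included so that a disk about \<open>c\<close> contains
    neither another eigenvalue nor \<open>0\<close>; there the spectrum and the nonzero spectrum
    agree.\<close>
  obtain \<delta> where \<delta>: "\<delta> > 0" "\<And>s. s \<in> insert 0 (\<mu> ` {..<n}) \<Longrightarrow> s \<noteq> c \<Longrightarrow> \<delta> \<le> dist c s"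
    using finite_set_avoid[of "insert 0 (\<mu> ` {..<n})" c] by (metis finite_imageI finite_insert finite_lessThan)
  define m where "m = card {i\<in>{..<n}. \<mu> i = c}"
  have "multiplicity_at c a = m"
  proof (rule multiplicity_atI[OF rank(2) \<delta>(1)])
    fix r :: real assume r: "0 < r" "r < \<delta>"
    have "spectrum a \<subseteq> insert 0 (\<mu> ` {..<n})" using \<mu>(1) by (auto simp: nonzero_spectrum_def)
    then show "spectrum a \<inter> ball c r = {c}"
    proof (intro equalityI subsetI)
      fix z assume z: "z \<in> spectrum a \<inter> ball c r"
      then have "z \<in> insert 0 (\<mu> ` {..<n})" using \<open>spectrum a \<subseteq> _\<close> by blast
      then have "z = c \<or> \<delta> \<le> dist c z" using \<delta>(2) by blast
      then show "z \<in> {c}" using z r by auto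
    qed (use c r in \<open>simp add: nonzero_spectrum_def\<close>)
    have zero: "0 \<notin> ball c r" using \<delta>(2)[of 0] c0 r by auto
    show "\<exists>\<epsilon>>0. \<forall>x \<in> rank_attained a \<inter> ball 1 \<epsilon>. ecard (spectrum (x * a) \<inter> ball c r) = enat m"
    proof (rule ccontr)
      assume neg: "\<not> ?thesis"
      have "\<exists>z. z \<in> rank_attained a \<inter> ball 1 (inverse (real (Suc k))) \<and>
          ecard (spectrum (z * a) \<inter> ball c r) \<noteq> enat m" for k
      proof -
        have "inverse (real (Suc k)) > 0" by simp
        with neg show ?thesis by blast
      qed
      then obtain X where X: "\<And>k. X k \<in> rank_attained a" "\<And>k. X k \<in> ball 1 (inverse (real (Suc k)))"
        "\<And>k. ecard (spectrum (X k * a) \<inter> ball c r) \<noteq> enat m" by (metis IntE)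
      have X1: "X \<longlonglongrightarrow> 1"
      proof (rule metric_LIMSEQ_I)
        fix \<epsilon> :: real assume "\<epsilon> > 0"
        then obtain N where N: "inverse (real (Suc N)) < \<epsilon>" using reals_Archimedean by blast
        have "dist (X k) 1 < \<epsilon>" if "k \<ge> N" for k
        proof -
          have "dist (X k) 1 < inverse (real (Suc k))" using X(2)[of k] by (simp add: dist_commute)
          also have "\<dots> \<le> inverse (real (Suc N))" using that by (intro le_imp_inverse_le) auto
          finally show ?thesis using N by simp
        qed
        then show "\<exists>N. \<forall>k\<ge>N. dist (X k) 1 < \<epsilon>" by blast
      qed
      have aX: "p * (a * X k) = a * X k" for k by (rule mult_absorb[OF a])
      have "\<exists>\<nu>. nonzero_spectrum (a * X k) = \<nu> ` {..<n} - {0} \<and>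
          (\<forall>j. tau ((a * X k) ^ Suc j) = (\<Sum>i<n. \<nu> i ^ Suc j))" for k
        using ex_eigenvalues_basic[OF f aX[of k]] by metis
      then obtain \<nu> where \<nu>: "\<And>k. nonzero_spectrum (a * X k) = \<nu> k ` {..<n} - {0}"
        "\<And>k j. tau ((a * X k) ^ Suc j) = (\<Sum>i<n. \<nu> k i ^ Suc j)" by metis
      \<comment> \<open>Attaining the rank means having \<open>n\<close> distinct nonzero
        eigenvalues. So \<open>\<nu> k\<close> is injective, and points in the disk can be counted
        by indices.\<close>
      have card: "card (\<nu> k ` {..<n} - {0}) = n" for k
        using X(1)[of k] \<nu>(1)[of k] rank(1) nonzero_spectrum_commute[of a "X k"]
        by (simp add: rank_attained_def ecard_def)
      have inj: "inj_on (\<nu> k) {..<n}" for k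
      proof (rule eq_card_imp_inj_on)
        have "card (\<nu> k ` {..<n} - {0}) \<le> card (\<nu> k ` {..<n})" by (intro card_mono) auto
        then show "card (\<nu> k ` {..<n}) = card {..<n}"
          using card[of k] card_image_le[of "{..<n}" "\<nu> k"] by simp
      qed simp
      have count: "ecard (spectrum (X k * a) \<inter> ball c r) = enat (card {i\<in>{..<n}. \<nu> k i \<in> ball c r})" for k
      proof -
        have "spectrum (X k * a) \<inter> ball c r = nonzero_spectrum (a * X k) \<inter> ball c r"
          unfolding nonzero_spectrum_commute[of a] using zero by (auto simp: nonzero_spectrum_def)
        also have "\<dots> = \<nu> k ` {i\<in>{..<n}. \<nu> k i \<in> ball c r}" using zero by (auto simp: \<nu>(1))
        finally have "spectrum (X k * a) \<inter> ball c r = \<nu> k ` {i\<in>{..<n}. \<nu> k i \<in> ball c r}" .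
        moreover have "inj_on (\<nu> k) {i\<in>{..<n}. \<nu> k i \<in> ball c r}"
          by (rule inj_on_subset[OF inj]) blast
        ultimately show ?thesis by (simp only: ecard_def card_image) simp
      qed
      have bounded: "bounded (range (\<lambda>k. \<nu> k i))" if "i < n" for i
      proof (rule boundedI)
        fix z assume "z \<in> range (\<lambda>k. \<nu> k i)"
        then obtain k where k: "z = \<nu> k i" by blast
        have *: "norm a * (norm (1::'a) + 1) \<ge> 0" by simp
        show "cmod z \<le> norm a * (norm (1::'a) + 1)"
        proof (cases "z = 0")
          case False
          then have "z \<in> nonzero_spectrum (a * X k)" using k that by (auto simp: \<nu>(1))
          then have "cmod z \<le> norm (a * X k)" by (rule nonzero_spectrum_bound[OF f aX])
          also have "\<dots> \<le> norm a * norm (X k)" by (rule norm_mult_ineq)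
          also have "norm (X k) \<le> norm (1::'a) + 1"
          proof -
            have "norm (X k - 1) < inverse (real (Suc k))" using X(2)[of k] by (simp add: dist_norm norm_minus_commute)
            also have "\<dots> \<le> 1" by (simp add: inverse_le_1_iff)
            finally show ?thesis using norm_triangle_ineq[of "X k - 1" 1] by simp
          qed
          finally show ?thesis by (simp add: mult_left_mono)
        qed (use * in simp)
      qed
      obtain s l where s: "strict_mono (s :: nat \<Rightarrow> nat)" and l: "\<forall>i<n. (\<lambda>k. \<nu> (s k) i) \<longlonglongrightarrow> l i"
        using convergent_subsequence_finite[of n \<nu>] bounded by blast
      have "(\<Sum>i<n. l i ^ Suc j) = (\<Sum>i<n. \<mu> i ^ Suc j)" for j
      proof (rule LIMSEQ_unique)
        show "(\<lambda>k. \<Sum>i<n. \<nu> (s k) i ^ Suc j) \<longlonglongrightarrow> (\<Sum>i<n. l i ^ Suc j)"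
          using l by (intro tendsto_sum tendsto_power) auto
        have "(\<lambda>k. X (s k)) \<longlonglongrightarrow> 1" using LIMSEQ_subseq_LIMSEQ[OF X1 s] by (simp add: comp_def)
        from tendsto_tau_power[OF f a this, of j]
        show "(\<lambda>k. \<Sum>i<n. \<nu> (s k) i ^ Suc j) \<longlonglongrightarrow> (\<Sum>i<n. \<mu> i ^ Suc j)"
          unfolding \<nu>(2) \<mu>(2) .
      qed
      note mult = power_sums_determine_multiplicities[OF this]
      have "\<forall>\<^sub>F k in sequentially. \<nu> (s k) i \<in> ball c r \<longleftrightarrow> l i = c" if i: "i < n" for i
      proof (cases "l i = c")
        case True
        then have "(\<lambda>k. \<nu> (s k) i) \<longlonglongrightarrow> c" using l i by auto
        then have "\<forall>\<^sub>F k in sequentially. \<nu> (s k) i \<in> ball c r"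
          using r by (intro topological_tendstoD) auto
        then show ?thesis using True by simp
      next
        case False
        \<comment> \<open>By the power sums a nonzero limit occurs among the \<open>\<mu> i\<close>.
          Being different from \<open>c\<close>, it is at least \<open>\<delta>\<close> away, so the
          approximating eigenvalues finally stay outside the disk.\<close>
        have "l i \<in> insert 0 (\<mu> ` {..<n})"
        proof (cases "l i = 0")
          case False
          then have "card {j\<in>{..<n}. \<mu> j = l i} = card {j\<in>{..<n}. l j = l i}" using mult by simp
          moreover have "card {j\<in>{..<n}. l j = l i} \<noteq> 0" using i by auto
          ultimately have "{j\<in>{..<n}. \<mu> j = l i} \<noteq> {}" by (metis card.empty)
          then obtain j where "j < n" "\<mu> j = l i" by auto
          then show ?thesis by (metis imageI insertI2 lessThan_iff)
        qed simp
        then have "\<delta> \<le> dist c (l i)" using \<delta>(2) False by blast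
        then have "l i \<in> - cball c r" using r by simp
        moreover have "open (- cball c r)" by (simp add: open_Compl)
        ultimately have "\<forall>\<^sub>F k in sequentially. \<nu> (s k) i \<in> - cball c r"
          using l i by (intro topological_tendstoD) auto
        then show ?thesis by eventually_elim (use False in auto)
      qed
      then have "\<forall>\<^sub>F k in sequentially. \<forall>i\<in>{..<n}. \<nu> (s k) i \<in> ball c r \<longleftrightarrow> l i = c"
        by (intro eventually_ball_finite) auto
      then obtain k where "\<forall>i\<in>{..<n}. \<nu> (s k) i \<in> ball c r \<longleftrightarrow> l i = c"
        unfolding eventually_sequentially by blast
      then have "{i\<in>{..<n}. \<nu> (s k) i \<in> ball c r} = {i\<in>{..<n}. l i = c}" by blast
      then have "ecard (spectrum (X (s k) * a) \<inter> ball c r) = enat m"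
        using count[of "s k"] mult[OF c0] by (simp add: m_def)
      then show False using X(3) by blast
    qed
  qed
  then show ?thesis by (simp add: m_def)
qed

lemma Tr_eq_tau:
  assumes "a \<in> F" shows "Tr a = tau a"
proof -
  obtain n x y p u where f: "frame n x y p" and a: "p * a = a"
    and u: "\<And>i. i < n \<Longrightarrow> x i = a * u i"
    using ex_range_frame[OF assms] by metis
  obtain \<mu> where \<mu>: "nonzero_spectrum a = \<mu> ` {..<n} - {0}"
    "\<And>k. tau (a ^ Suc k) = (\<Sum>i<n. \<mu> i ^ Suc k)"
    using ex_eigenvalues_basic[OF f a] by metis
  have "spectrum a \<subseteq> insert 0 (\<mu> ` {..<n})" using \<mu>(1) by (auto simp: nonzero_spectrum_def)
  then have fin: "finite (spectrum a)" using finite_subset by blast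
  have "Tr a = (\<Sum>c\<in>nonzero_spectrum a. c * of_nat (multiplicity_at c a))"
    unfolding Tr_def nonzero_spectrum_def using fin by (intro sum.mono_neutral_right) auto
  also have "\<dots> = (\<Sum>c\<in>nonzero_spectrum a. \<Sum>i\<in>{i\<in>{..<n}. \<mu> i = c}. \<mu> i)"
    by (intro sum.cong) (simp_all add: multiplicity_at_eq[OF f a u \<mu>] mult.commute)
  also have "\<dots> = (\<Sum>c\<in>\<mu> ` {..<n}. \<Sum>i\<in>{i\<in>{..<n}. \<mu> i = c}. \<mu> i)"
    unfolding \<mu>(1) by (intro sum.mono_neutral_left) auto
  also have "\<dots> = (\<Sum>i<n. \<mu> i)" by (rule sum.image_gen[symmetric]) simp
  also have "\<dots> = tau a" using \<mu>(2)[of 0] by simp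
  finally show ?thesis .
qed

end

section \<open>Commutators\<close>

context minimal_idempotent_algebra
begin

text \<open>If every vector of the range is an eigenvector, \<open>b\<close> is scalar there and
  trace zero makes the scalar \<open>0\<close>. Otherwise take a non-eigenvector \<open>v\<close>
  and a covector \<open>w\<close> with \<open>w * v = e\<close> and \<open>w * b * v = 0\<close>:
  one diagonal entry is \<open>0\<close>, and the compression to the rest still has trace zero.
  Keeping \<open>p\<close> fixed preserves the later rank bounds.\<close>

lemma ex_zero_diagonal_frame:
  assumes "frame n x y p" "p * b = b" "tau b = 0"
  shows "\<exists>x' y'. frame n x' y' p \<and> (\<forall>i<n. y' i * b * x' i = 0)"
  using assms
proof (induction n arbitrary: x y p b)
  case 0
  then show ?case by auto
next
  case (Suc n)
  note f = Suc.prems(1) and b = Suc.prems(2)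
  note pp = frame_idempotent[OF f] and pF = frame_in_F[OF f]
  have bF: "b \<in> F" using F_mult_right[OF pF, of b] b by simp
  show ?case
  proof (cases "\<forall>v. v * e = v \<longrightarrow> p * v = v \<longrightarrow> (\<exists>c. b * v = c *\<^sub>C v)")
    case True
    have "\<forall>i. \<exists>c. i < Suc n \<longrightarrow> b * x i = c *\<^sub>C x i"
      using True frameD(1)[OF f] frame_proj_vector[OF f] by blast
    then obtain c where "\<forall>i. i < Suc n \<longrightarrow> b * x i = c i *\<^sub>C x i" by (elim choice[THEN exE])
    then have c: "b * x i = c i *\<^sub>C x i" if "i < Suc n" for i using that by blast
    \<comment> \<open>Comparing coefficients for the eigenvector \<open>x i + x 0\<close> shows that
      the eigenvalues coincide.\<close>
    have c0: "c i = c 0" if i: "i < Suc n" for i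
    proof (cases "i = 0")
      case False
      have "(x i + x 0) * e = x i + x 0" "p * (x i + x 0) = x i + x 0"
        using frameD(1)[OF f] frame_proj_vector[OF f] i by (simp_all add: distrib_left distrib_right)
      then obtain k where k: "b * (x i + x 0) = k *\<^sub>C (x i + x 0)" using True by blast
      have 1: "c i *\<^sub>C x i + c 0 *\<^sub>C x 0 = k *\<^sub>C x i + k *\<^sub>C x 0"
        using k c[OF i] c[of 0] by (simp add: distrib_left scaleC_simps)
      have "y i * (c i *\<^sub>C x i + c 0 *\<^sub>C x 0) = c i *\<^sub>C e" "y i * (k *\<^sub>C x i + k *\<^sub>C x 0) = k *\<^sub>C e"
        "y 0 * (c i *\<^sub>C x i + c 0 *\<^sub>C x 0) = c 0 *\<^sub>C e" "y 0 * (k *\<^sub>C x i + k *\<^sub>C x 0) = k *\<^sub>C e"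
        using frameD(3)[OF f] i False by (simp_all add: distrib_left scaleC_simps)
      then have "k = c i" "k = c 0" unfolding 1 using e_nonzero by simp_all
      then show ?thesis by simp
    qed simp
    have yb: "y i * b * x i = c 0 *\<^sub>C e" if "i < Suc n" for i
      using c[OF that] frameD(3)[OF f that that] c0[OF that] by (simp add: mult.assoc scaleC_simps)
    have "tau b = (\<Sum>i<Suc n. sc (y i * b * x i))" by (rule tau_frame[OF f b])
    also have "\<dots> = (\<Sum>i<Suc n. c 0)" using yb by (intro sum.cong) (simp_all add: sc_scaleC)
    also have "\<dots> = of_nat (Suc n) * c 0" by (simp only: sum_constant card_lessThan)
    finally have "c 0 = 0" using Suc.prems(3) of_nat_neq_0[of n, where 'a=complex] by (metis mult_eq_0_iff)
    then show ?thesis using f yb by (metis scaleC_zero_left)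
  next
    case False
    then obtain v where v: "v * e = v" "p * v = v" "\<And>c. b * v \<noteq> c *\<^sub>C v" by blast
    have "v \<noteq> 0" using v(3)[of 0] by auto
    moreover have "b * v * e = b * v" using v(1) by (simp add: mult.assoc)
    ultimately obtain w0 where w0: "e * w0 = w0" "w0 * v = e" "w0 * (b * v) = 0"
      using ex_separating_covector[OF v(1) _ _ v(3)] by blast
    \<comment> \<open>Cutting \<open>w0\<close> down by \<open>p\<close> keeps its values at
      \<open>v\<close> and \<open>b * v\<close>, since \<open>p\<close> fixes both.\<close>
    define w where "w = w0 * p"
    have w: "e * w = w" "w * p = w" "w * v = e" "w * (b * v) = 0"
      using w0 v(2) pp mult_absorb[OF b] mult_absorb[OF w0(1)] by (simp_all add: w_def mult.assoc)
    obtain x1 y1 where f1: "frame n x1 y1 (p - v * w)"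
      using frame_split[OF f v(1,2) w(1,2,3)] by blast
    have p1: "(p - v * w) * v = 0" using v(1,2) w(3) by (simp add: left_diff_distrib mult.assoc)
    have p2: "w * (p - v * w) = 0"
      using w(1,2) mult_absorb[OF w(3)] by (simp add: right_diff_distrib)
    have "tau (v * (w * b)) = sc (w * b * v)"
      by (rule tau_rank_one[OF v(1)]) (simp add: mult_absorb[OF w(1)])
    also have "\<dots> = 0" using w(4) by (simp add: mult.assoc)
    finally have "tau ((p - v * w) * b) = 0"
      using tau_diff[OF bF F_mult_left[OF bF, of "v * w"]] Suc.prems(3) b
      by (simp add: left_diff_distrib mult.assoc)
    moreover have "(p - v * w) * ((p - v * w) * b) = (p - v * w) * b"
      by (rule mult_absorb[OF frame_idempotent[OF f1]])
    ultimately obtain x' y' where f': "frame n x' y' (p - v * w)"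
      and diag: "\<forall>i<n. y' i * ((p - v * w) * b) * x' i = 0"
      using Suc.IH[OF f1] by blast
    have "y' i * b * x' i = 0" if "i < n" for i
      using diag[rule_format, OF that] mult_absorb[OF covector_frame_proj[OF f' that]]
      by (simp add: mult.assoc)
    moreover have "frame (Suc n) (x'(n := v)) (y'(n := w)) p"
      using frame_append[OF f' v(1) p1 w(1) p2 w(3)] by simp
    moreover have "w * b * v = 0" using w(4) by (simp add: mult.assoc)
    ultimately have "frame (Suc n) (x'(n := v)) (y'(n := w)) p \<and>
        (\<forall>i<Suc n. (y'(n := w)) i * b * (x'(n := v)) i = 0)"
      by (auto simp: less_Suc_eq)
    then show ?thesis by blast
  qed
qed

text \<open>In a frame with vanishing diagonal entries \<open>a\<close> is a commutator with the diagonal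
  operator \<open>D\<close> with distinct nonzero entries \<open>1, \<dots>, n\<close>.\<close>

lemma trace_zero_commutator:
  assumes aF: "a \<in> F" and tau: "tau a = 0"
  obtains D Y where "D \<in> F" "Y \<in> F" "a = commutator D Y"
    "spectral_rank D \<le> spectral_rank a" "spectral_rank Y \<le> spectral_rank a"
proof -
  obtain n x0 y0 p u where f0: "frame n x0 y0 p" and a: "p * a = a"
    and u: "\<And>i. i < n \<Longrightarrow> x0 i = a * u i"
    using ex_range_frame[OF aF] by metis
  have rank: "spectral_rank a = enat n" by (rule range_frame_rank(1)[OF f0 a u])
  obtain x y where f: "frame n x y p" and diag: "\<And>i. i < n \<Longrightarrow> y i * a * x i = 0"
    using ex_zero_diagonal_frame[OF f0 a tau] by blast
  note pp = frame_idempotent[OF f]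
  define E where "E i = x i * y i" for i
  define w where "w i = complex_of_nat (Suc i)" for i
  have w: "w i \<noteq> 0" "w i = w j \<longleftrightarrow> i = j" for i j
    unfolding w_def of_nat_eq_iff by (simp_all del: of_nat_Suc)
  have p: "p = (\<Sum>i<n. E i)" using frameD(4)[OF f] by (simp add: E_def)
  have EF: "E i \<in> F" if "i < n" for i
    unfolding E_def by (rule F_rank_one[OF frameD(1,2)[OF f that]])
  have pE: "p * E i = E i" "E i * p = E i" if "i < n" for i
    using mult_absorb[OF frame_proj_vector[OF f that]] covector_frame_proj[OF f that]
    by (simp_all add: E_def mult.assoc)
  have EE: "E i * E j = (if i = j then E i else 0)" if "i < n" "j < n" for i j
    using frameD(3)[OF f that] frameD(2)[OF f that(2)] mult_absorb[OF frameD(3)[OF f that]]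
    by (simp add: E_def mult.assoc)
  have EaE: "E i * a * E i = 0" if "i < n" for i
  proof -
    have "E i * a * E i = x i * (y i * a * x i) * y i" by (simp add: E_def mult.assoc)
    then show ?thesis using diag[OF that] by simp
  qed
  define D where "D = (\<Sum>i<n. w i *\<^sub>C E i)"
  have DE: "D * E j = w j *\<^sub>C E j" if "j < n" for j
  proof -
    have "D * E j = (\<Sum>i<n. if i = j then w j *\<^sub>C E j else 0)"
      unfolding D_def sum_distrib_right using that by (intro sum.cong) (auto simp: EE scaleC_simps)
    then show ?thesis using that by simp
  qed
  have ED: "E j * D = w j *\<^sub>C E j" if "j < n" for j
  proof -
    have "E j * D = (\<Sum>i<n. if i = j then w j *\<^sub>C E j else 0)"
      unfolding D_def sum_distrib_left using that by (intro sum.cong) (auto simp: EE scaleC_simps)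
    then show ?thesis using that by simp
  qed
  have pD: "p * D = D"
    unfolding D_def sum_distrib_left using pE by (intro sum.cong) (auto simp: scaleC_simps)
  \<comment> \<open>The diagonal coefficients may be \<open>0\<close> because the blocks
    \<open>E i * a * E i\<close> vanish.\<close>
  define k where "k i j = (if i = j then 0 else inverse (w i - w j))" for i j
  define Y1 where "Y1 = (\<Sum>i<n. \<Sum>j<n. k i j *\<^sub>C (E i * a * E j))"
  \<comment> \<open>\<open>D\<close> annihilates these blocks from the right, so the weight
    difference is \<open>w i - 0\<close>; this is where the weights have to be nonzero.\<close>
  define Y2 where "Y2 = (\<Sum>i<n. inverse (w i) *\<^sub>C (E i * a * (1 - p)))"
  define Y where "Y = Y1 + Y2"
  have DY1: "D * Y1 = (\<Sum>i<n. \<Sum>j<n. (k i j * w i) *\<^sub>C (E i * a * E j))"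
    unfolding Y1_def sum_distrib_left
    by (intro sum.cong refl) (simp add: scaleC_simps mult_absorb[OF DE] mult.assoc)
  have Y1D: "Y1 * D = (\<Sum>i<n. \<Sum>j<n. (k i j * w j) *\<^sub>C (E i * a * E j))"
    unfolding Y1_def sum_distrib_right
    by (intro sum.cong refl) (simp add: scaleC_simps ED mult.assoc)
  have DY2: "D * Y2 = (\<Sum>i<n. E i * a * (1 - p))"
    unfolding Y2_def sum_distrib_left
    by (intro sum.cong refl) (simp add: scaleC_simps mult_absorb[OF DE] w mult.assoc)
  have "(1 - p) * D = 0" using pD by (simp add: left_diff_distrib)
  then have Y2D: "Y2 * D = 0"
    unfolding Y2_def sum_distrib_right by (intro sum.neutral) (simp add: scaleC_simps mult.assoc)
  have "D * Y1 - Y1 * D = (\<Sum>i<n. \<Sum>j<n. E i * a * E j)"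
    unfolding DY1 Y1D sum_subtractf[symmetric]
  proof (intro sum.cong refl)
    fix i j assume "i \<in> {..<n}" "j \<in> {..<n}"
    show "(k i j * w i) *\<^sub>C (E i * a * E j) - (k i j * w j) *\<^sub>C (E i * a * E j) = E i * a * E j"
    proof (cases "i = j")
      case False
      then have "k i j * (w i - w j) = 1" using w(2) by (simp add: k_def)
      then show ?thesis by (simp add: scaleC_one right_diff_distrib flip: scaleC_diff_left)
    qed (use EaE \<open>i \<in> {..<n}\<close> in simp)
  qed
  also have "\<dots> = p * a * p" unfolding p by (simp only: sum_distrib_right[where r = a] sum_product)
  finally have "commutator D Y = p * a * p + (\<Sum>i<n. E i * a * (1 - p))"
    by (simp add: commutator_def Y_def distrib_left distrib_right DY2 Y2D)
  also have "(\<Sum>i<n. E i * a * (1 - p)) = p * a * (1 - p)"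
    unfolding sum_distrib_right[symmetric] p[symmetric] ..
  also have "p * a * p + p * a * (1 - p) = a" using a by (simp add: algebra_simps)
  finally have "a = commutator D Y" ..
  moreover have DF: "D \<in> F" unfolding D_def by (intro F_sum F_scaleC EF) simp
  moreover have "Y \<in> F" unfolding Y_def Y1_def Y2_def
    by (intro F_add F_sum F_scaleC F_mult_right EF) simp_all
  moreover have "spectral_rank D \<le> spectral_rank a"
    unfolding rank by (rule spectral_rank_le_frame[OF f pD])
  moreover have "p * Y = Y" unfolding Y_def Y1_def Y2_def distrib_left sum_distrib_left
    by (intro arg_cong2[of _ _ _ _ plus] sum.cong refl) (simp_all add: scaleC_simps mult_absorb[OF pE(1)] mult.assoc)
  then have "spectral_rank Y \<le> spectral_rank a"
    unfolding rank by (rule spectral_rank_le_frame[OF f])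
  ultimately show thesis using that by blast
qed

section \<open>Splitting the socle into \<open>F\<close> and its annihilator\<close>

lemma F_subset_two_sided_ideal:
  assumes "two_sided_ideal J" "e \<in> J" shows "F \<subseteq> J"
proof
  have lJ: "left_ideal J" using assms(1) by (simp add: two_sided_ideal_def)
  fix b assume "b \<in> F"
  then show "b \<in> J"
  proof induction
    case (add b x y)
    have "x * e * y \<in> J" using assms lJ by (simp add: two_sided_ideal_def left_idealD(3))
    then show ?case using add left_idealD(2)[OF lJ] by (simp add: mult.assoc)
  qed (rule left_idealD(1)[OF lJ])
qed

lemma F_annihilates_right: "b \<in> F \<Longrightarrow> (\<And>z. e * z * s = 0) \<Longrightarrow> b * s = 0"
proof (induction rule: F.induct)
  case (add b x y)
  have "y * s = 0" using add.prems[of y] add.hyps(3) by simp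
  then show ?case using add by (simp add: distrib_right mult.assoc)
qed simp

lemma F_annihilates_left: "b \<in> F \<Longrightarrow> (\<And>z. s * z * e = 0) \<Longrightarrow> s * b = 0"
proof (induction rule: F.induct)
  case (add b x y)
  have "s * x = 0" using add.prems[of x] add.hyps(2) by (simp add: mult.assoc)
  then show ?case using add by (simp add: distrib_left mult_absorb)
qed simp

text \<open>The element \<open>(s z e) t (s z e)\<close> contains the vanishing factor
  \<open>e t s\<close>, so semiprimeness applies to \<open>s z e\<close>.\<close>

lemma annihilator_symmetric:
  assumes "\<And>z. e * z * s = 0" shows "s * z * e = 0"
proof (rule semiprime)
  fix t
  have "s * z * e * t * (s * z * e) = s * z * (e * t * s) * z * e" by (simp add: mult.assoc)
  then show "s * z * e * t * (s * z * e) = 0" by (simp add: assms)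
qed

text \<open>A minimal left ideal that meets \<open>F\<close> outside \<open>0\<close> lies in
  \<open>F\<close>. A summand \<open>x\<close> with some \<open>e * z * x \<noteq> 0\<close>
  therefore joins \<open>b\<close>, and all others join \<open>r\<close>.\<close>

lemma Soc_decomposition:
  assumes "s \<in> Soc"
  shows "\<exists>b r. b \<in> F \<and> s = b + r \<and> (\<forall>z. e * z * r = 0)"
  using assms
proof (induction rule: Soc_induct)
  case zero
  show ?case using F.zero by (intro exI[of _ 0]) simp
next
  case (add s L x)
  then obtain b r where br: "b \<in> F" "s = b + r" "\<forall>z. e * z * r = 0" by blast
  show ?case
  proof (cases "\<forall>z. e * z * x = 0")
    case True
    then have "\<forall>z. e * z * (r + x) = 0" using br by (simp add: distrib_left)
    then show ?thesis using br by (intro exI[of _ b] exI[of _ "r + x"]) (simp add: add.assoc)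
  next
    case False
    then obtain z where z: "e * z * x \<noteq> 0" by blast
    have lF: "left_ideal F" using two_sided_ideal_F by (simp add: two_sided_ideal_def)
    note lL = minimal_left_idealD(1)[OF add.hyps(2)]
    have "F \<inter> L = L"
    proof (rule minimal_left_idealD(3)[OF add.hyps(2) left_ideal_Int[OF lF lL] _ _ z])
      show "e * z * x \<in> F \<inter> L"
        using left_idealD(3)[OF lL add.hyps(3)] F_mult_right[OF F_mult_right[OF e_in_F]] by simp
    qed simp
    then have "x \<in> F" using add.hyps(3) by blast
    then show ?thesis using br by (intro exI[of _ "b + x"] exI[of _ r]) (simp add: F_add ac_simps)
  qed
qed

text \<open>Mixed products of the two components vanish, so
  \<open>e - [x1, y1] = f + [x2, y2]\<close> lies both in \<open>F\<close> and in its annihilator.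
  By semiprimeness it is \<open>0\<close>, and then \<open>e\<close> would be a commutator within
  \<open>F\<close>, contrary to \<open>tau e = 1\<close>.\<close>

lemma difference_not_commutator:
  assumes f: "\<And>z. e * z * f = 0" and xy: "x \<in> Soc" "y \<in> Soc"
  shows "e - f \<noteq> commutator x y"
proof
  assume c: "e - f = commutator x y"
  obtain x1 x2 where x: "x1 \<in> F" "x = x1 + x2" "\<And>z. e * z * x2 = 0"
    using Soc_decomposition[OF xy(1)] by blast
  obtain y1 y2 where y: "y1 \<in> F" "y = y1 + y2" "\<And>z. e * z * y2 = 0"
    using Soc_decomposition[OF xy(2)] by blast
  have cross: "x1 * y2 = 0" "y2 * x1 = 0" "x2 * y1 = 0" "y1 * x2 = 0"
    using F_annihilates_right[OF x(1) y(3)] F_annihilates_left[OF x(1) annihilator_symmetric[OF y(3)]]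
      F_annihilates_right[OF y(1) x(3)] F_annihilates_left[OF y(1) annihilator_symmetric[OF x(3)]]
    by auto
  define h where "h = e - commutator x1 y1"
  have cF: "x1 * y1 \<in> F" "y1 * x1 \<in> F" using x y F_mult_left by blast+
  have hF: "h \<in> F" unfolding h_def commutator_def by (intro F_diff e_in_F cF)
  have h: "h = f + commutator x2 y2"
    using c cross unfolding h_def commutator_def x(2) y(2) by (simp add: algebra_simps)
  have "e * z * h = 0" for z
  proof -
    have "e * z * h = e * z * f + (e * z * x2 * y2 - e * z * y2 * x2)"
      by (simp add: h commutator_def algebra_simps)
    then show ?thesis by (simp add: f x(3) y(3))
  qed
  then have "h * z * h = 0" for z using F_annihilates_right[OF F_mult_right[OF hF]] by blast
  then have "h = 0" by (rule semiprime)
  then have "e = x1 * y1 - y1 * x1" by (simp add: h_def commutator_def)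
  then have "tau e = tau (x1 * y1) - tau (y1 * x1)" using tau_diff[OF cF] by simp
  then have "tau e = 0" using tau_commute[OF x(1)] by simp
  then show False using tau_frame_proj[OF frame_e] by simp
qed

end

section \<open>Minimality of the socle and bounded operators\<close>

context semiprime
begin

lemma ex_minimal_idempotent_in_Soc:
  assumes "(Soc :: 'a set) \<noteq> {0}"
  obtains e :: 'a where "minimal_idempotent e" "e \<in> Soc"
proof -
  have "\<exists>L :: 'a set. minimal_left_ideal L"
  proof (rule ccontr)
    assume none: "\<nexists>L :: 'a set. minimal_left_ideal L"
    have "s = 0" if "s \<in> Soc" for s :: 'a
      using that by (induction rule: Soc_induct) (use none in auto)
    then have "(Soc :: 'a set) = {0}" using Soc_zero by blast
    then show False using assms by blast
  qed
  then obtain L :: "'a set" where L: "minimal_left_ideal L" by blast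
  obtain e where "e \<in> L" "minimal_idempotent e" by (rule minimal_left_ideal_idempotent[OF L])
  then show thesis using that minimal_left_ideal_subset_Soc[OF L] by blast
qed

lemma minimal_Soc_commutator:
  fixes a :: 'a
  assumes min: "minimal_two_sided_ideal (Soc :: 'a set)" and a: "a \<in> Soc" "Tr a = 0"
  shows "\<exists>x\<in>Soc. \<exists>y\<in>Soc. a = commutator x y \<and>
    spectral_rank x \<le> spectral_rank a \<and> spectral_rank y \<le> spectral_rank a"
proof (cases "(Soc :: 'a set) = {0}")
  \<comment> \<open>A zero socle has no minimal idempotent to work with, but then
    \<open>a = 0\<close>.\<close>
  case True
  then have "a = 0" using a(1) by blast
  then have "a = commutator a a" by (simp add: commutator_def)
  then show ?thesis using a(1) by blast
next
  case False
  then obtain e :: 'a where e: "minimal_idempotent e" "e \<in> Soc"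
    by (rule ex_minimal_idempotent_in_Soc)
  interpret minimal_idempotent_algebra A e by unfold_locales (rule e(1))
  have "F \<subseteq> Soc" by (rule F_subset_two_sided_ideal[OF two_sided_ideal_Soc e(2)])
  moreover have "F \<noteq> {0}" using e_in_F e_nonzero by blast
  ultimately have F: "F = Soc"
    using min two_sided_ideal_F by (auto simp: minimal_two_sided_ideal_def)
  have "tau a = 0" using Tr_eq_tau[of a] a F by simp
  then obtain x y where "x \<in> F" "y \<in> F" "a = commutator x y"
    "spectral_rank x \<le> spectral_rank a" "spectral_rank y \<le> spectral_rank a"
    using trace_zero_commutator[of a] a(1) F by metis
  then show ?thesis unfolding F by blast
qed

lemma nonzero_spectrum_orthogonal_combination:
  fixes e f :: 'a
  assumes e: "e * e = e" "e \<noteq> 0" and f: "f * f = f" "f \<noteq> 0" and ef: "e * f = 0" "f * e = 0"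
  shows "nonzero_spectrum (\<alpha> *\<^sub>C e - \<beta> *\<^sub>C f) = {\<alpha>, - \<beta>} - {0}"
proof -
  define b where "b = \<alpha> *\<^sub>C e - \<beta> *\<^sub>C f"
  have "b * e = \<alpha> *\<^sub>C e" "b * f = (- \<beta>) *\<^sub>C f"
    using e f ef by (simp_all add: b_def left_diff_distrib scaleC_simps)
  then have "\<alpha> \<in> spectrum b" "- \<beta> \<in> spectrum b"
    using eigenvector_in_spectrum e(2) f(2) by blast+
  moreover have "unit_elt (c *\<^sub>C 1 - b)" if c: "c \<noteq> 0" "c \<noteq> \<alpha>" "c \<noteq> - \<beta>" for c
  proof -
    have c': "c - \<alpha> \<noteq> 0" "c + \<beta> \<noteq> 0" using c by (auto simp: add_eq_0_iff2)
    \<comment> \<open>The inverse is written on the orthogonal idempotents \<open>1 - e - f\<close>,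
      \<open>e\<close> and \<open>f\<close>, where \<open>b\<close> acts as \<open>0\<close>,
      \<open>\<alpha>\<close> and \<open>- \<beta>\<close>.\<close>
    define W where "W = inverse c *\<^sub>C (1 - e - f) + inverse (c - \<alpha>) *\<^sub>C e + inverse (c + \<beta>) *\<^sub>C f"
    have d: "c *\<^sub>C 1 - b = c *\<^sub>C (1 - e - f) + (c - \<alpha>) *\<^sub>C e + (c + \<beta>) *\<^sub>C f"
      by (simp add: b_def scaleC_simps)
    have o: "(1 - e - f) * e = 0" "(1 - e - f) * f = 0" "e * (1 - e - f) = 0" "f * (1 - e - f) = 0"
      "(1 - e - f) * (1 - e - f) = 1 - e - f"
      using e f ef by (simp_all add: algebra_simps)
    have "(c *\<^sub>C 1 - b) * W = (1 - e - f) + e + f" "W * (c *\<^sub>C 1 - b) = (1 - e - f) + e + f"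
      unfolding d W_def distrib_left distrib_right mult_scaleC_left mult_scaleC_right o e(1) f(1) ef
      using c(1) c' by (simp_all add: scaleC_scaleC scaleC_one scaleC_zero_right)
    then show ?thesis unfolding unit_elt_def by auto
  qed
  then have "nonzero_spectrum b \<subseteq> {\<alpha>, - \<beta>} - {0}" unfolding nonzero_spectrum_iff subset_iff by blast
  ultimately show ?thesis unfolding b_def[symmetric] nonzero_spectrum_def by blast
qed

text \<open>The nonzero spectrum of \<open>z * (e - f)\<close> is explicit:
  \<open>\<alpha> z\<close> and \<open>- \<beta> z\<close>, with continuous functionals that are
  \<open>1\<close> at \<open>1\<close>. Hence \<open>1\<close> and \<open>-1\<close> each have
  multiplicity one.\<close>

lemma Tr_difference_orthogonal:
  fixes e f :: 'a
  assumes e: "minimal_idempotent e" and f: "minimal_idempotent f"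
    and ef: "\<And>z. e * z * f = 0" "\<And>z. f * z * e = 0"
  shows "Tr (e - f) = 0"
proof -
  interpret E: minimal_idempotent_algebra A e by unfold_locales (rule e)
  interpret G: minimal_idempotent_algebra A f by unfold_locales (rule f)
  have ef0: "e * f = 0" "f * e = 0" using ef[of 1] by simp_all
  define \<alpha> \<beta> where "\<alpha> = E.sc" and "\<beta> = G.sc"
  have one: "\<alpha> 1 = 1" "\<beta> 1 = 1"
    unfolding \<alpha>_def \<beta>_def by (rule E.sc_unique G.sc_unique, simp add: E.ee G.ee scaleC_one)+
  have spec: "nonzero_spectrum (z * (e - f)) = {\<alpha> z, - \<beta> z} - {0}" for z
  proof -
    \<comment> \<open>\<open>e + f\<close> is a right unit for \<open>e - f\<close>. Moved to the
      left by cyclic invariance, it compresses \<open>z\<close> to the two corners, where it is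
      scalar.\<close>
    have "(e - f) * (e + f) = e - f" by (simp add: algebra_simps E.ee G.ee ef0)
    then have "nonzero_spectrum (z * (e - f)) = nonzero_spectrum ((z * (e - f)) * (e + f))"
      by (simp add: mult.assoc)
    also have "\<dots> = nonzero_spectrum ((e + f) * (z * (e - f)))" by (rule nonzero_spectrum_commute)
    also have "(e + f) * (z * (e - f)) = e * z * e - e * z * f + f * z * e - f * z * f"
      by (simp add: algebra_simps)
    also have "\<dots> = \<alpha> z *\<^sub>C e - \<beta> z *\<^sub>C f" by (simp add: ef E.sc_eq G.sc_eq \<alpha>_def \<beta>_def)
    finally show ?thesis
      using nonzero_spectrum_orthogonal_combination[OF E.ee E.e_nonzero G.ee G.e_nonzero ef0] by simp
  qed
  have spec1: "nonzero_spectrum (e - f) = {1, - 1}" using spec[of 1] one by auto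
  have le2: "ecard (nonzero_spectrum (z * (e - f))) \<le> enat 2" for z
  proof -
    have "card ({\<alpha> z, - \<beta> z} - {0}) \<le> card {\<alpha> z, - \<beta> z}" by (intro card_mono) auto
    also have "\<dots> \<le> 2" by (simp add: card_insert_if)
    finally show ?thesis unfolding spec by (simp add: ecard_def)
  qed
  have two: "ecard (nonzero_spectrum (1 * (e - f))) = enat 2" by (simp add: spec1 ecard_def)
  have rank: "spectral_rank (e - f) = enat 2"
    unfolding spectral_rank_def
  proof (rule antisym)
    show "(SUP z. ecard (nonzero_spectrum (z * (e - f)))) \<le> enat 2" by (rule SUP_least) (rule le2)
    show "enat 2 \<le> (SUP z. ecard (nonzero_spectrum (z * (e - f))))"
      unfolding two[symmetric] by (rule SUP_upper) simp
  qed
  have attained: "1 \<in> rank_attained (e - f)"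
    using two by (simp add: rank_attained_def rank)
  obtain K where K: "K > 0" "\<And>z. cmod (\<alpha> z) \<le> norm z * K"
    using bounded_linear.pos_bounded[OF E.bounded_linear_sc] unfolding \<alpha>_def by blast
  obtain K' where K': "K' > 0" "\<And>z. cmod (\<beta> z) \<le> norm z * K'"
    using bounded_linear.pos_bounded[OF G.bounded_linear_sc] unfolding \<beta>_def by blast
  have diff: "\<alpha> z - 1 = \<alpha> (z - 1)" "\<beta> z - 1 = \<beta> (z - 1)" for z
    using E.sc_add[of "z - 1" 1] G.sc_add[of "z - 1" 1] one by (simp_all add: \<alpha>_def \<beta>_def)
  have mult: "multiplicity_at c (e - f) = 1" if c: "c \<in> {1, - 1}" for c
  proof (rule multiplicity_atI[of _ 1])
    show "rank_attained (e - f) \<inter> ball 1 \<epsilon> \<noteq> {}" if "\<epsilon> > 0" for \<epsilon>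
      using attained that by auto
  next
    \<comment> \<open>Disks of radius below \<open>1\<close> about \<open>1\<close> and
      \<open>-1\<close> are disjoint and avoid \<open>0\<close>.\<close>
    fix r :: real assume r: "0 < r" "r < 1"
    have zero: "0 \<notin> ball c r" using c r by auto
    have sp: "spectrum (z * (e - f)) \<inter> ball c r = {\<alpha> z, - \<beta> z} \<inter> ball c r" for z
    proof -
      have "(S - {0}) \<inter> ball c r = S \<inter> ball c r" for S using zero by blast
      then show ?thesis using spec[of z] unfolding nonzero_spectrum_def by metis
    qed
    have near: "{\<alpha> z, - \<beta> z} \<inter> ball c r = {if c = 1 then \<alpha> z else - \<beta> z}"
      if "cmod (\<alpha> z - 1) < r" "cmod (\<beta> z - 1) < r" for z
    proof -
      have far: "1 \<le> cmod (1 + w)" if "cmod (w - 1) < 1" for w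
        using norm_triangle_ineq4[of "1 + w" "w - 1"] that by simp
      have "1 \<le> cmod (1 + \<alpha> z)" "1 \<le> cmod (1 + \<beta> z)" using far that r by auto
      moreover have "cmod (- 1 - \<alpha> z) = cmod (1 + \<alpha> z)" using norm_minus_cancel[of "1 + \<alpha> z"] by simp
      moreover have "cmod (- 1 + \<beta> z) = cmod (\<beta> z - 1)" "cmod (1 - \<alpha> z) = cmod (\<alpha> z - 1)"
        by (simp_all add: norm_minus_commute)
      ultimately show ?thesis using c that r by (auto simp: dist_norm)
    qed
    show "spectrum (e - f) \<inter> ball c r = {c}"
      using sp[of 1] near[of 1] one c r by auto
    define \<epsilon> where "\<epsilon> = min (r / K) (r / K')"
    have "\<epsilon> > 0" using r K(1) K'(1) by (simp add: \<epsilon>_def)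
    moreover have "ecard (spectrum (z * (e - f)) \<inter> ball c r) = enat 1" if "z \<in> ball 1 \<epsilon>" for z
    proof -
      have z: "norm (z - 1) < r / K" "norm (z - 1) < r / K'"
        using that by (simp_all add: \<epsilon>_def dist_norm norm_minus_commute)
      then have "cmod (\<alpha> z - 1) < r" "cmod (\<beta> z - 1) < r"
        using K(1) K(2)[of "z - 1"] K'(1) K'(2)[of "z - 1"] unfolding diff
        by (simp_all add: less_divide_eq)
      then show ?thesis unfolding sp by (simp add: near ecard_def)
    qed
    ultimately show "\<exists>\<epsilon>>0. \<forall>x\<in>rank_attained (e - f) \<inter> ball 1 \<epsilon>.
        ecard (spectrum (x * (e - f)) \<inter> ball c r) = enat 1" by blast
  qed simp
  have "spectrum (e - f) \<subseteq> {0, 1, - 1}" using spec1 by (auto simp: nonzero_spectrum_def)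
  then have "finite (spectrum (e - f))" using finite_subset by blast
  then have "Tr (e - f) = (\<Sum>c\<in>nonzero_spectrum (e - f). c * of_nat (multiplicity_at c (e - f)))"
    unfolding Tr_def nonzero_spectrum_def by (intro sum.mono_neutral_right) auto
  also have "\<dots> = 0" unfolding spec1 by (simp add: mult)
  finally show ?thesis .
qed

lemma commutators_imp_minimal_Soc:
  assumes "\<And>a :: 'a. a \<in> Soc \<Longrightarrow> Tr a = 0 \<Longrightarrow> \<exists>x\<in>Soc. \<exists>y\<in>Soc. a = commutator x y"
  shows "minimal_two_sided_ideal (Soc :: 'a set)"
proof (rule ccontr)
  assume "\<not> ?thesis"
  then obtain J :: "'a set" where "two_sided_ideal J" "J \<subseteq> Soc" "J \<noteq> {0}" "J \<noteq> Soc"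
    using two_sided_ideal_Soc[where 'a = 'a] by (auto simp: minimal_two_sided_ideal_def)
  then obtain e f :: 'a where ef: "minimal_idempotent e" "minimal_idempotent f" "e \<in> Soc" "f \<in> Soc"
    "\<And>z. e * z * f = 0"
    by (rule orthogonal_minimal_idempotents) (rule that)
  interpret minimal_idempotent_algebra A e by unfold_locales (rule ef(1))
  have "Tr (e - f) = 0"
    by (rule Tr_difference_orthogonal[OF ef(1,2,5) annihilator_symmetric[OF ef(5)]])
  moreover have "left_ideal (Soc :: 'a set)"
    using two_sided_ideal_Soc[where 'a = 'a] by (simp add: two_sided_ideal_def)
  then have "e - f \<in> Soc" using left_ideal_diff ef(3,4) by blast
  ultimately show False using assms difference_not_commutator[OF ef(5)] by blast
qed

end

section \<open>Operators on a complex Banach space\<close>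

abbreviation app :: "'x::complex_normed_vector bounded_op \<Rightarrow> 'x \<Rightarrow> 'x" where
  "app T \<equiv> blinfun_apply (blinfun_of_op T)"

lemma app_mult: "app (S * T) \<xi> = app S (app T (\<xi> :: 'x::complex_banach))"
  by transfer simp

lemma app_add: "app (S + T) \<xi> = app S \<xi> + app T \<xi>"
  by transfer (rule blinfun.add_left)

lemma app_diff: "app (S - T) \<xi> = app S \<xi> - app T \<xi>"
  by transfer (rule blinfun.diff_left)

lemma app_zero: "app 0 \<xi> = 0"
  by transfer simp

lemma app_zero_right: "app T 0 = 0"
  by (rule blinfun.zero_right)

lemma app_one: "app 1 \<xi> = (\<xi> :: 'x::complex_banach)"
  by transfer simp

lemma app_nonzero:
  assumes "T \<noteq> 0" obtains \<xi> where "app T \<xi> \<noteq> 0"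
proof -
  have "blinfun_of_op T \<noteq> blinfun_of_op 0" using assms by (simp add: blinfun_of_op_inject)
  then show thesis using that blinfun_eqI[of "blinfun_of_op T" "blinfun_of_op 0"] app_zero by metis
qed

text \<open>The rank-one operator built from a functional that does not vanish at
  \<open>\<xi>\<close>. This transitivity on nonzero vectors underlies both semisimplicity and
  primeness.\<close>

lemma ex_operator_mapping:
  fixes \<xi> \<eta> :: "'x::complex_normed_vector"
  assumes "\<xi> \<noteq> 0" obtains R where "app R \<xi> = \<eta>"
proof -
  obtain \<phi> :: "'x \<Rightarrow> complex" where \<phi>: "bounded_linear \<phi>" "\<And>c x. \<phi> (c *\<^sub>C x) = c * \<phi> x" "\<phi> \<xi> \<noteq> 0"
    using ex_complex_functional[OF assms] by blast
  interpret \<phi>: bounded_linear \<phi> by (rule \<phi>(1))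
  define g where "g x = (\<phi> x / \<phi> \<xi>) *\<^sub>C \<eta>" for x
  obtain K where K: "\<And>x. cmod (\<phi> x) \<le> norm x * K" using \<phi>.bounded by blast
  have "bounded_linear g"
  proof (rule bounded_linear_intro[where K = "K * norm \<eta> / cmod (\<phi> \<xi>)"])
    show "g (x + y) = g x + g y" for x y by (simp add: g_def \<phi>.add add_divide_distrib scaleC_add_left)
    show "g (r *\<^sub>R x) = r *\<^sub>R g x" for r x
      by (simp add: g_def \<phi>(2) scaleR_scaleC scaleC_scaleC scaleR_conv_of_real)
    show "norm (g x) \<le> norm x * (K * norm \<eta> / cmod (\<phi> \<xi>))" for x
      using mult_right_mono[OF K[of x], of "norm \<eta> / cmod (\<phi> \<xi>)"]
      by (simp add: g_def norm_scaleC norm_divide mult.assoc)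
  qed
  then have g: "blinfun_apply (Blinfun g) = g" by (rule bounded_linear_Blinfun_apply)
  have "Blinfun g \<in> {T. \<forall>c x. blinfun_apply T (c *\<^sub>C x) = c *\<^sub>C blinfun_apply T x}"
    by (simp add: g) (simp add: g_def \<phi>(2) scaleC_scaleC)
  then have "app (Op (Blinfun g)) \<xi> = \<eta>"
    using \<phi>(3) by (simp add: Op_inverse g g_def scaleC_one)
  then show thesis by (rule that)
qed

text \<open>If \<open>S\<close> in \<open>J\<close> does not kill \<open>\<xi>\<close>, some
  \<open>R\<close> carries \<open>S \<xi>\<close> back to \<open>\<xi>\<close>. Then
  \<open>T - T * R * S\<close> kills \<open>\<xi>\<close> for every \<open>T\<close>, so
  \<open>T\<close> is in \<open>J\<close>.\<close>

lemma maximal_left_ideal_annihilator: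
  fixes \<xi> :: "'x::complex_banach"
  assumes "\<xi> \<noteq> 0" shows "maximal_left_ideal {S. app S \<xi> = 0}"
proof -
  have "left_ideal {S. app S \<xi> = 0}"
    by (simp add: left_ideal_def app_add app_mult app_zero app_zero_right)
  moreover have "1 \<notin> {S. app S \<xi> = 0}" using assms by (simp add: app_one)
  then have "{S. app S \<xi> = 0} \<noteq> UNIV" by blast
  moreover have "J = UNIV" if J: "left_ideal J" "{S. app S \<xi> = 0} \<subseteq> J" "J \<noteq> {S. app S \<xi> = 0}" for J
  proof -
    obtain S where S: "S \<in> J" "app S \<xi> \<noteq> 0" using J(2,3) by blast
    obtain R where R: "app R (app S \<xi>) = \<xi>" by (rule ex_operator_mapping[OF S(2)])
    have "T \<in> J" for T
    proof -
      have "app (T - T * R * S) \<xi> = 0" by (simp add: app_diff app_mult R)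
      then have "T - T * R * S \<in> J" using J(2) by blast
      moreover have "T * R * S \<in> J" by (rule left_idealD(3)[OF J(1) S(1)])
      ultimately show ?thesis using left_idealD(2)[OF J(1)] by (metis diff_add_cancel)
    qed
    then show ?thesis by blast
  qed
  ultimately show ?thesis unfolding maximal_left_ideal_def by blast
qed

text \<open>The annihilators of single nonzero vectors are maximal left ideals, and only the zero
  operator lies in all of them.\<close>

lemma semisimple_bounded_op: "semisimple TYPE('x::complex_banach bounded_op)"
proof -
  have "T = 0" if T: "T \<in> jacobson_radical" for T :: "'x bounded_op"
  proof (rule ccontr)
    assume "T \<noteq> 0"
    then obtain \<xi> where \<xi>: "app T \<xi> \<noteq> 0" by (rule app_nonzero)
    then have "\<xi> \<noteq> 0" using app_zero_right by metis
    from maximal_left_ideal_annihilator[OF this] T \<xi> show False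
      by (auto simp: jacobson_radical_def)
  qed
  moreover have "(0 :: 'x bounded_op) \<in> jacobson_radical"
    by (auto simp: jacobson_radical_def maximal_left_ideal_def left_ideal_def)
  ultimately show ?thesis by (auto simp: semisimple_def)
qed

lemma bounded_op_prime:
  fixes S T :: "'x::complex_banach bounded_op"
  assumes "S \<noteq> 0" "T \<noteq> 0" obtains R where "S * R * T \<noteq> 0"
proof -
  obtain \<xi> where \<xi>: "app T \<xi> \<noteq> 0" by (rule app_nonzero[OF assms(2)])
  obtain \<eta> where \<eta>: "app S \<eta> \<noteq> 0" by (rule app_nonzero[OF assms(1)])
  obtain R where R: "app R (app T \<xi>) = \<eta>" by (rule ex_operator_mapping[OF \<xi>])
  have "app (S * R * T) \<xi> \<noteq> 0" using R \<eta> by (simp add: app_mult)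
  then have "S * R * T \<noteq> 0" using app_zero by metis
  then show thesis by (rule that)
qed

text \<open>A smaller nonzero ideal in the socle would produce nonzero \<open>e\<close> and
  \<open>f\<close> with \<open>e A f = 0\<close>, which transitivity on vectors excludes.\<close>

lemma minimal_Soc_bounded_op: "minimal_two_sided_ideal (Soc :: 'x::complex_banach bounded_op set)"
proof (rule ccontr)
  interpret semiprime "TYPE('x bounded_op)"
    by (rule semisimple_imp_semiprime[OF semisimple_bounded_op])
  assume "\<not> ?thesis"
  then obtain J :: "'x bounded_op set" where "two_sided_ideal J" "J \<subseteq> Soc" "J \<noteq> {0}" "J \<noteq> Soc"
    using two_sided_ideal_Soc[where 'a = "'x bounded_op"] by (auto simp: minimal_two_sided_ideal_def)
  then obtain e f :: "'x bounded_op" where ef: "minimal_idempotent e" "minimal_idempotent f"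
    "e \<in> Soc" "f \<in> Soc" "\<And>z. e * z * f = 0"
    by (rule orthogonal_minimal_idempotents) (rule that)
  then have "e \<noteq> 0" "f \<noteq> 0" by (auto simp: minimal_idempotent_def)
  then show False using bounded_op_prime ef(5) by metis
qed

theorem theorem4p4:
  shows "(semisimple TYPE('a::complex_banach_algebra_1) \<longrightarrow>
      ((\<forall>a\<in>(Soc :: 'a set). Tr a = 0 \<longrightarrow> (\<exists>x\<in>Soc. \<exists>y\<in>Soc. a = commutator x y))
         \<longleftrightarrow> minimal_two_sided_ideal (Soc :: 'a set))
    \<and> (minimal_two_sided_ideal (Soc :: 'a set) \<longrightarrow>
         (\<forall>a\<in>(Soc :: 'a set). Tr a = 0 \<longrightarrow>
            (\<exists>x\<in>Soc. \<exists>y\<in>Soc. a = commutator x y \<and> spectral_rank x \<le> spectral_rank a \<and> spectral_rank y \<le> spectral_rank a))))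
    \<and> (\<forall>a\<in>(Soc :: 'x::complex_banach bounded_op set). Tr a = 0 \<longrightarrow>
         (\<exists>x\<in>Soc. \<exists>y\<in>Soc. a = commutator x y \<and> spectral_rank x \<le> spectral_rank a \<and> spectral_rank y \<le> spectral_rank a))"
    (is "(?semisimple \<longrightarrow> (?comm \<longleftrightarrow> ?min) \<and> (?min \<longrightarrow> ?bounds)) \<and> ?operators")
proof
  show "?semisimple \<longrightarrow> (?comm \<longleftrightarrow> ?min) \<and> (?min \<longrightarrow> ?bounds)"
  proof
    assume ?semisimple
    then interpret semiprime "TYPE('a)" by (rule semisimple_imp_semiprime)
    have bounds: "?min \<longrightarrow> ?bounds" using minimal_Soc_commutator by blast
    moreover have "?comm \<longrightarrow> ?min" using commutators_imp_minimal_Soc by blast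
    ultimately show "(?comm \<longleftrightarrow> ?min) \<and> (?min \<longrightarrow> ?bounds)" by blast
  qed
  interpret semiprime "TYPE('x bounded_op)"
    by (rule semisimple_imp_semiprime[OF semisimple_bounded_op])
  show ?operators using minimal_Soc_commutator[OF minimal_Soc_bounded_op] by blast
qed

end
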